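(* Let $\mathbb{F}$ be a field, let $a$ and $b$ be odd positive integers, $n=a+b$ and $\lambda=(a,1^b)$. Then $\operatorname{End}_{\mathscr{H}_n}(S_\lambda)$ is one-dimensional over $\mathbb{F}$, where $\mathscr{H}_n=\mathscr{H}_{\mathbb{F},-1}(\mathfrak{S}_n)$. In particular, $S_\lambda$ is indecomposable.
   Context: The algebra. $\mathbb{F}$ is a field, $q=-1$. $\mathscr{H}_n=\mathscr{H}_{\mathbb{F},-1}(\mathfrak{S}_n)$ is the Iwahori--Hecke algebra: the unital associative $\mathbb{F}$-algebra generated by $T_1,\dots,T_{n-1}$ with relations $(T_i-q)(T_i+1)=0$, $T_iT_j=T_jT_i$ for $|i-j|>1$, $T_iT_{i+1}T_i=T_{i+1}T_iT_{i+1}$. By a theorem of Brundan and Kleshchev it is isomorphic to, and is identified with, the unital associative $\mathbb{F}$-algebra with generators $y_1,\dots,y_n$, $\psi_1,\dots,\psi_{n-1}$, $e(i)$ ($i=(i_1,\dots,i_n)\in\{0,1\}^n$) and relations: $y_1=0$; $e(i)=0$ if $i_1=1$; $e(i)e(j)=\delta_{ij}e(i)$; $\sum_i e(i)=1$; $y_re(i)=e(i)y_r$; $\psi_re(i)=e(s_r\cdot i)\psi_r$, where $s_r\cdot i$ swaps the $r$-th and $(r+1)$-th terms of $i$; $y_sy_r=y_ry_s$; $y_s\psi_r=\psi_ry_s$ if $s\neq r,r+1$; $y_r\psi_re(i)=(\psi_ry_{r+1}-\delta_{i_r,i_{r+1}})e(i)$; $y_{r+1}\psi_re(i)=(\psi_ry_r+\delta_{i_r,i_{r+1}})e(i)$;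 $\psi_s\psi_r=\psi_r\psi_s$ if $s\neq r\pm1$; $\psi_r^2e(i)=0$ if $i_r=i_{r+1}$ and $\psi_r^2e(i)=-(y_r-y_{r+1})^2e(i)$ if $i_r\neq i_{r+1}$; $\psi_r\psi_{r+1}\psi_re(i)=\psi_{r+1}\psi_r\psi_{r+1}e(i)$ if $i_r=i_{r+1}$ or $i_{r+1}=i_{r+2}$; $\psi_r\psi_{r+1}\psi_re(i)=(\psi_{r+1}\psi_r\psi_{r+1}+y_r-2y_{r+1}+y_{r+2})e(i)$ if $i_r\neq i_{r+1}\neq i_{r+2}$. The Specht module. For a hook partition $\lambda=(a,1^b)$ of $n=a+b$, the node in row $r$ and column $c$ has residue $c-r\pmod 2$; $T_\lambda$ is the tableau with $1,\dots,n$ entered consecutively down the columns (so $1,\dots,b+1$ down the first column, then $b+2,\dots,n$ along the rest of the first row), and $i_\lambda\in\{0,1\}^n$ is the sequence whose $k$-th term is the residue of the node containing $k$ in $T_\lambda$. $S_\lambda$ is the left $\mathscr{H}_n$-module generated by $z$ subject to: $y_kz=0$ for all $k$; $e(i)z=\delta_{i,i_\lambda}z$ for all $i$; $\psi_jz=0$ for all $j\neq b+1$; $\psi_1\psi_2\cdots\psi_{b+1}z=0$ (the last relation being omitted when $a=1$). *)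

theory Defs
  imports
    "HOL-Library.Poly_Mapping"
    "HOL-Algebra.Embedded_Algebras"
    "HOL-Algebra.QuotRing"
    "HOL-Algebra.Module"
    "HOL-Combinatorics.Transposition"
begin

section \<open>Free algebras and algebras given by generators and relations\<close>

datatype 'x free_monoid = Word (letters: "'x list")

instantiation free_monoid :: (type) monoid_add
begin
definition zero_free_monoid :: "'a free_monoid" where "0 = Word []"
definition plus_free_monoid :: "'a free_monoid \<Rightarrow> 'a free_monoid \<Rightarrow> 'a free_monoid"
  where "u + v = Word (letters u @ letters v)"
instance by standard (auto simp: zero_free_monoid_def plus_free_monoid_def)
end

text \<open>
  Finitely supported functions on words, with the convolution product of
  \<^theory>\<open>HOL-Library.Poly_Mapping\<close>: the monoid algebra of the free monoid, i.e. the free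
  unital associative algebra over \<open>'f\<close> on the letters \<open>'x\<close>.
\<close>

type_synonym ('x, 'f) free_alg = "'x free_monoid \<Rightarrow>\<^sub>0 'f"

definition gen :: "'x \<Rightarrow> ('x, 'f::field) free_alg"
  where "gen x = Poly_Mapping.single (Word [x]) 1"

definition const :: "'f \<Rightarrow> ('x, 'f::field) free_alg"
  where "const c = Poly_Mapping.single 0 c"

definition free_algebra :: "'x set \<Rightarrow> ('x, 'f::field) free_alg ring"
  where "free_algebra X =
    \<lparr>carrier = {p. \<forall>w \<in> Poly_Mapping.keys p. set (letters w) \<subseteq> X},
     mult = (*), one = 1, zero = 0, add = (+)\<rparr>"

text \<open>\<^const>\<open>genideal\<close> generates two-sided ideals.\<close>

definition relation_ideal ::
    "'x set \<Rightarrow> ('x, 'f::field) free_alg set \<Rightarrow> ('x, 'f) free_alg set"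
  where "relation_ideal X R = genideal (free_algebra X) R"

definition presented_algebra ::
    "'x set \<Rightarrow> ('x, 'f::field) free_alg set \<Rightarrow> ('x, 'f) free_alg set ring"
  where "presented_algebra X R = free_algebra X Quot relation_ideal X R"

definition presented_class ::
    "'x set \<Rightarrow> ('x, 'f::field) free_alg set \<Rightarrow> ('x, 'f) free_alg \<Rightarrow> ('x, 'f) free_alg set"
  where "presented_class X R p = relation_ideal X R +>\<^bsub>free_algebra X\<^esub> p"


section \<open>Left modules over a not necessarily commutative ring\<close>

text \<open>
  The library's \<^locale>\<open>module\<close> requires a commutative ring. The fields \<open>mult\<close> and \<open>one\<close> of the
  record type \<^type>\<open>module\<close> play no role here. The library's \<^locale>\<open>submodule\<close> does not require
  commutativity.
\<close>

locale left_module = R?: ring R + M?: abelian_group M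
  for R :: "('r, 'x) ring_scheme" (structure) and M :: "('r, 'm, 'z) module_scheme" (structure) +
  assumes smult_closed:
      "\<lbrakk>a \<in> carrier R; x \<in> carrier M\<rbrakk> \<Longrightarrow> a \<odot>\<^bsub>M\<^esub> x \<in> carrier M"
    and smult_l_distr:
      "\<lbrakk>a \<in> carrier R; b \<in> carrier R; x \<in> carrier M\<rbrakk> \<Longrightarrow>
       (a \<oplus> b) \<odot>\<^bsub>M\<^esub> x = a \<odot>\<^bsub>M\<^esub> x \<oplus>\<^bsub>M\<^esub> b \<odot>\<^bsub>M\<^esub> x"
    and smult_r_distr:
      "\<lbrakk>a \<in> carrier R; x \<in> carrier M; y \<in> carrier M\<rbrakk> \<Longrightarrow>
       a \<odot>\<^bsub>M\<^esub> (x \<oplus>\<^bsub>M\<^esub> y) = a \<odot>\<^bsub>M\<^esub> x \<oplus>\<^bsub>M\<^esub> a \<odot>\<^bsub>M\<^esub> y"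
    and smult_assoc:
      "\<lbrakk>a \<in> carrier R; b \<in> carrier R; x \<in> carrier M\<rbrakk> \<Longrightarrow>
       (a \<otimes> b) \<odot>\<^bsub>M\<^esub> x = a \<odot>\<^bsub>M\<^esub> (b \<odot>\<^bsub>M\<^esub> x)"
    and smult_one:
      "x \<in> carrier M \<Longrightarrow> \<one> \<odot>\<^bsub>M\<^esub> x = x"

definition regular_module :: "('r, 'x) ring_scheme \<Rightarrow> ('r, 'r) module"
  where "regular_module R =
    \<lparr>carrier = carrier R, mult = mult R, one = one R, zero = zero R, add = add R, smult = mult R\<rparr>"

definition generated_submodule :: "('r, 'x) ring_scheme \<Rightarrow> ('r, 'm, 'z) module_scheme \<Rightarrow> 'm set \<Rightarrow> 'm set"
  where "generated_submodule R M A = \<Inter>{N. submodule N R M \<and> A \<subseteq> N}"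

definition quotient_module :: "('r, 'm, 'z) module_scheme \<Rightarrow> 'm set \<Rightarrow> ('r, 'm set) module"
  where "quotient_module M N =
    \<lparr>carrier = a_rcosets\<^bsub>M\<^esub> N, mult = undefined, one = undefined, zero = N, add = set_add M,
     smult = (\<lambda>h C. \<Union>x\<in>C. N +>\<^bsub>M\<^esub> (h \<odot>\<^bsub>M\<^esub> x))\<rparr>"

text \<open>
  The left module generated by one element \<open>z\<close> subject to \<open>h z = 0\<close> for all \<open>h \<in> A\<close>: the quotient
  of the regular module by the left ideal generated by \<open>A\<close>, where \<open>z\<close> is the class of \<open>1\<close>.
\<close>

definition presented_cyclic_module :: "('r, 'x) ring_scheme \<Rightarrow> 'r set \<Rightarrow> ('r, 'r set) module"
  where "presented_cyclic_module R A =
    quotient_module (regular_module R) (generated_submodule R (regular_module R) A)"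

text \<open>
  Endomorphisms are made extensional (equal to \<^const>\<open>undefined\<close> outside the carrier), so that
  equality of endomorphisms is equality of functions.
\<close>

definition module_endos :: "('r, 'x) ring_scheme \<Rightarrow> ('r, 'm, 'z) module_scheme \<Rightarrow> ('m \<Rightarrow> 'm) set"
  where "module_endos R M =
    {f \<in> carrier M \<rightarrow>\<^sub>E carrier M.
      (\<forall>x\<in>carrier M. \<forall>y\<in>carrier M. f (x \<oplus>\<^bsub>M\<^esub> y) = f x \<oplus>\<^bsub>M\<^esub> f y) \<and>
      (\<forall>h\<in>carrier R. \<forall>x\<in>carrier M. f (h \<odot>\<^bsub>M\<^esub> x) = h \<odot>\<^bsub>M\<^esub> f x)}"

definition End_ring :: "('r, 'x) ring_scheme \<Rightarrow> ('r, 'm, 'z) module_scheme \<Rightarrow> ('m \<Rightarrow> 'm) ring"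
  where "End_ring R M =
    \<lparr>carrier = module_endos R M,
     mult = compose (carrier M),
     one = (\<lambda>x\<in>carrier M. x),
     zero = (\<lambda>x\<in>carrier M. \<zero>\<^bsub>M\<^esub>),
     add = (\<lambda>f g. \<lambda>x\<in>carrier M. f x \<oplus>\<^bsub>M\<^esub> g x)\<rparr>"

definition indecomposable :: "('r, 'x) ring_scheme \<Rightarrow> ('r, 'm, 'z) module_scheme \<Rightarrow> bool"
  where "indecomposable R M \<longleftrightarrow>
    carrier M \<noteq> {\<zero>\<^bsub>M\<^esub>} \<and>
    \<not> (\<exists>N1 N2. submodule N1 R M \<and> submodule N2 R M \<and>
          N1 \<noteq> {\<zero>\<^bsub>M\<^esub>} \<and> N2 \<noteq> {\<zero>\<^bsub>M\<^esub>} \<and>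
          N1 \<inter> N2 = {\<zero>\<^bsub>M\<^esub>} \<and> N1 <+>\<^bsub>M\<^esub> N2 = carrier M)"


section \<open>The Iwahori--Hecke algebra with \<open>q = -1\<close> in the Brundan--Kleshchev presentation\<close>

text \<open>Residue sequences are 1-based: \<open>i\<^sub>r\<close> is \<open>i r\<close> for \<open>1 \<le> r \<le> n\<close>.\<close>

definition residue_seqs :: "nat \<Rightarrow> (nat \<Rightarrow> nat) set"
  where "residue_seqs n = {1..n} \<rightarrow>\<^sub>E {0, 1}"

datatype klr_gen = Y nat | Psi nat | E "nat \<Rightarrow> nat"

definition klr_gens :: "nat \<Rightarrow> klr_gen set"
  where "klr_gens n = Y ` {1..n} \<union> Psi ` {1..<n} \<union> E ` residue_seqs n"

abbreviation y_gen :: "nat \<Rightarrow> (klr_gen, 'f::field) free_alg"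
  where "y_gen r \<equiv> gen (Y r)"
abbreviation psi_gen :: "nat \<Rightarrow> (klr_gen, 'f::field) free_alg"
  where "psi_gen r \<equiv> gen (Psi r)"
abbreviation e_gen :: "(nat \<Rightarrow> nat) \<Rightarrow> (klr_gen, 'f::field) free_alg"
  where "e_gen i \<equiv> gen (E i)"

text \<open>A relation \<open>u = v\<close> is represented by the element \<open>u - v\<close> of the free algebra.\<close>

inductive_set klr_relators :: "nat \<Rightarrow> (klr_gen, 'f::field) free_alg set" for n :: nat
  where
    y_1: "1 \<le> n \<Longrightarrow> y_gen 1 \<in> klr_relators n"
  | e_1: "\<lbrakk>i \<in> residue_seqs n; 1 \<le> n; i 1 = 1\<rbrakk> \<Longrightarrow> e_gen i \<in> klr_relators n"
  | e_e: "\<lbrakk>i \<in> residue_seqs n; j \<in> residue_seqs n\<rbrakk> \<Longrightarrow>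
      e_gen i * e_gen j - of_bool (i = j) * e_gen i \<in> klr_relators n"
  | e_sum: "(\<Sum>i\<in>residue_seqs n. e_gen i) - 1 \<in> klr_relators n"
  | y_e: "\<lbrakk>1 \<le> r; r \<le> n; i \<in> residue_seqs n\<rbrakk> \<Longrightarrow>
      y_gen r * e_gen i - e_gen i * y_gen r \<in> klr_relators n"
  | psi_e: "\<lbrakk>1 \<le> r; r < n; i \<in> residue_seqs n\<rbrakk> \<Longrightarrow>
      psi_gen r * e_gen i - e_gen (i \<circ> transpose r (r + 1)) * psi_gen r \<in> klr_relators n"
  | y_y: "\<lbrakk>1 \<le> r; r \<le> n; 1 \<le> s; s \<le> n\<rbrakk> \<Longrightarrow>
      y_gen s * y_gen r - y_gen r * y_gen s \<in> klr_relators n"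
  | y_psi: "\<lbrakk>1 \<le> r; r < n; 1 \<le> s; s \<le> n; s \<noteq> r; s \<noteq> r + 1\<rbrakk> \<Longrightarrow>
      y_gen s * psi_gen r - psi_gen r * y_gen s \<in> klr_relators n"
  | y_psi_left: "\<lbrakk>1 \<le> r; r < n; i \<in> residue_seqs n\<rbrakk> \<Longrightarrow>
      y_gen r * psi_gen r * e_gen i
        - (psi_gen r * y_gen (r + 1) - of_bool (i r = i (r + 1))) * e_gen i \<in> klr_relators n"
  | y_psi_right: "\<lbrakk>1 \<le> r; r < n; i \<in> residue_seqs n\<rbrakk> \<Longrightarrow>
      y_gen (r + 1) * psi_gen r * e_gen i
        - (psi_gen r * y_gen r + of_bool (i r = i (r + 1))) * e_gen i \<in> klr_relators n"
  | psi_psi: "\<lbrakk>1 \<le> r; r < n; 1 \<le> s; s < n; s \<noteq> r + 1; r \<noteq> s + 1\<rbrakk> \<Longrightarrow>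
      psi_gen s * psi_gen r - psi_gen r * psi_gen s \<in> klr_relators n"
  | psi_sq_eq: "\<lbrakk>1 \<le> r; r < n; i \<in> residue_seqs n; i r = i (r + 1)\<rbrakk> \<Longrightarrow>
      psi_gen r ^ 2 * e_gen i \<in> klr_relators n"
  | psi_sq_neq: "\<lbrakk>1 \<le> r; r < n; i \<in> residue_seqs n; i r \<noteq> i (r + 1)\<rbrakk> \<Longrightarrow>
      psi_gen r ^ 2 * e_gen i - (- ((y_gen r - y_gen (r + 1)) ^ 2 * e_gen i)) \<in> klr_relators n"
  | braid: "\<lbrakk>1 \<le> r; r + 1 < n; i \<in> residue_seqs n; i r = i (r + 1) \<or> i (r + 1) = i (r + 2)\<rbrakk> \<Longrightarrow>
      psi_gen r * psi_gen (r + 1) * psi_gen r * e_gen i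
        - psi_gen (r + 1) * psi_gen r * psi_gen (r + 1) * e_gen i \<in> klr_relators n"
  | braid_neq: "\<lbrakk>1 \<le> r; r + 1 < n; i \<in> residue_seqs n; i r \<noteq> i (r + 1); i (r + 1) \<noteq> i (r + 2)\<rbrakk> \<Longrightarrow>
      psi_gen r * psi_gen (r + 1) * psi_gen r * e_gen i
        - (psi_gen (r + 1) * psi_gen r * psi_gen (r + 1)
             + y_gen r - 2 * y_gen (r + 1) + y_gen (r + 2)) * e_gen i \<in> klr_relators n"

type_synonym 'f hecke = "(klr_gen, 'f) free_alg set"

definition hecke_algebra :: "nat \<Rightarrow> 'f::field hecke ring"
  where "hecke_algebra n = presented_algebra (klr_gens n) (klr_relators n)"

definition hecke_class :: "nat \<Rightarrow> (klr_gen, 'f::field) free_alg \<Rightarrow> 'f hecke"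
  where "hecke_class n = presented_class (klr_gens n) (klr_relators n)"

text \<open>
  The endomorphisms \<open>x \<mapsto> c x\<close> for \<open>c\<close> in the ground field \<open>'f\<close>. The vector space structure of an
  endomorphism ring over \<open>'f\<close> is multiplication by these.
\<close>

definition scalar_endos ::
    "nat \<Rightarrow> ('f::field hecke, 'm, 'z) module_scheme \<Rightarrow> ('m \<Rightarrow> 'm) set"
  where "scalar_endos n M = range (\<lambda>c. \<lambda>x\<in>carrier M. hecke_class n (const c) \<odot>\<^bsub>M\<^esub> x)"


section \<open>Specht modules for hook partitions\<close>

text \<open>The node \<open>(row, column)\<close> of \<open>(a, 1\<^sup>b)\<close> containing \<open>k\<close> in the column-wise tableau.\<close>

definition hook_node :: "nat \<Rightarrow> nat \<Rightarrow> nat \<times> nat"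
  where "hook_node b k = (if k \<le> b + 1 then (k, 1) else (1, k - b))"

definition residue :: "nat \<times> nat \<Rightarrow> nat"
  where "residue = (\<lambda>(r, c). nat ((int c - int r) mod 2))"

definition hook_residue_seq :: "nat \<Rightarrow> nat \<Rightarrow> nat \<Rightarrow> nat"
  where "hook_residue_seq a b = (\<lambda>k\<in>{1..a + b}. residue (hook_node b k))"

definition specht_relators :: "nat \<Rightarrow> nat \<Rightarrow> (klr_gen, 'f::field) free_alg set"
  where "specht_relators a b =
    y_gen ` {1..a + b}
    \<union> (\<lambda>i. e_gen i - of_bool (i = hook_residue_seq a b)) ` residue_seqs (a + b)
    \<union> psi_gen ` ({1..<a + b} - {b + 1})
    \<union> (if a = 1 then {} else {prod_list (map psi_gen [1..<b + 2])})"

definition specht_module :: "nat \<Rightarrow> nat \<Rightarrow> ('f::field hecke, 'f hecke set) module"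
  where "specht_module a b =
    presented_cyclic_module (hecke_algebra (a + b)) (hecke_class (a + b) ` specht_relators a b)"

section \<open>Well-definedness\<close>

lemma free_algebra_ring: "ring (free_algebra X :: ('x,'f::field) free_alg ring)"
proof (rule ringI)
  show "abelian_group (free_algebra X :: ('x,'f::field) free_alg ring)"
  proof (rule abelian_groupI)
    fix p assume p: "p \<in> carrier (free_algebra X :: ('x,'f::field) free_alg ring)"
    show "\<exists>q\<in>carrier (free_algebra X). q \<oplus>\<^bsub>free_algebra X\<^esub> p = \<zero>\<^bsub>free_algebra X\<^esub>"
      using p by (intro bexI[of _ "- p"]) (auto simp: free_algebra_def)
  qed (auto simp: free_algebra_def ac_simps dest: subsetD[OF keys_add])
  show "monoid (free_algebra X :: ('x,'f::field) free_alg ring)"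
  proof (rule monoidI)
    fix p q assume pq: "p \<in> carrier (free_algebra X :: ('x,'f::field) free_alg ring)"
      "q \<in> carrier (free_algebra X :: ('x,'f::field) free_alg ring)"
    show "p \<otimes>\<^bsub>free_algebra X\<^esub> q \<in> carrier (free_algebra X)"
      using pq keys_mult[of p q] unfolding free_algebra_def
      by (fastforce simp: plus_free_monoid_def)
  qed (auto simp: free_algebra_def ac_simps zero_free_monoid_def mult.assoc)
qed (auto simp: free_algebra_def algebra_simps)

lemma free_algebra_closed:
  fixes p q :: "('x, 'f::field) free_alg"
  shows "0 \<in> carrier (free_algebra X :: ('x, 'f) free_alg ring)"
    and "1 \<in> carrier (free_algebra X :: ('x, 'f) free_alg ring)"
    and "p \<in> carrier (free_algebra X) \<Longrightarrow> q \<in> carrier (free_algebra X) \<Longrightarrow> p + q \<in> carrier (free_algebra X)"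
    and "p \<in> carrier (free_algebra X) \<Longrightarrow> q \<in> carrier (free_algebra X) \<Longrightarrow> p * q \<in> carrier (free_algebra X)"
    and "p \<in> carrier (free_algebra X) \<Longrightarrow> - p \<in> carrier (free_algebra X)"
    and "x \<in> X \<Longrightarrow> gen x \<in> carrier (free_algebra X :: ('x, 'f) free_alg ring)"
    and "const c \<in> carrier (free_algebra X :: ('x, 'f) free_alg ring)"
proof -
  interpret ring "free_algebra X :: ('x, 'f) free_alg ring" by (rule free_algebra_ring)
  have ops: "\<zero>\<^bsub>free_algebra X\<^esub> = (0 :: ('x, 'f) free_alg)"
    "\<one>\<^bsub>free_algebra X\<^esub> = (1 :: ('x, 'f) free_alg)"
    "u \<oplus>\<^bsub>free_algebra X\<^esub> v = u + v" "u \<otimes>\<^bsub>free_algebra X\<^esub> v = u * v"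
    for u v :: "('x, 'f) free_alg"
    by (simp_all add: free_algebra_def)
  note closed = zero_closed one_closed a_closed[of p q] m_closed[of p q]
  show "0 \<in> carrier (free_algebra X :: ('x, 'f) free_alg ring)"
    "1 \<in> carrier (free_algebra X :: ('x, 'f) free_alg ring)"
    "p \<in> carrier (free_algebra X) \<Longrightarrow> q \<in> carrier (free_algebra X) \<Longrightarrow> p + q \<in> carrier (free_algebra X)"
    "p \<in> carrier (free_algebra X) \<Longrightarrow> q \<in> carrier (free_algebra X) \<Longrightarrow> p * q \<in> carrier (free_algebra X)"
    using closed unfolding ops by blast+
  show "p \<in> carrier (free_algebra X) \<Longrightarrow> - p \<in> carrier (free_algebra X)"
    by (simp add: free_algebra_def)
  show "x \<in> X \<Longrightarrow> gen x \<in> carrier (free_algebra X :: ('x, 'f) free_alg ring)"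
    by (simp add: free_algebra_def gen_def)
  show "const c \<in> carrier (free_algebra X :: ('x, 'f) free_alg ring)"
    by (simp add: free_algebra_def const_def zero_free_monoid_def)
qed

lemma free_algebra_closed':
  "p \<in> carrier (free_algebra X) \<Longrightarrow> q \<in> carrier (free_algebra X) \<Longrightarrow> p - q \<in> carrier (free_algebra X)"
  "p \<in> carrier (free_algebra X) \<Longrightarrow> p ^ k \<in> carrier (free_algebra X)"
  "of_bool P \<in> carrier (free_algebra X)"
  "2 \<in> carrier (free_algebra X)"
  "(\<And>i. i \<in> A \<Longrightarrow> g i \<in> carrier (free_algebra X)) \<Longrightarrow> sum g A \<in> carrier (free_algebra X)"
  "(\<And>i. i \<in> set l \<Longrightarrow> g i \<in> carrier (free_algebra X)) \<Longrightarrow> prod_list (map g l) \<in> carrier (free_algebra X)"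
  for p q :: "('x,'f::field) free_alg"
  subgoal using free_algebra_closed(3)[OF _ free_algebra_closed(5), of p X q] by simp
  subgoal by (induction k) (auto intro: free_algebra_closed)
  subgoal by (cases P) (auto intro: free_algebra_closed)
  subgoal unfolding one_add_one[symmetric] by (intro free_algebra_closed)
  subgoal by (induction A rule: infinite_finite_induct) (auto intro: free_algebra_closed)
  subgoal by (induction l) (auto intro: free_algebra_closed)
  done

lemma residue_seqs_transpose: "i \<in> residue_seqs n \<Longrightarrow> 1 \<le> r \<Longrightarrow> r < n \<Longrightarrow> i \<circ> transpose r (Suc r) \<in> residue_seqs n"
  unfolding residue_seqs_def
  by (auto simp: PiE_def Pi_def extensional_def transpose_def)

lemma klr_relators_closed: "klr_relators n \<subseteq> carrier (free_algebra (klr_gens n))"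
proof
  fix p assume "p \<in> klr_relators n" then show "p \<in> carrier (free_algebra (klr_gens n))"
    by (cases) (auto intro!: free_algebra_closed free_algebra_closed' residue_seqs_transpose simp: klr_gens_def)
qed

lemma hook_residue_seq_mem: "hook_residue_seq a b \<in> residue_seqs (a+b)"
  by (auto simp: hook_residue_seq_def residue_seqs_def residue_def split: prod.splits)

lemma specht_relators_closed: "b \<ge> 1 \<Longrightarrow> a \<ge> 1 \<Longrightarrow> specht_relators a b \<subseteq> carrier (free_algebra (klr_gens (a+b)))"
  by (auto simp: specht_relators_def klr_gens_def simp del: upt_Suc
     intro!: free_algebra_closed free_algebra_closed' )

lemma ideal_relation_ideal: "R \<subseteq> carrier (free_algebra X) \<Longrightarrow> ideal (relation_ideal X R) (free_algebra X)"
  unfolding relation_ideal_def by (rule ring.genideal_ideal[OF free_algebra_ring])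

lemma ring_hecke_algebra: "ring (hecke_algebra n :: 'f::field hecke ring)"
  unfolding hecke_algebra_def presented_algebra_def
  by (rule ideal.quotient_is_ring[OF ideal_relation_ideal[OF klr_relators_closed]])

lemma hecke_class_closed: "p \<in> carrier (free_algebra (klr_gens n)) \<Longrightarrow> hecke_class n p \<in> carrier (hecke_algebra n)"
  by (auto simp: hecke_algebra_def hecke_class_def presented_algebra_def presented_class_def FactRing_def A_RCOSETS_def')


lemma left_module_regular:
  fixes R (structure)
  assumes "ring R"
  shows "left_module R (regular_module R)"
proof -
  interpret ring R by (rule assms)
  show ?thesis
  proof (intro left_module.intro left_module_axioms.intro)
    show "abelian_group (regular_module R)"
    proof (rule abelian_groupI)
      fix x assume "x \<in> carrier (regular_module R)"
      then show "\<exists>y\<in>carrier (regular_module R).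
          y \<oplus>\<^bsub>regular_module R\<^esub> x = \<zero>\<^bsub>regular_module R\<^esub>"
        by (intro bexI[of _ "\<ominus> x"]) (auto simp: regular_module_def l_neg)
    qed (auto simp: regular_module_def a_ac)
  qed (auto simp: regular_module_def l_distr r_distr m_assoc ring_axioms)
qed

context left_module begin

lemma abelian_subgroup_submodule:
  assumes "submodule N R M"
  shows "abelian_subgroup N M"
proof (rule abelian_subgroupI3)
  interpret N: submodule N R M by (rule assms)
  show "additive_subgroup N M"
    by (rule additive_subgroup.intro) (rule N.subgroup_axioms)
qed (rule M.abelian_group_axioms)

lemma quotient_module_simps:
  assumes "submodule N R M"
  shows "carrier (quotient_module M N) = (\<lambda>x. N +>\<^bsub>M\<^esub> x) ` carrier M"
    and "\<zero>\<^bsub>quotient_module M N\<^esub> = N +>\<^bsub>M\<^esub> \<zero>\<^bsub>M\<^esub>"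
    and "\<lbrakk>x \<in> carrier M; y \<in> carrier M\<rbrakk> \<Longrightarrow>
      (N +>\<^bsub>M\<^esub> x) \<oplus>\<^bsub>quotient_module M N\<^esub> (N +>\<^bsub>M\<^esub> y) = N +>\<^bsub>M\<^esub> (x \<oplus>\<^bsub>M\<^esub> y)"
proof -
  interpret N: abelian_subgroup N M by (rule abelian_subgroup_submodule[OF assms])
  show "carrier (quotient_module M N) = (\<lambda>x. N +>\<^bsub>M\<^esub> x) ` carrier M"
    by (auto simp: quotient_module_def A_RCOSETS_def')
  show "\<zero>\<^bsub>quotient_module M N\<^esub> = N +>\<^bsub>M\<^esub> \<zero>\<^bsub>M\<^esub>"
    using N.a_subset by (simp add: quotient_module_def M.a_coset_add_zero)
  show "\<lbrakk>x \<in> carrier M; y \<in> carrier M\<rbrakk> \<Longrightarrow>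
      (N +>\<^bsub>M\<^esub> x) \<oplus>\<^bsub>quotient_module M N\<^esub> (N +>\<^bsub>M\<^esub> y) = N +>\<^bsub>M\<^esub> (x \<oplus>\<^bsub>M\<^esub> y)"
    by (simp add: quotient_module_def N.a_rcos_sum)
qed

lemma abelian_group_quotient_module:
  assumes "submodule N R M"
  shows "abelian_group (quotient_module M N)"
proof (rule abelian_groupI)
  note simps = quotient_module_simps[OF assms]
  fix C assume "C \<in> carrier (quotient_module M N)"
  then obtain x where x: "x \<in> carrier M" "C = N +>\<^bsub>M\<^esub> x" by (auto simp: simps)
  then show "\<exists>D\<in>carrier (quotient_module M N).
      D \<oplus>\<^bsub>quotient_module M N\<^esub> C = \<zero>\<^bsub>quotient_module M N\<^esub>"
    by (intro bexI[of _ "N +>\<^bsub>M\<^esub> (\<ominus>\<^bsub>M\<^esub> x)"]) (auto simp: simps M.l_neg)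
qed (auto simp: quotient_module_simps[OF assms] M.a_ac)

lemma quotient_module_smult:
  assumes "submodule N R M" "h \<in> carrier R" "x \<in> carrier M"
  shows "h \<odot>\<^bsub>quotient_module M N\<^esub> (N +>\<^bsub>M\<^esub> x) = N +>\<^bsub>M\<^esub> (h \<odot>\<^bsub>M\<^esub> x)"
proof -
  interpret N: abelian_subgroup N M by (rule abelian_subgroup_submodule[OF assms(1)])
  have "N +>\<^bsub>M\<^esub> (h \<odot>\<^bsub>M\<^esub> y) = N +>\<^bsub>M\<^esub> (h \<odot>\<^bsub>M\<^esub> x)" if "y \<in> N +>\<^bsub>M\<^esub> x" for y
  proof -
    have "y \<in> (\<Union>z\<in>N. {z \<oplus>\<^bsub>M\<^esub> x})"
      using that unfolding a_r_coset_def'[of M N x] .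
    then obtain z where z: "z \<in> N" "y = z \<oplus>\<^bsub>M\<^esub> x" by blast
    then have zc: "z \<in> carrier M" using N.a_subset by blast
    have eq: "h \<odot>\<^bsub>M\<^esub> y = h \<odot>\<^bsub>M\<^esub> z \<oplus>\<^bsub>M\<^esub> h \<odot>\<^bsub>M\<^esub> x"
      unfolding z(2) by (rule smult_r_distr[OF assms(2) zc assms(3)])
    have "h \<odot>\<^bsub>M\<^esub> z \<in> N" by (rule submodule.smult_closed[OF assms(1,2) z(1)])
    then have "h \<odot>\<^bsub>M\<^esub> y \<in> N +>\<^bsub>M\<^esub> (h \<odot>\<^bsub>M\<^esub> x)"
      unfolding eq a_r_coset_def'[of M N "h \<odot>\<^bsub>M\<^esub> x"] by blast
    then show ?thesis
      using N.a_repr_independence'[OF _ smult_closed[OF assms(2,3)]] by metis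
  qed
  moreover have "x \<in> N +>\<^bsub>M\<^esub> x" using assms(3) by (rule N.a_rcos_self)
  ultimately have "(\<Union>y\<in>N +>\<^bsub>M\<^esub> x. N +>\<^bsub>M\<^esub> (h \<odot>\<^bsub>M\<^esub> y)) = N +>\<^bsub>M\<^esub> (h \<odot>\<^bsub>M\<^esub> x)"
    by (intro UN_constant_eq) blast+
  then show ?thesis by (simp only: quotient_module_def module.simps)
qed

lemma left_module_quotient_module:
  assumes "submodule N R M"
  shows "left_module R (quotient_module M N)"
proof (intro left_module.intro left_module_axioms.intro)
  show "abelian_group (quotient_module M N)"
    by (rule abelian_group_quotient_module[OF assms])
qed (auto simp: quotient_module_simps[OF assms] quotient_module_smult[OF assms] smult_closed
    smult_l_distr smult_r_distr smult_assoc smult_one ring_axioms)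

lemma generated_submodule_submodule: assumes "A \<subseteq> carrier M" shows "submodule (generated_submodule R M A) R M \<and> A \<subseteq> generated_submodule R M A"
proof -
  have 1: "submodule (carrier M) R M"
    using a_group by (auto simp: submodule_def submodule_axioms_def smult_closed intro: group.subgroup_self[of "add_monoid M", simplified])
  show ?thesis
    unfolding generated_submodule_def submodule_def
    apply (intro conjI)
    subgoal
      apply (rule group.subgroups_Inter[OF a_group])
      using 1 assms by (auto simp: submodule_def)
    subgoal by (auto simp: submodule_axioms_def)
    subgoal by auto
    done
qed

lemma ring_End_ring: "ring (End_ring R M)"
proof (rule ringI)
  have car: "carrier (End_ring R M) = module_endos R M"
    and add: "\<And>f g. f \<oplus>\<^bsub>End_ring R M\<^esub> g = (\<lambda>x\<in>carrier M. f x \<oplus>\<^bsub>M\<^esub> g x)"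
    and zero: "\<zero>\<^bsub>End_ring R M\<^esub> = (\<lambda>x\<in>carrier M. \<zero>\<^bsub>M\<^esub>)"
    and one: "\<one>\<^bsub>End_ring R M\<^esub> = (\<lambda>x\<in>carrier M. x)"
    and mult: "\<And>f g. f \<otimes>\<^bsub>End_ring R M\<^esub> g = (\<lambda>x\<in>carrier M. f (g x))"
    by (simp_all add: End_ring_def compose_def)
  have sc: "f x \<in> carrier M" if "f \<in> module_endos R M" "x \<in> carrier M" for f x
    using that by (auto simp: module_endos_def)
  have f_add: "f (x \<oplus>\<^bsub>M\<^esub> y) = f x \<oplus>\<^bsub>M\<^esub> f y"
    if "f \<in> module_endos R M" "x \<in> carrier M" "y \<in> carrier M" for f x y
    using that by (auto simp: module_endos_def)
  have eqI: "f = (\<lambda>x\<in>carrier M. g x)"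
    if "f \<in> module_endos R M" "\<And>x. x \<in> carrier M \<Longrightarrow> f x = g x" for f g
    using that by (auto simp: module_endos_def PiE_def extensional_def restrict_def fun_eq_iff)
  have s0: "h \<odot>\<^bsub>M\<^esub> \<zero>\<^bsub>M\<^esub> = \<zero>\<^bsub>M\<^esub>" if "h \<in> carrier R" for h
    using smult_r_distr[OF that M.zero_closed M.zero_closed] smult_closed[OF that M.zero_closed]
    by simp
  have sm: "h \<odot>\<^bsub>M\<^esub> (\<ominus>\<^bsub>M\<^esub> x) = \<ominus>\<^bsub>M\<^esub> (h \<odot>\<^bsub>M\<^esub> x)" if "h \<in> carrier R" "x \<in> carrier M" for h x
    using s0[OF that(1)] smult_r_distr[OF that(1), of "\<ominus>\<^bsub>M\<^esub> x" x] that
    by (metis M.a_inv_closed M.l_neg M.minus_equality smult_closed)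
  have add_cl: "(\<lambda>x\<in>carrier M. f x \<oplus>\<^bsub>M\<^esub> g x) \<in> module_endos R M"
    if "f \<in> module_endos R M" "g \<in> module_endos R M" for f g
    using that by (auto simp: module_endos_def smult_closed smult_r_distr Pi_def PiE_def M.a_ac)
  have zero_cl: "(\<lambda>x\<in>carrier M. \<zero>\<^bsub>M\<^esub>) \<in> module_endos R M"
    by (auto simp: module_endos_def smult_closed s0)
  have neg_cl: "(\<lambda>x\<in>carrier M. \<ominus>\<^bsub>M\<^esub> f x) \<in> module_endos R M" if "f \<in> module_endos R M" for f
    using that by (auto simp: module_endos_def smult_closed Pi_def PiE_def sm M.minus_add)
  have mult_cl: "(\<lambda>x\<in>carrier M. f (g x)) \<in> module_endos R M"
    if "f \<in> module_endos R M" "g \<in> module_endos R M" for f g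
    using that by (auto simp: module_endos_def smult_closed Pi_def PiE_def)
  have one_cl: "(\<lambda>x\<in>carrier M. x) \<in> module_endos R M"
    by (auto simp: module_endos_def smult_closed)
  show "abelian_group (End_ring R M)"
  proof (rule abelian_groupI, unfold car add zero)
    fix f g h
    assume f: "f \<in> module_endos R M" and g: "g \<in> module_endos R M" and h: "h \<in> module_endos R M"
    show "(\<lambda>x\<in>carrier M. f x \<oplus>\<^bsub>M\<^esub> g x) \<in> module_endos R M" by (rule add_cl[OF f g])
    show "(\<lambda>x\<in>carrier M. (\<lambda>x\<in>carrier M. f x \<oplus>\<^bsub>M\<^esub> g x) x \<oplus>\<^bsub>M\<^esub> h x) =
        (\<lambda>x\<in>carrier M. f x \<oplus>\<^bsub>M\<^esub> (\<lambda>x\<in>carrier M. g x \<oplus>\<^bsub>M\<^esub> h x) x)"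
      by (rule restrict_ext) (simp add: f g h sc M.a_assoc)
    show "(\<lambda>x\<in>carrier M. f x \<oplus>\<^bsub>M\<^esub> g x) = (\<lambda>x\<in>carrier M. g x \<oplus>\<^bsub>M\<^esub> f x)"
      by (rule restrict_ext) (simp add: f g sc M.a_comm)
    show "(\<lambda>x\<in>carrier M. (\<lambda>x\<in>carrier M. \<zero>\<^bsub>M\<^esub>) x \<oplus>\<^bsub>M\<^esub> f x) = f"
      by (rule eqI[symmetric, OF f]) (simp add: f sc)
    show "\<exists>g\<in>module_endos R M. (\<lambda>x\<in>carrier M. g x \<oplus>\<^bsub>M\<^esub> f x) = (\<lambda>x\<in>carrier M. \<zero>\<^bsub>M\<^esub>)"
      by (rule bexI[OF _ neg_cl[OF f]], rule restrict_ext) (simp add: f sc M.l_neg)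
  qed (rule zero_cl)
  show "Group.monoid (End_ring R M)"
  proof (rule monoidI, unfold car mult one)
    fix f g h
    assume f: "f \<in> module_endos R M" and g: "g \<in> module_endos R M" and h: "h \<in> module_endos R M"
    show "(\<lambda>x\<in>carrier M. f (g x)) \<in> module_endos R M" by (rule mult_cl[OF f g])
    show "(\<lambda>x\<in>carrier M. (\<lambda>x\<in>carrier M. f (g x)) (h x)) =
        (\<lambda>x\<in>carrier M. f ((\<lambda>x\<in>carrier M. g (h x)) x))"
      by (rule restrict_ext) (simp add: h sc)
    show "(\<lambda>x\<in>carrier M. (\<lambda>x\<in>carrier M. x) (f x)) = f"
      by (rule eqI[symmetric, OF f]) (simp add: f sc)
    show "(\<lambda>x\<in>carrier M. f ((\<lambda>x\<in>carrier M. x) x)) = f"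
      by (rule eqI[symmetric, OF f]) simp
  qed (rule one_cl)
  fix f g h
  assume "f \<in> carrier (End_ring R M)" "g \<in> carrier (End_ring R M)" "h \<in> carrier (End_ring R M)"
  then have fgh: "f \<in> module_endos R M" "g \<in> module_endos R M" "h \<in> module_endos R M"
    by (simp_all add: car)
  show "(f \<oplus>\<^bsub>End_ring R M\<^esub> g) \<otimes>\<^bsub>End_ring R M\<^esub> h =
      f \<otimes>\<^bsub>End_ring R M\<^esub> h \<oplus>\<^bsub>End_ring R M\<^esub> g \<otimes>\<^bsub>End_ring R M\<^esub> h"
    unfolding add mult by (rule restrict_ext) (simp add: fgh sc)
  show "h \<otimes>\<^bsub>End_ring R M\<^esub> (f \<oplus>\<^bsub>End_ring R M\<^esub> g) =
      h \<otimes>\<^bsub>End_ring R M\<^esub> f \<oplus>\<^bsub>End_ring R M\<^esub> h \<otimes>\<^bsub>End_ring R M\<^esub> g"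
    unfolding add mult by (rule restrict_ext) (simp add: fgh sc f_add)
qed

end

lemma left_module_specht_module: "a \<ge> 1 \<Longrightarrow> b \<ge> 1 \<Longrightarrow> left_module (hecke_algebra (a+b)) (specht_module a b :: ('f::field hecke, 'f hecke set) module)"
  unfolding specht_module_def presented_cyclic_module_def
proof (rule left_module.left_module_quotient_module[OF left_module_regular[OF ring_hecke_algebra] conjunct1[OF left_module.generated_submodule_submodule[OF left_module_regular[OF ring_hecke_algebra]]]])
  assume "a \<ge> 1" "b \<ge> 1"
  then show "hecke_class (a + b) ` specht_relators a b \<subseteq> carrier (regular_module (hecke_algebra (a+b) :: 'f hecke ring))"
    using specht_relators_closed[of b a] hecke_class_closed[of _ "a+b"] by (auto simp: regular_module_def)
qed

end

theory Submission
  imports Defs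
begin

text \<open>
  A Specht module for a hook \<open>(a, 1\<^sup>b)\<close> is spanned by one vector for each set of \<open>b + 1\<close> positions
  (the entries of the first column) containing \<open>1\<close>. Because \<open>a\<close> and \<open>b\<close> are odd, the positions
  \<open>2, 3, \<dots>, n + 1\<close> (with the position \<open>n + 1\<close> always put in the arm) fall into consecutive pairs, and
  the Hecke algebra acts on functions of these pairs by explicit local operators: a pair whose
  two letters agree is a vector of a two-dimensional symplectic space, a pair whose letters differ is a
  vector of a nilHecke module, and the residue sequence only records which pairs are of which kind.
  The images of the spanning vectors in this representation are unitriangular, so the Specht module embeds.
  An endomorphism sends the generator to a vector that satisfies the defining relations of the generator;
  in the representation, the relation \<open>y\<^bsub>b+1\<^esub> = 0\<close> fixes the one pair with different letters,
  the relations \<open>\<psi>\<^sub>r = 0\<close> make the coefficients symmetric under exchanging neighbouring pairs with equal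
  letters, and since the last pair has an arm letter this leaves only multiples of the generator. The same
  argument applied to the components of the generator shows that the module is indecomposable.
\<close>

section \<open>Free algebras acting on functions\<close>

text \<open>The relations bound the module only from above. That the generator is nonzero and that
  singular vectors are scalar needs linear independence of the spanning vectors, and the
  representation is built to prove it. The pairs are cut so that the positions 2 k + 1 and 2 k + 2,
  on two sides of a boundary, always have different residues, while inside a pair the residues agree
  exactly when the letters differ. Each case distinction of the defining relations thus becomes a
  condition on single pairs. Equal residues force E F + F E = 1, the nilHecke relation. Across a
  boundary, \<psi>^2 = -(y - y')^2 has to be -2 E E', and -2 is the value of a symplectic form on
  its dual tensor. As the form is alternating, \<psi> = 0 turns into symmetry of coefficients in
  every characteristic. The Garnir relation kills the words in which 1 has left the first column, so
  \<psi>_1 acts by zero. The last pair is half fictitious: n is even and there is no \<psi>_n, so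
  nothing brings a leg to position n + 1.\<close>

definition linop :: "(('t \<Rightarrow> 'f::field) \<Rightarrow> ('s \<Rightarrow> 'f)) \<Rightarrow> bool"
  where "linop L \<longleftrightarrow> (\<forall>c g h. L (\<lambda>t. c * g t + h t) = (\<lambda>t. c * L g t + L h t))"

lemma linopD: "linop L \<Longrightarrow> L (\<lambda>t. c * g t + h t) = (\<lambda>t. c * L g t + L h t)"
  by (simp add: linop_def)

lemma linop_zero: "linop L \<Longrightarrow> L (\<lambda>t. 0) = (\<lambda>t. 0)"
  using linopD[of L "-1" "\<lambda>t. 0" "\<lambda>t. 0"] by (simp add: fun_eq_iff)

text \<open>A word acts by composing its letters from right to left, which gives a left action. Only
  the words of \<open>p\<close> are summed, so the functions may have infinite support.\<close>

definition free_act :: "('x \<Rightarrow> ('t \<Rightarrow> 'f) \<Rightarrow> 't \<Rightarrow> 'f) \<Rightarrow> ('x, 'f::field) free_alg \<Rightarrow> ('t \<Rightarrow> 'f) \<Rightarrow> 't \<Rightarrow> 'f"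
  where "free_act \<rho> p g = (\<lambda>t. \<Sum>w\<in>Poly_Mapping.keys p. Poly_Mapping.lookup p w * foldr \<rho> (letters w) g t)"

lemma free_act_superset:
  assumes "finite A" "Poly_Mapping.keys p \<subseteq> A"
  shows "free_act \<rho> p g t = (\<Sum>w\<in>A. Poly_Mapping.lookup p w * foldr \<rho> (letters w) g t)"
  unfolding free_act_def
  by (rule sum.mono_neutral_left) (use assms in \<open>auto simp: in_keys_iff\<close>)

lemma free_act_zero [simp]: "free_act \<rho> 0 g t = 0"
  by (simp add: free_act_def)

lemma free_act_single [simp]:
  "free_act \<rho> (Poly_Mapping.single w c) g t = c * foldr \<rho> (letters w) g t"
  by (subst free_act_superset[of "{w}"]) auto

lemma free_act_add [simp]:
  "free_act \<rho> (p + q) g t = free_act \<rho> p g t + free_act \<rho> q g t"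
  using keys_add[of p q]
  by (simp add: free_act_superset[of "Poly_Mapping.keys p \<union> Poly_Mapping.keys q"]
      lookup_add algebra_simps sum.distrib)

lemma free_act_uminus [simp]: "free_act \<rho> (- p) g t = - free_act \<rho> p g t"
  using free_act_add[of \<rho> "-p" p g t] by (simp add: eq_neg_iff_add_eq_0 del: free_act_add)

lemma free_act_diff [simp]: "free_act \<rho> (p - q) g t = free_act \<rho> p g t - free_act \<rho> q g t"
  using free_act_add[of \<rho> p "-q" g t] by simp

lemma free_act_sum [simp]: "free_act \<rho> (sum f A) g t = (\<Sum>x\<in>A. free_act \<rho> (f x) g t)"
  by (induction A rule: infinite_finite_induct) simp_all

lemma free_act_gen [simp]: "free_act \<rho> (gen x) g = \<rho> x g"
  by (simp add: gen_def fun_eq_iff)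

lemma free_act_const [simp]: "free_act \<rho> (const c) g t = c * g t"
  by (simp add: const_def zero_free_monoid_def)

lemma const_one: "const 1 = 1" and const_zero: "const 0 = 0"
  by (simp_all add: const_def)

lemma free_act_one [simp]: "free_act \<rho> 1 g = g"
  using free_act_const[of \<rho> 1 g] by (simp add: const_one fun_eq_iff)

lemma poly_mapping_induct_add:
  fixes p :: "'a \<Rightarrow>\<^sub>0 'b::comm_monoid_add"
  assumes "\<And>w c. P (Poly_Mapping.single w c)" and "\<And>p q. P p \<Longrightarrow> P q \<Longrightarrow> P (p + q)"
  shows "P p"
proof -
  have "P (\<Sum>w\<in>A. Poly_Mapping.single w (Poly_Mapping.lookup p w))" if "finite A" for A
    using that
    \<comment> \<open>A monomial with coefficient 0 is the zero polynomial; this supplies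
      \<open>P 0\<close> for the empty sum.\<close>
    by (induction A rule: finite_induct) (use assms(1)[of undefined 0] assms in auto)
  moreover have "p = (\<Sum>w\<in>Poly_Mapping.keys p. Poly_Mapping.single w (Poly_Mapping.lookup p w))"
    by (rule poly_mapping_eqI)
      (simp add: lookup_sum lookup_single when_def in_keys_iff sum.delta)
  ultimately show ?thesis by (metis finite_keys)
qed

lemma linop_scale: "linop L \<Longrightarrow> L (\<lambda>t. c * g t) = (\<lambda>t. c * L g t)"
  using linopD[of L c g "\<lambda>t. 0"] by (simp add: linop_zero)

lemma linop_add: "linop L \<Longrightarrow> L (\<lambda>t. g t + h t) = (\<lambda>t. L g t + L h t)"
  using linopD[of L 1 g h] by simp

lemma linop_foldr:
  assumes "\<And>x. linop (\<rho> x)"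
  shows "linop (foldr \<rho> xs)"
proof (induction xs)
  case (Cons x xs)
  then show ?case using assms[of x] by (simp add: linop_def)
qed (simp add: linop_def)

lemma linop_free_act:
  assumes "\<And>x. linop (\<rho> x)"
  shows "linop (free_act \<rho> p)"
  unfolding linop_def free_act_def linopD[OF linop_foldr[OF assms]]
  by (simp add: algebra_simps sum.distrib sum_distrib_left)

lemma free_act_mult:
  fixes p q :: "('x, 'f::field) free_alg"
  assumes \<rho>: "\<And>x. linop (\<rho> x)"
  shows "free_act \<rho> (p * q) g = free_act \<rho> p (free_act \<rho> q g)"
proof (induction p rule: poly_mapping_induct_add)
  case (1 w c)
  show ?case
  proof (induction q rule: poly_mapping_induct_add)
    case (1 u d)
    show ?case
      by (simp add: fun_eq_iff mult_single plus_free_monoid_def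
          linop_scale[OF linop_foldr[OF \<rho>]] free_act_single[abs_def])
  next
    case (2 p q)
    have "free_act \<rho> (p + q) g = (\<lambda>t. free_act \<rho> p g t + free_act \<rho> q g t)"
      by (simp add: fun_eq_iff)
    then show ?case
      using 2 linop_add[OF linop_free_act[where p = "Poly_Mapping.single w c", OF \<rho>]]
      by (simp add: fun_eq_iff distrib_left del: free_act_single)
  qed
next
  case (2 p1 p2)
  then show ?case by (simp add: fun_eq_iff distrib_right)
qed

text \<open>The polynomials that annihilate all functions form a two-sided ideal: a right factor
  only changes the function acted on, and a left factor sends the zero function to zero by
  linearity.\<close>

lemma free_act_relation_ideal:
  fixes \<rho> :: "'x \<Rightarrow> ('t \<Rightarrow> 'f::field) \<Rightarrow> 't \<Rightarrow> 'f"
  assumes \<rho>: "\<And>x. linop (\<rho> x)" and R: "R \<subseteq> carrier (free_algebra X)"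
    and zero: "\<And>r g t. r \<in> R \<Longrightarrow> free_act \<rho> r g t = 0" and p: "p \<in> relation_ideal X R"
  shows "free_act \<rho> p g t = 0"
proof -
  let ?K = "{u \<in> carrier (free_algebra X). \<forall>g t. free_act \<rho> u g t = 0}"
  have simps: "u \<oplus>\<^bsub>free_algebra X\<^esub> v = u + v" "u \<otimes>\<^bsub>free_algebra X\<^esub> v = u * v" "\<zero>\<^bsub>free_algebra X\<^esub> = (0 :: ('x, 'f) free_alg)"
    for u v :: "('x, 'f) free_alg"
    by (simp_all add: free_algebra_def)
  interpret FX: ring "free_algebra X :: ('x, 'f) free_alg ring" by (rule free_algebra_ring)
  have z: "free_act \<rho> u (\<lambda>t. 0) = (\<lambda>t. 0)" for u
    by (rule linop_zero[OF linop_free_act[OF \<rho>]])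
  have "ideal ?K (free_algebra X)"
  proof (rule idealI[OF FX.ring_axioms])
    show "subgroup ?K (add_monoid (free_algebra X))"
    proof (rule FX.add.subgroupI)
      fix u assume u: "u \<in> ?K"
      then have "\<ominus>\<^bsub>free_algebra X\<^esub> u = - u"
        using free_algebra_closed(5)[of u X] by (intro FX.minus_equality) (simp_all add: simps)
      then show "\<ominus>\<^bsub>free_algebra X\<^esub> u \<in> ?K" using u free_algebra_closed(5)[of u X] by auto
    next
      have "(0 :: ('x, 'f) free_alg) \<in> ?K" using free_algebra_closed(1) by auto
      then show "?K \<noteq> {}" by blast
    qed (auto simp: simps free_algebra_closed)
  next
    fix u v :: "('x, 'f) free_alg"
    assume "u \<in> ?K" "v \<in> carrier (free_algebra X)"
    moreover from this have "free_act \<rho> u g = (\<lambda>t. 0)" for g by (auto simp: fun_eq_iff)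
    ultimately show "v \<otimes>\<^bsub>free_algebra X\<^esub> u \<in> ?K" "u \<otimes>\<^bsub>free_algebra X\<^esub> v \<in> ?K"
      by (auto simp: simps free_algebra_closed free_act_mult[OF \<rho>] z)
  qed
  moreover have "R \<subseteq> ?K" using R zero by auto
  ultimately have "relation_ideal X R \<subseteq> ?K"
    unfolding relation_ideal_def by (rule FX.genideal_minimal)
  then show ?thesis using p by blast
qed

lemma const_mult_commute: "const c * p = p * const c"
proof (induction p rule: poly_mapping_induct_add)
  case (1 w d)
  then show ?case by (simp add: const_def mult_single ac_simps)
qed (simp add: distrib_left distrib_right)

lemma const_minus_one: "const (- 1) = - 1"
  by (simp add: const_def single_uminus)

lemmas C_ops = free_algebra_closed(1-5,7) free_algebra_closed'(1-4)

text \<open>Words grow by prepending letters, so stability of a span under the generators passes to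
  the whole algebra.\<close>

lemma free_algebra_left_induct:
  fixes S :: "('x, 'f::field) free_alg set"
  assumes p: "p \<in> carrier (free_algebra X)" and q: "q \<in> S"
    and add: "\<And>u v. u \<in> S \<Longrightarrow> v \<in> S \<Longrightarrow> u + v \<in> S"
    and const: "\<And>d u. u \<in> S \<Longrightarrow> const d * u \<in> S"
    and gen: "\<And>x u. x \<in> X \<Longrightarrow> u \<in> S \<Longrightarrow> gen x * u \<in> S"
  shows "p * q \<in> S"
proof -
  have w: "Poly_Mapping.single (Word xs) d * q \<in> S" if "set xs \<subseteq> X" for xs d
    using that
  proof (induction xs)
    case Nil
    then show ?case using const[OF q, of d] by (simp add: const_def zero_free_monoid_def)
  next
    case (Cons x xs)
    then have "gen x * (Poly_Mapping.single (Word xs) d * q) \<in> S" by (intro gen) auto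
    moreover have "gen x * Poly_Mapping.single (Word xs) d = Poly_Mapping.single (Word (x # xs)) d"
      by (simp add: gen_def mult_single plus_free_monoid_def)
    ultimately show ?case by (simp add: mult.assoc[symmetric])
  qed
  have "(\<Sum>w\<in>A. Poly_Mapping.single w (Poly_Mapping.lookup p w)) * q \<in> S"
    if "finite A" "A \<subseteq> Poly_Mapping.keys p" for A
    using that
  proof (induction A rule: finite_induct)
    case empty
    then show ?case using const[OF q, of 0] by (simp add: const_zero)
  next
    case (insert w A)
    have "Poly_Mapping.single w (Poly_Mapping.lookup p w) * q \<in> S"
      using w[of "letters w"] p insert by (auto simp: free_algebra_def)
    then show ?case using insert by (simp add: distrib_right add)
  qed
  moreover have "p = (\<Sum>w\<in>Poly_Mapping.keys p. Poly_Mapping.single w (Poly_Mapping.lookup p w))"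
    by (rule poly_mapping_eqI) (simp add: lookup_sum lookup_single when_def in_keys_iff)
  ultimately show ?thesis by (metis finite_keys order_refl)
qed

section \<open>Cyclic modules over presented algebras\<close>

locale presented_cyclic =
  fixes X :: "'x set" and R Q :: "('x, 'f::field) free_alg set"
  assumes R: "R \<subseteq> carrier (free_algebra X)" and Q: "Q \<subseteq> carrier (free_algebra X)"
begin

abbreviation "FX \<equiv> free_algebra X :: ('x, 'f) free_alg ring"
abbreviation "A \<equiv> presented_algebra X R"
abbreviation "cls \<equiv> presented_class X R"
abbreviation "N \<equiv> generated_submodule A (regular_module A) (cls ` Q)"
abbreviation "M \<equiv> presented_cyclic_module A (cls ` Q)"

text \<open>The preimage of the left ideal \<open>N\<close> in the free algebra. The cyclic module
  becomes the free algebra modulo \<open>J\<close>, so that calculations use polynomial arithmetic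
  instead of cosets of cosets.\<close>

definition J :: "('x, 'f) free_alg set"
  where "J = {p \<in> carrier FX. cls p \<in> N}"

definition vec :: "('x, 'f) free_alg \<Rightarrow> ('x, 'f) free_alg set set"
  where "vec p = N +>\<^bsub>regular_module A\<^esub> cls p"

lemma FX_simps: "p \<oplus>\<^bsub>FX\<^esub> q = p + q" "p \<otimes>\<^bsub>FX\<^esub> q = p * q" "\<one>\<^bsub>FX\<^esub> = 1" "\<zero>\<^bsub>FX\<^esub> = 0"
  by (simp_all add: free_algebra_def)

lemma ideal_I: "ideal (relation_ideal X R) FX"
  by (rule ideal_relation_ideal[OF R])

lemma FX_minus: "q \<in> carrier FX \<Longrightarrow> p \<ominus>\<^bsub>FX\<^esub> q = p - q"
proof -
  interpret ring FX by (rule free_algebra_ring)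
  assume q: "q \<in> carrier FX"
  have "\<ominus>\<^bsub>FX\<^esub> q = - q"
    using free_algebra_closed(5)[OF q] q by (intro minus_equality) (simp_all add: FX_simps)
  then show ?thesis by (simp add: a_minus_def FX_simps)
qed

lemma cls_hom: "cls \<in> ring_hom FX A"
  using ideal.rcos_ring_hom[OF ideal_I] unfolding presented_algebra_def presented_class_def .

lemma ring_A: "ring A"
  unfolding presented_algebra_def by (rule ideal.quotient_is_ring[OF ideal_I])

lemma cls_closed: "p \<in> carrier FX \<Longrightarrow> cls p \<in> carrier A"
  using cls_hom by (rule ring_hom_closed)

lemma cls_add: "p \<in> carrier FX \<Longrightarrow> q \<in> carrier FX \<Longrightarrow> cls p \<oplus>\<^bsub>A\<^esub> cls q = cls (p + q)"
  using ring_hom_add[OF cls_hom, of p q] by (simp add: FX_simps)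

lemma cls_mult: "p \<in> carrier FX \<Longrightarrow> q \<in> carrier FX \<Longrightarrow> cls p \<otimes>\<^bsub>A\<^esub> cls q = cls (p * q)"
  using ring_hom_mult[OF cls_hom, of p q] by (simp add: FX_simps)

lemma cls_zero: "cls 0 = \<zero>\<^bsub>A\<^esub>"
  using ring_hom_zero[OF cls_hom free_algebra_ring ring_A] by (simp add: FX_simps)

lemma cls_uminus: "p \<in> carrier FX \<Longrightarrow> \<ominus>\<^bsub>A\<^esub> cls p = cls (- p)"
proof -
  interpret A: ring A by (rule ring_A)
  assume p: "p \<in> carrier FX"
  then show ?thesis
    using free_algebra_closed(5)[OF p]
    by (intro A.minus_equality) (simp_all add: cls_add cls_zero cls_closed)
qed

lemma carrier_A: "carrier A = cls ` carrier FX"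
  by (auto simp: presented_algebra_def presented_class_def FactRing_def A_RCOSETS_def')

lemma cls_eq_iff: "p \<in> carrier FX \<Longrightarrow> q \<in> carrier FX \<Longrightarrow> cls p = cls q \<longleftrightarrow> p - q \<in> relation_ideal X R"
  using ring.quotient_eq_iff_same_a_r_cos[OF free_algebra_ring ideal_I, of p q] FX_minus[of q p]
  by (simp add: presented_class_def)

lemma regular_simps: "carrier (regular_module A) = carrier A" "x \<oplus>\<^bsub>regular_module A\<^esub> y = x \<oplus>\<^bsub>A\<^esub> y"
  "\<zero>\<^bsub>regular_module A\<^esub> = \<zero>\<^bsub>A\<^esub>" "x \<odot>\<^bsub>regular_module A\<^esub> y = x \<otimes>\<^bsub>A\<^esub> y"
  by (simp_all add: regular_module_def)

lemma left_module_A: "left_module A (regular_module A)"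
  by (rule left_module_regular[OF ring_A])

lemma submodule_N: "submodule N A (regular_module A)" and Q_subset_N: "cls ` Q \<subseteq> N"
  using left_module.generated_submodule_submodule[OF left_module_A, of "cls ` Q"] Q cls_closed
  by (auto simp: regular_simps)

lemma N_closed: "x \<in> N \<Longrightarrow> x \<in> carrier A" "\<zero>\<^bsub>A\<^esub> \<in> N" "x \<in> N \<Longrightarrow> y \<in> N \<Longrightarrow> x \<oplus>\<^bsub>A\<^esub> y \<in> N"
  "a \<in> carrier A \<Longrightarrow> x \<in> N \<Longrightarrow> a \<otimes>\<^bsub>A\<^esub> x \<in> N"
  using subgroup.mem_carrier[OF submodule.axioms(1)[OF submodule_N]]
    subgroup.one_closed[OF submodule.axioms(1)[OF submodule_N]]
    subgroup.m_closed[OF submodule.axioms(1)[OF submodule_N]]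
    submodule.smult_closed[OF submodule_N]
  by (auto simp: regular_simps)

lemma J_carrier: "J \<subseteq> carrier FX"
  by (auto simp: J_def)

lemma J_add: "p \<in> J \<Longrightarrow> q \<in> J \<Longrightarrow> p + q \<in> J"
  by (auto simp: J_def free_algebra_closed N_closed cls_add[symmetric])

lemma J_mult: "p \<in> carrier FX \<Longrightarrow> q \<in> J \<Longrightarrow> p * q \<in> J"
  by (auto simp: J_def free_algebra_closed N_closed cls_closed cls_mult[symmetric])

lemma J_uminus: "p \<in> J \<Longrightarrow> - p \<in> J"
  using J_mult[OF free_algebra_closed(5)[OF free_algebra_closed(2)], of p] by simp

lemma J_diff: "p \<in> J \<Longrightarrow> q \<in> J \<Longrightarrow> p - q \<in> J"
  using J_add[of p "- q"] J_uminus[of q] by simp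

lemma J_zero: "0 \<in> J"
  by (auto simp: J_def free_algebra_closed N_closed cls_zero)

lemma I_subset_J: "relation_ideal X R \<subseteq> J"
proof
  fix p assume p: "p \<in> relation_ideal X R"
  then have "p \<in> carrier FX" using ideal.Icarr[OF ideal_I] by blast
  moreover from this have "cls p = cls 0"
    using p free_algebra_closed by (subst cls_eq_iff) auto
  ultimately show "p \<in> J" by (simp add: J_def N_closed cls_zero)
qed

lemma relator_mult_J: "p \<in> R \<Longrightarrow> q \<in> carrier FX \<Longrightarrow> p * q \<in> J"
proof -
  assume "p \<in> R" "q \<in> carrier FX"
  then have "p * q \<in> relation_ideal X R"
    using ideal.I_r_closed[OF ideal_I, of p q] ring.genideal_self[OF free_algebra_ring R]
    by (auto simp: relation_ideal_def FX_simps)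
  then show ?thesis using I_subset_J by blast
qed

lemma Q_subset_J: "Q \<subseteq> J"
  using Q Q_subset_N by (auto simp: J_def)

text \<open>The image of \<open>K\<close> is a submodule containing the relators of the generator,
  hence contains \<open>N\<close>. Since \<open>K\<close> contains the relation ideal, it also
  contains every representative of a class in its image.\<close>

lemma J_subset:
  assumes "K \<subseteq> carrier FX" and I: "relation_ideal X R \<subseteq> K" and QK: "Q \<subseteq> K"
    and add: "\<And>p q. p \<in> K \<Longrightarrow> q \<in> K \<Longrightarrow> p + q \<in> K"
    and mult: "\<And>p q. p \<in> carrier FX \<Longrightarrow> q \<in> K \<Longrightarrow> p * q \<in> K"
  shows "J \<subseteq> K"
proof
  fix p assume p: "p \<in> J"
  have "subgroup (cls ` K) (add_monoid (regular_module A))"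
  proof (rule group.subgroupI)
    show "group (add_monoid (regular_module A))"
      using left_module_A by (simp add: left_module_def abelian_group.a_group)
    show "cls ` K \<subseteq> carrier (add_monoid (regular_module A))"
      using assms(1) cls_closed by (auto simp: regular_simps)
    have "0 \<in> relation_ideal X R"
      using additive_subgroup.zero_closed[OF ideal.axioms(1)[OF ideal_I]] by (simp add: FX_simps)
    then show "cls ` K \<noteq> {}" using I by blast
  next
    fix a assume "a \<in> cls ` K"
    then obtain q where q: "q \<in> K" "a = cls q" by blast
    have "- q \<in> K" using mult[OF free_algebra_closed(5)[OF free_algebra_closed(2)] q(1)] by simp
    moreover have "\<ominus>\<^bsub>regular_module A\<^esub> a = cls (- q)"
    proof -
      have "\<ominus>\<^bsub>regular_module A\<^esub> a = \<ominus>\<^bsub>A\<^esub> a"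
        by (simp add: a_inv_def regular_module_def m_inv_def)
      then show ?thesis using q assms(1) by (auto simp: cls_uminus)
    qed
    ultimately show "inv\<^bsub>add_monoid (regular_module A)\<^esub> a \<in> cls ` K"
      unfolding a_inv_def by auto
  next
    fix a b assume "a \<in> cls ` K" "b \<in> cls ` K"
    then obtain q r where "q \<in> K" "a = cls q" "r \<in> K" "b = cls r" by blast
    then show "a \<otimes>\<^bsub>add_monoid (regular_module A)\<^esub> b \<in> cls ` K"
      using add[of q r] cls_add[of q r] assms(1) by (auto simp: regular_simps)
  qed
  moreover have "submodule_axioms (cls ` K) A (regular_module A)"
    using mult assms(1) by unfold_locales (auto simp: regular_simps carrier_A cls_mult)
  ultimately have "submodule (cls ` K) A (regular_module A)"
    by (rule submodule.intro)
  then have "N \<subseteq> cls ` K"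
    using QK unfolding generated_submodule_def by (intro Inter_lower CollectI conjI image_mono)
  then obtain q where q: "q \<in> K" "cls p = cls q" using p by (auto simp: J_def)
  then have "p - q \<in> relation_ideal X R" using p assms(1) J_carrier by (subst (asm) cls_eq_iff) auto
  then have "(p - q) + q \<in> K" using add I q(1) by blast
  then show "p \<in> K" by simp
qed

lemma carrier_M: "carrier M = vec ` carrier FX"
  unfolding presented_cyclic_module_def left_module.quotient_module_simps(1)[OF left_module_A submodule_N]
  by (auto simp: vec_def regular_simps carrier_A)

lemma vec_smult: "p \<in> carrier FX \<Longrightarrow> q \<in> carrier FX \<Longrightarrow> cls p \<odot>\<^bsub>M\<^esub> vec q = vec (p * q)"
  unfolding presented_cyclic_module_def vec_def
  using left_module.quotient_module_smult[OF left_module_A submodule_N, of "cls p" "cls q"]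
  by (simp add: cls_closed regular_simps cls_mult)

lemma zero_M: "\<zero>\<^bsub>M\<^esub> = vec 0"
  unfolding presented_cyclic_module_def vec_def
  using left_module.quotient_module_simps(2)[OF left_module_A submodule_N]
  by (simp add: regular_simps cls_zero)

lemma left_module_M: "left_module A M"
  unfolding presented_cyclic_module_def
  by (rule left_module.left_module_quotient_module[OF left_module_A submodule_N])

lemma vec_eq_iff: "p \<in> carrier FX \<Longrightarrow> q \<in> carrier FX \<Longrightarrow> vec p = vec q \<longleftrightarrow> p - q \<in> J"
proof -
  assume p: "p \<in> carrier FX" and q: "q \<in> carrier FX"
  interpret N: abelian_subgroup N "regular_module A"
    by (rule left_module.abelian_subgroup_submodule[OF left_module_A submodule_N])
  have coset: "vec r = (\<Union>x\<in>N. {x \<oplus>\<^bsub>A\<^esub> cls r})" for r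
    unfolding vec_def a_r_coset_def'[of "regular_module A" N "cls r"] by (simp add: regular_simps)
  show ?thesis
  proof
    assume "vec p = vec q"
    moreover have "cls p \<in> vec p"
      unfolding vec_def by (rule N.a_rcos_self) (simp add: regular_simps cls_closed p)
    ultimately have "cls p \<in> vec q" by simp
    then obtain x where x: "x \<in> N" "cls p = x \<oplus>\<^bsub>A\<^esub> cls q" unfolding coset[of q] by blast
    then obtain m where m: "m \<in> carrier FX" "x = cls m" using N_closed(1) carrier_A by blast
    then have "m \<in> J" using x by (simp add: J_def)
    moreover have "p - (m + q) \<in> relation_ideal X R"
      using x m p q free_algebra_closed(3)[OF m(1) q] by (simp add: cls_add cls_eq_iff)
    ultimately have "(p - (m + q)) + m \<in> J" using I_subset_J J_add by blast
    then show "p - q \<in> J" by simp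
  next
    assume "p - q \<in> J"
    then have "cls (p - q) \<oplus>\<^bsub>A\<^esub> cls q \<in> vec q" unfolding coset[of q] by (auto simp: J_def)
    moreover have "cls (p - q) \<oplus>\<^bsub>A\<^esub> cls q = cls p"
      using \<open>p - q \<in> J\<close> J_carrier q by (subst cls_add) auto
    ultimately show "vec p = vec q"
      unfolding vec_def using q by (intro N.a_repr_independence'[symmetric]) (simp_all add: regular_simps cls_closed)
  qed
qed

text \<open>The relations of the generator hold only at the one vector \<open>z\<close>. The
  annihilator of a vector is a left ideal, which is all that \<open>J_subset\<close> asks
  for.\<close>

lemma J_free_act:
  fixes \<rho> :: "'x \<Rightarrow> ('t \<Rightarrow> 'f) \<Rightarrow> 't \<Rightarrow> 'f"
  assumes \<rho>: "\<And>x. linop (\<rho> x)"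
    and R0: "\<And>r g t. r \<in> R \<Longrightarrow> free_act \<rho> r g t = 0" and Q0: "\<And>q t. q \<in> Q \<Longrightarrow> free_act \<rho> q z t = 0"
    and p: "p \<in> J"
  shows "free_act \<rho> p z t = 0"
proof -
  have "J \<subseteq> {u \<in> carrier FX. \<forall>t. free_act \<rho> u z t = 0}"
  proof (rule J_subset)
    show "relation_ideal X R \<subseteq> {u \<in> carrier FX. \<forall>t. free_act \<rho> u z t = 0}"
      using free_act_relation_ideal[OF \<rho> R R0] I_subset_J J_carrier by blast
    show "u * v \<in> {u \<in> carrier FX. \<forall>t. free_act \<rho> u z t = 0}"
      if "u \<in> carrier FX" "v \<in> {u \<in> carrier FX. \<forall>t. free_act \<rho> u z t = 0}" for u v
    proof -
      have "free_act \<rho> v z = (\<lambda>t. 0)" using that by (auto simp: fun_eq_iff)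
      then show ?thesis
        using that by (auto simp: free_algebra_closed free_act_mult[OF \<rho>] linop_zero[OF linop_free_act[OF \<rho>]])
    qed
  qed (use Q Q0 in \<open>auto simp: free_algebra_closed\<close>)
  then show ?thesis using p by blast
qed

lemma const_scalar_vec: "u \<in> carrier FX \<Longrightarrow> cls (const d) \<odot>\<^bsub>M\<^esub> vec u = vec (const d * u)"
  by (simp add: vec_smult free_algebra_closed)

lemma vec_zero_iff: "u \<in> carrier FX \<Longrightarrow> vec u = vec 0 \<longleftrightarrow> u \<in> J"
  using vec_eq_iff[OF _ free_algebra_closed(1), of u] by simp

lemma vec_in_submodule:
  assumes "submodule N' A M" "vec 1 \<in> N'"
  shows "carrier M \<subseteq> N'"
proof
  fix x assume "x \<in> carrier M"
  then obtain u where u: "u \<in> carrier FX" "x = vec u" by (auto simp: carrier_M)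
  then have "cls u \<odot>\<^bsub>M\<^esub> vec 1 \<in> N'"
    using submodule.smult_closed[OF assms(1) cls_closed assms(2)] by blast
  then show "x \<in> N'" using u vec_smult[of u 1] by (simp add: free_algebra_closed)
qed

section \<open>Consequences of every singular vector being a scalar multiple of the
  generator\<close>

context
  assumes core: "\<And>v. v \<in> carrier FX \<Longrightarrow> (\<And>q. q \<in> Q \<Longrightarrow> q * v \<in> J) \<Longrightarrow> \<exists>d. v - const d \<in> J"
    and one: "1 \<notin> J"
begin

lemma endo_scalar:
  assumes f: "f \<in> module_endos A M"
  shows "\<exists>d. f = (\<lambda>x\<in>carrier M. cls (const d) \<odot>\<^bsub>M\<^esub> x)"
proof -
  note cl = free_algebra_closed
  have "vec 1 \<in> carrier M" by (auto simp: carrier_M cl)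
  then have "f (vec 1) \<in> carrier M" using f by (auto simp: module_endos_def)
  then obtain v where v: "v \<in> carrier FX" "f (vec 1) = vec v" by (auto simp: carrier_M)
  have fv: "f (vec u) = vec (u * v)" if u: "u \<in> carrier FX" for u
  proof -
    have "f (cls u \<odot>\<^bsub>M\<^esub> vec 1) = cls u \<odot>\<^bsub>M\<^esub> f (vec 1)"
      using f u \<open>vec 1 \<in> carrier M\<close> cls_closed by (auto simp: module_endos_def)
    then show ?thesis using u v by (simp add: vec_smult cl)
  qed
  have "q * v \<in> J" if "q \<in> Q" for q
  proof -
    have q: "q \<in> carrier FX" using that Q by blast
    have "vec q = vec 0" using that Q_subset_J q by (subst vec_zero_iff) auto
    then have "vec (q * v) = vec 0" using fv[OF q] fv[OF cl(1)] by simp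
    then show ?thesis using vec_zero_iff q v by (simp add: cl)
  qed
  then obtain d where d: "v - const d \<in> J" using core v by blast
  have "f x = cls (const d) \<odot>\<^bsub>M\<^esub> x" if x: "x \<in> carrier M" for x
  proof -
    obtain u where u: "u \<in> carrier FX" "x = vec u" using x by (auto simp: carrier_M)
    have "u * v - u * const d \<in> J" using J_mult[OF u(1) d] by (simp add: right_diff_distrib)
    then have "vec (u * v) = vec (u * const d)" using u v by (subst vec_eq_iff) (auto simp: cl)
    then show ?thesis using u fv by (simp add: const_scalar_vec const_mult_commute)
  qed
  then have "f = (\<lambda>x\<in>carrier M. cls (const d) \<odot>\<^bsub>M\<^esub> x)"
    using f by (auto simp: module_endos_def PiE_def extensional_def restrict_def fun_eq_iff)
  then show ?thesis by blast
qed

lemma scalar_endo: "(\<lambda>x\<in>carrier M. cls (const d) \<odot>\<^bsub>M\<^esub> x) \<in> module_endos A M"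
proof -
  interpret left_module A M by (rule left_module_M)
  have c: "cls (const d) \<in> carrier A" by (intro cls_closed free_algebra_closed)
  have "cls (const d) \<odot>\<^bsub>M\<^esub> (h \<odot>\<^bsub>M\<^esub> x) = h \<odot>\<^bsub>M\<^esub> (cls (const d) \<odot>\<^bsub>M\<^esub> x)"
    if h: "h \<in> carrier A" and x: "x \<in> carrier M" for h x
  proof -
    obtain u where u: "u \<in> carrier FX" "h = cls u" using h carrier_A by blast
    have "cls (const d) \<otimes>\<^bsub>A\<^esub> h = h \<otimes>\<^bsub>A\<^esub> cls (const d)"
      using u free_algebra_closed(7)[of d X] by (simp add: cls_mult const_mult_commute)
    then show ?thesis using c h x by (simp add: smult_assoc[symmetric])
  qed
  then show ?thesis
    using c by (auto simp: module_endos_def smult_closed smult_r_distr)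
qed

lemma dimension_End: "ring.dimension (End_ring A M) 1 (range (\<lambda>d. \<lambda>x\<in>carrier M. cls (const d) \<odot>\<^bsub>M\<^esub> x)) (carrier (End_ring A M))"
proof -
  interpret LM: left_module A M by (rule left_module_M)
  interpret E: ring "End_ring A M" by (rule LM.ring_End_ring)
  let ?K = "range (\<lambda>d. \<lambda>x\<in>carrier M. cls (const d) \<odot>\<^bsub>M\<^esub> x)"
  have K: "carrier (End_ring A M) = ?K"
    using endo_scalar scalar_endo by (auto simp: End_ring_def)
  have v1: "vec 1 \<in> carrier M" by (auto simp: carrier_M free_algebra_closed)
  have "\<one>\<^bsub>End_ring A M\<^esub> \<noteq> \<zero>\<^bsub>End_ring A M\<^esub>"
  proof
    assume "\<one>\<^bsub>End_ring A M\<^esub> = \<zero>\<^bsub>End_ring A M\<^esub>"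
    then have "(\<lambda>x\<in>carrier M. x) (vec 1) = (\<lambda>x\<in>carrier M. \<zero>\<^bsub>M\<^esub>) (vec 1)"
      by (simp add: End_ring_def)
    then show False using v1 one vec_zero_iff[OF free_algebra_closed(2)] by (simp add: zero_M)
  qed
  \<comment> \<open>The endomorphism ring equals \<open>?K\<close>, so the line through the identity
    over \<open>?K\<close> is already everything.\<close>
  then have "E.dimension (Suc 0) ?K (E.line_extension ?K \<one>\<^bsub>End_ring A M\<^esub> {\<zero>\<^bsub>End_ring A M\<^esub>})"
    by (intro E.Suc_dim E.zero_dim) auto
  moreover have "E.line_extension ?K \<one>\<^bsub>End_ring A M\<^esub> {\<zero>\<^bsub>End_ring A M\<^esub>} = carrier (End_ring A M)"
    unfolding E.line_extension_def K[symmetric] by (auto simp: set_add_def' r_coset_def)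
  ultimately show ?thesis by simp
qed

lemma indecomposable_M: "indecomposable A M"
proof -
  interpret LM: left_module A M by (rule left_module_M)
  note cl = free_algebra_closed
  have v1: "vec 1 \<in> carrier M" by (auto simp: carrier_M cl)
  have ne: "vec 1 \<noteq> vec 0" using one vec_zero_iff[OF cl(2)] by simp
  have False if N1: "submodule N1 A M" and N2: "submodule N2 A M" and nz: "N1 \<noteq> {\<zero>\<^bsub>M\<^esub>}" "N2 \<noteq> {\<zero>\<^bsub>M\<^esub>}"
    and int: "N1 \<inter> N2 = {\<zero>\<^bsub>M\<^esub>}" and sum: "N1 <+>\<^bsub>M\<^esub> N2 = carrier M" for N1 N2
  proof -
    have sub: "N1 \<subseteq> carrier M" "N2 \<subseteq> carrier M"
      using subgroup.subset[OF submodule.axioms(1)[OF N1]] subgroup.subset[OF submodule.axioms(1)[OF N2]] by auto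
    obtain x y where xy: "x \<in> N1" "y \<in> N2" "vec 1 = x \<oplus>\<^bsub>M\<^esub> y"
      using v1 unfolding sum[symmetric] set_add_def' by blast
    obtain v where v: "v \<in> carrier FX" "x = vec v" using xy sub carrier_M by blast
    \<comment> \<open>The two components of \<open>q\<close> times the generator add up to zero, so
      each lies in both summands and vanishes: the component \<open>x\<close> satisfies the
      relations of the generator.\<close>
    have "q * v \<in> J" if "q \<in> Q" for q
    proof -
      have q: "q \<in> carrier FX" using that Q by blast
      have qx: "cls q \<odot>\<^bsub>M\<^esub> x \<in> N1" and qy: "cls q \<odot>\<^bsub>M\<^esub> y \<in> N2"
        using submodule.smult_closed[OF N1 cls_closed[OF q] xy(1)]
          submodule.smult_closed[OF N2 cls_closed[OF q] xy(2)] by auto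
      have "cls q \<odot>\<^bsub>M\<^esub> vec 1 = \<zero>\<^bsub>M\<^esub>"
        using that Q_subset_J q by (subst vec_smult) (auto simp: cl zero_M vec_zero_iff)
      then have "cls q \<odot>\<^bsub>M\<^esub> x \<oplus>\<^bsub>M\<^esub> cls q \<odot>\<^bsub>M\<^esub> y = \<zero>\<^bsub>M\<^esub>"
        using LM.smult_r_distr[OF cls_closed[OF q], of x y] xy sub by auto
      then have "\<ominus>\<^bsub>M\<^esub> (cls q \<odot>\<^bsub>M\<^esub> y) = cls q \<odot>\<^bsub>M\<^esub> x"
        using qx qy sub by (intro LM.M.minus_equality) auto
      moreover have "\<ominus>\<^bsub>M\<^esub> (cls q \<odot>\<^bsub>M\<^esub> y) \<in> N2"
        using subgroup.m_inv_closed[OF submodule.axioms(1)[OF N2] qy] by (simp add: a_inv_def)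
      ultimately have "cls q \<odot>\<^bsub>M\<^esub> x = \<zero>\<^bsub>M\<^esub>" using qx int by auto
      then show ?thesis using q v by (simp add: vec_smult zero_M vec_zero_iff cl)
    qed
    then obtain d where d: "v - const d \<in> J" using core v by blast
    then have x: "x = vec (const d)" using v by (simp add: vec_eq_iff cl)
    show False
    proof (cases "d = 0")
      case True
      then have "x = \<zero>\<^bsub>M\<^esub>" using x by (simp add: const_zero zero_M)
      then have "vec 1 \<in> N2" using xy sub by auto
      then have "carrier M \<subseteq> N2" by (rule vec_in_submodule[OF N2])
      then show False using sub int nz by auto
    next
      case False
      have "const (1 / d) * const d = (1 :: ('x, 'f) free_alg)"
        using False by (simp add: const_def mult_single)
      then have "cls (const (1 / d)) \<odot>\<^bsub>M\<^esub> x = vec 1"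
        unfolding x by (simp add: const_scalar_vec cl)
      moreover have "cls (const (1 / d)) \<odot>\<^bsub>M\<^esub> x \<in> N1"
        by (rule submodule.smult_closed[OF N1 cls_closed[OF cl(7)] xy(1)])
      ultimately have "vec 1 \<in> N1" by simp
      then have "carrier M \<subseteq> N1" by (rule vec_in_submodule[OF N1])
      then show False using sub int nz by auto
    qed
  qed
  moreover have "carrier M \<noteq> {\<zero>\<^bsub>M\<^esub>}" using v1 ne by (auto simp: zero_M)
  ultimately show ?thesis unfolding indecomposable_def by blast
qed

end

end

section \<open>The tensor-space representation\<close>

text \<open>
  Pair \<open>k\<close> stands for the positions \<open>2 k + 2\<close> and \<open>2 k + 3\<close>; \<^const>\<open>True\<close> means that the position is in the
  first column (the leg).
\<close>

type_synonym pairs = "nat \<Rightarrow> bool \<times> bool"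

text \<open>On basis vectors this moves the leg of a pair from the second position to the first and
  kills pairs with equal letters; \<open>F_op\<close> moves it back. The two y's of the pair act by
  this operator with opposite signs.\<close>

definition E_op :: "nat \<Rightarrow> (pairs \<Rightarrow> 'f::field) \<Rightarrow> pairs \<Rightarrow> 'f"
  where "E_op k g T = (if T k = (True, False) then g (T(k := (False, True))) else 0)"

definition F_op :: "nat \<Rightarrow> (pairs \<Rightarrow> 'f::field) \<Rightarrow> pairs \<Rightarrow> 'f"
  where "F_op k g T = (if T k = (False, True) then g (T(k := (True, False))) else 0)"

text \<open>
  Operators are given on coefficient functions, so \<open>g\<close> is evaluated at the preimages of \<open>T\<close>. On a pair
  of neighbouring pairs with equal letters, \<open>G_op\<close> is the symplectic form, on two pairs with different
  letters it is minus the dual tensor, and on mixed pairs it is an exchange.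
\<close>

definition G_op :: "nat \<Rightarrow> (pairs \<Rightarrow> 'f::field) \<Rightarrow> pairs \<Rightarrow> 'f"
  where "G_op k g T = (
    if T k = (True, False) \<and> fst (T (Suc k)) = snd (T (Suc k))
      then g (T(k := T (Suc k), Suc k := (False, True)))
    else if fst (T k) = snd (T k) \<and> T (Suc k) = (True, False)
      then g (T(k := (False, True), Suc k := T k))
    else if T k = (True, False) \<and> T (Suc k) = (True, False)
      then g (T(k := (True, True), Suc k := (False, False))) - g (T(k := (False, False), Suc k := (True, True)))
    else if T k = (False, False) \<and> T (Suc k) = (True, True)
      then g (T(k := (False, True), Suc k := (False, True)))
    else if T k = (True, True) \<and> T (Suc k) = (False, False)
      then - g (T(k := (False, True), Suc k := (False, True)))
    else 0)"

text \<open>Once the affected entries of \<open>T\<close> are written as explicit updates, an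
  identity between local operators is a finite check over letters.\<close>

lemma all_pairs_upd2: 
  "(\<forall>T::pairs. P T) \<longleftrightarrow> (\<forall>T x y. P (T(k := x, Suc k := y)))"
  by (metis fun_upd_triv)
lemma all_pairs_upd3: 
  "(\<forall>T::pairs. P T) \<longleftrightarrow> (\<forall>T x y z. P (T(k := x, Suc k := y, Suc (Suc k) := z)))"
  by (metis fun_upd_triv)

section \<open>Relations between the local operators\<close>

lemmas op_simps = E_op_def F_op_def G_op_def fun_upd_twist

text \<open>These are \<psi>'s at distance two, yet both touch pair \<open>Suc k\<close>. When two
  neighbouring pairs are (False, True) and the third has equal letters, this is the snake identity
  between the form and the dual tensor; it fixes their relative sign.\<close>

lemma G_comm: "G_op k (G_op (Suc k) g) T = G_op (Suc k) (G_op k g) T"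
proof -
  have "\<forall>T. G_op k (G_op (Suc k) g) T = G_op (Suc k) (G_op k g) T"
    apply (subst all_pairs_upd3[of _ k])
    by (simp add: op_simps split_paired_All all_bool_eq)
  then show ?thesis by blast
qed

text \<open>The constant -2 is the form evaluated on the dual tensor.\<close>

lemma G_G: "G_op k (G_op k g) T = - 2 * E_op k (E_op (Suc k) g) T"
proof -
  have "\<forall>T. G_op k (G_op k g) T = - 2 * E_op k (E_op (Suc k) g) T"
    apply (subst all_pairs_upd2[of _ k])
    by (simp add: op_simps split_paired_All all_bool_eq)
  then show ?thesis by blast
qed

text \<open>On basis vectors \<open>G_op\<close> kills every input with a pair (True, False) and
  never outputs a pair (False, True), whereas \<open>E_op\<close> produces the former and consumes
  the latter.\<close>

lemma G_E_zero:
  "E_op k (G_op k g) T = 0" "E_op (Suc k) (G_op k g) T = 0"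
  "G_op k (E_op k g) T = 0" "G_op k (E_op (Suc k) g) T = 0"
proof -
  have "\<forall>T. E_op k (G_op k g) T = 0 \<and> E_op (Suc k) (G_op k g) T = 0 \<and>
     G_op k (E_op k g) T = 0 \<and> G_op k (E_op (Suc k) g) T = 0"
    apply (subst all_pairs_upd2[of _ k])
    by (simp add: op_simps split_paired_All all_bool_eq)
  then show "E_op k (G_op k g) T = 0" "E_op (Suc k) (G_op k g) T = 0"
  "G_op k (E_op k g) T = 0" "G_op k (E_op (Suc k) g) T = 0" by blast+
qed

text \<open>The braid relation with r = 2 k + 2. On a pair with equal letters \<open>E_op k\<close>
  vanishes, so y_r - 2 y_(r+1) + y_(r+2) = - 3 E_k - E_(k+1) leaves just this correction.
  \<open>GFG\<close> is the case r = 2 k + 3, where the sum is E_k + 3 E_(k+1).\<close>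

lemma FGF: "F_op k (G_op k (F_op k g)) T = G_op k (F_op k (G_op k g)) T
    - (if fst (T k) = snd (T k) then E_op (Suc k) g T else 0)"
proof -
  have "\<forall>T. F_op k (G_op k (F_op k g)) T = G_op k (F_op k (G_op k g)) T
    - (if fst (T k) = snd (T k) then E_op (Suc k) g T else 0)"
    apply (subst all_pairs_upd2[of _ k])
    by (simp add: op_simps split_paired_All all_bool_eq)
  then show ?thesis by blast
qed

lemma GFG: "G_op k (F_op (Suc k) (G_op k g)) T = F_op (Suc k) (G_op k (F_op (Suc k) g)) T
    + (if fst (T (Suc k)) = snd (T (Suc k)) then E_op k g T else 0)"
proof -
  have "\<forall>T. G_op k (F_op (Suc k) (G_op k g)) T = F_op (Suc k) (G_op k (F_op (Suc k) g)) T
    + (if fst (T (Suc k)) = snd (T (Suc k)) then E_op k g T else 0)"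
    apply (subst all_pairs_upd2[of _ k])
    by (simp add: op_simps split_paired_All all_bool_eq)
  then show ?thesis by blast
qed

lemma E_E: "E_op k (E_op k g) T = 0" and F_F: "F_op k (F_op k g) T = 0"
  by (simp_all add: op_simps)

text \<open>The nilHecke relation: different letters mean equal residues, the case in which the
  relations between y and \<psi> contain the term 1.\<close>

lemma E_F: "E_op k (F_op k g) T + F_op k (E_op k g) T = (if fst (T k) \<noteq> snd (T k) then g T else 0)"
  by (cases "T k") (auto simp add: op_simps fun_upd_idem)

lemma E_comm: "E_op k (E_op j g) T = E_op j (E_op k g) T"
  by (cases "j = k") (auto simp add: op_simps)

lemma F_comm: "F_op k (F_op j g) T = F_op j (F_op k g) T"
  by (cases "j = k") (auto simp add: op_simps)

lemma E_F_far: "j \<noteq> k \<Longrightarrow> E_op k (F_op j g) T = F_op j (E_op k g) T"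
  by (auto simp add: op_simps)

lemma E_G_far: "j \<noteq> k \<Longrightarrow> j \<noteq> Suc k \<Longrightarrow> E_op j (G_op k g) T = G_op k (E_op j g) T"
  by (cases "T j = (True, False)")
    (simp_all add: E_op_def G_op_def fun_upd_twist[of j k] fun_upd_twist[of j "Suc k"])

lemma F_G_far: "j \<noteq> k \<Longrightarrow> j \<noteq> Suc k \<Longrightarrow> F_op j (G_op k g) T = G_op k (F_op j g) T"
  by (cases "T j = (False, True)")
    (simp_all add: F_op_def G_op_def fun_upd_twist[of j k] fun_upd_twist[of j "Suc k"])

text \<open>The matrix of \<open>G_op\<close> on two neighbouring pairs. In this form linearity is
  immediate, and operators on disjoint pairs commute by exchanging two sums instead of by a case
  analysis over four pairs.\<close>

definition G_coeff :: "bool \<times> bool \<Rightarrow> bool \<times> bool \<Rightarrow> (bool \<times> bool) \<times> (bool \<times> bool) \<Rightarrow> 'f::field"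
  where "G_coeff x y p = (
    if x = (True, False) \<and> fst y = snd y then of_bool (p = (y, (False, True)))
    else if fst x = snd x \<and> y = (True, False) then of_bool (p = ((False, True), x))
    else if x = (True, False) \<and> y = (True, False)
      then of_bool (p = ((True, True), (False, False))) - of_bool (p = ((False, False), (True, True)))
    else if x = (False, False) \<and> y = (True, True) then of_bool (p = ((False, True), (False, True)))
    else if x = (True, True) \<and> y = (False, False) then - of_bool (p = ((False, True), (False, True)))
    else 0)"

lemma G_op_coeff:
  "G_op k g T = (\<Sum>p\<in>UNIV. G_coeff (T k) (T (Suc k)) p * g (T(k := fst p, Suc k := snd p)))"
proof -
  have *: "(\<Sum>p\<in>UNIV. of_bool (p = a) * h p) = h a" for h :: "_ \<Rightarrow> 'a" and a :: "(bool \<times> bool) \<times> (bool \<times> bool)"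
    by (simp add: of_bool_def if_distrib[of "\<lambda>x. x * _"] cong: if_cong)
  have **: "(\<Sum>p\<in>UNIV. (if A then f p else f' p) * h p) = (if A then \<Sum>p\<in>UNIV. f p * h p else \<Sum>p\<in>UNIV. f' p * h p)"
    for A and f f' h :: "(bool \<times> bool) \<times> (bool \<times> bool) \<Rightarrow> 'a"
    by simp
  show ?thesis
    unfolding G_op_def G_coeff_def
    by (simp only: * ** left_diff_distrib sum_subtractf minus_mult_left[symmetric]
        sum_negf fst_conv snd_conv mult_zero_left sum.neutral_const)
qed

lemma G_far: assumes "Suc k < j" shows "G_op k (G_op j g) T = G_op j (G_op k g) T"
proof -
  have ne: "j \<noteq> k" "j \<noteq> Suc k" "Suc j \<noteq> k" "Suc j \<noteq> Suc k" "k \<noteq> j" "Suc k \<noteq> j" "k \<noteq> Suc j" using assms by auto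
  have tw: "T(k := x, Suc k := y, j := z, Suc j := w) = T(j := z, Suc j := w, k := x, Suc k := y)" for x y z w
    using ne by (auto simp: fun_eq_iff)
  let ?f = "\<lambda>p q. G_coeff (T k) (T (Suc k)) p * (G_coeff (T j) (T (Suc j)) q
    * g (T(j := fst q, Suc j := snd q, k := fst p, Suc k := snd p)))"
  have 1: "G_op k (G_op j g) T = (\<Sum>p\<in>UNIV. \<Sum>q\<in>UNIV. ?f p q)"
    unfolding G_op_coeff[of k] G_op_coeff[of j] sum_distrib_left by (simp add: ne tw)
  have 2: "G_op j (G_op k g) T = (\<Sum>q\<in>UNIV. \<Sum>p\<in>UNIV. ?f p q)"
    unfolding G_op_coeff[of k] G_op_coeff[of j] sum_distrib_left
    by (intro sum.cong refl) (simp add: ne ac_simps)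
  show ?thesis
    unfolding 1 2 by (rule sum.swap)
qed
text \<open>True when the first \<open>k\<close> pairs contain an odd number of legs, see
  \<open>parity_odd\<close>. Residues depend on no more: at an even position both letters give the
  same residue, determined by the preceding pairs, and at an odd one the pair ending there is
  counted too.\<close>

primrec parity :: "pairs \<Rightarrow> nat \<Rightarrow> bool"
  where "parity T 0 = False"
  | "parity T (Suc k) = (parity T k = (fst (T k) = snd (T k)))"

text \<open>The residue of the node containing \<open>r\<close> in the tableau whose first column is encoded by \<open>T\<close>.\<close>

definition res_of :: "pairs \<Rightarrow> nat \<Rightarrow> nat"
  where "res_of T r = of_bool (if odd r then parity T (r div 2) else \<not> parity T (r div 2 - 1))"

lemma res_of_simps [simp]:
  "res_of T (Suc (2 * k)) = of_bool (parity T k)" "res_of T (Suc (Suc (2 * k))) = of_bool (\<not> parity T k)"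
  "res_of T (Suc 0) = 0"
  by (simp_all add: res_of_def)

lemma parity_cong: "(\<And>j. j < k \<Longrightarrow> (fst (T j) = snd (T j)) = (fst (U j) = snd (U j))) \<Longrightarrow> parity T k = parity U k"
  by (induction k) auto

lemma res_of_cong: "(\<And>j. (fst (T j) = snd (T j)) = (fst (U j) = snd (U j))) \<Longrightarrow> res_of T = res_of U"
  unfolding res_of_def fun_eq_iff using parity_cong[of _ T U] by simp

lemma parity_flip:
  assumes "\<And>j. (fst (T j) = snd (T j)) = ((fst (U j) = snd (U j)) = (j \<noteq> k \<and> j \<noteq> Suc k))"
  shows "parity T j = (parity U j = (j \<noteq> Suc k))"
proof (induction j)
  case (Suc j)
  then show ?case using assms[of j] unfolding parity.simps by auto
qed simp

lemma position_cases:
  obtains "r = 0" | j where "r = Suc (2 * j)" | j where "r = Suc (Suc (2 * j))"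
proof (cases r rule: parity_cases)
  case even
  then obtain m where "r = 2 * m" by blast
  then show ?thesis using that by (cases m) auto
next
  case odd
  then show ?thesis using that by (metis oddE Suc_eq_plus1)
qed

text \<open>Changing the kind of two consecutive pairs changes the leg parity only at the boundary
  between them. The two residues meeting there are opposite, so they are exchanged.\<close>

lemma res_of_flip:
  assumes "\<And>j. (fst (T j) = snd (T j)) = ((fst (U j) = snd (U j)) = (j \<noteq> k \<and> j \<noteq> Suc k))"
  shows "res_of T r = res_of U (transpose (Suc (2 * Suc k)) (Suc (Suc (2 * Suc k))) r)"
proof (cases r rule: position_cases)
  case 1
  then show ?thesis by (simp add: transpose_def res_of_def)
next
  case (2 j)
  then show ?thesis using parity_flip[OF assms, of j]
    by (cases "j = Suc k") (simp_all add: transpose_def double_not_eq_Suc_double Suc_double_not_eq_double del: parity.simps mult_Suc_right)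
next
  case (3 j)
  then show ?thesis using parity_flip[OF assms, of j] 
    by (cases "j = Suc k") (simp_all add: transpose_def double_not_eq_Suc_double Suc_double_not_eq_double del: parity.simps mult_Suc_right)
qed

lemma linop_E: "linop (E_op k)" and linop_F: "linop (F_op k)" and linop_G: "linop (G_op k)"
  by (simp_all add: linop_def E_op_def F_op_def fun_eq_iff)
    (simp add: G_op_coeff sum.distrib distrib_left sum_distrib_left mult.left_commute)

lemma linop_uminus: "linop L \<Longrightarrow> L (\<lambda>t. - g t) T = - L g T"
  using linop_scale[of L "-1" g] by (simp add: fun_eq_iff)

lemmas op_uminus = linop_uminus[OF linop_E] linop_uminus[OF linop_F] linop_uminus[OF linop_G]
lemmas op_zero = linop_zero[OF linop_E] linop_zero[OF linop_F] linop_zero[OF linop_G]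

section \<open>The action of the generators and the check of the defining relations\<close>

definition y_op :: "nat \<Rightarrow> (pairs \<Rightarrow> 'f::field) \<Rightarrow> pairs \<Rightarrow> 'f"
  where "y_op r g T = (if r \<le> 1 then 0 else if odd r then E_op (r div 2 - 1) g T else - E_op (r div 2 - 1) g T)"

definition psi_op :: "nat \<Rightarrow> (pairs \<Rightarrow> 'f::field) \<Rightarrow> pairs \<Rightarrow> 'f"
  where "psi_op r g T = (if r \<le> 1 then 0 else if odd r then G_op (r div 2 - 1) g T else F_op (r div 2 - 1) g T)"

definition e_op :: "nat \<Rightarrow> (nat \<Rightarrow> nat) \<Rightarrow> (pairs \<Rightarrow> 'f::field) \<Rightarrow> pairs \<Rightarrow> 'f"
  where "e_op n i g T = (if restrict (res_of T) {1..n} = i then g T else 0)"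

primrec klr_op :: "nat \<Rightarrow> klr_gen \<Rightarrow> (pairs \<Rightarrow> 'f::field) \<Rightarrow> pairs \<Rightarrow> 'f"
  where "klr_op n (Y r) = y_op r" | "klr_op n (Psi r) = psi_op r" | "klr_op n (E i) = e_op n i"

lemma y_op_simps [simp]:
  "y_op (Suc 0) g = (\<lambda>T. 0)"
  "y_op (Suc (Suc (2 * k))) g = (\<lambda>T. - E_op k g T)"
  "y_op (Suc (Suc (Suc (2 * k)))) g = E_op k g"
  by (simp_all add: y_op_def fun_eq_iff)

lemma psi_op_simps [simp]:
  "psi_op (Suc 0) g = (\<lambda>T. 0)"
  "psi_op (Suc (Suc (2 * k))) g = F_op k g"
  "psi_op (Suc (Suc (Suc (2 * k)))) g = G_op k g"
  by (simp_all add: psi_op_def fun_eq_iff)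

lemma linop_klr_op: "linop (klr_op n x)"
proof (cases x)
  case (Y r)
  then show ?thesis
    by (simp add: linop_def y_op_def fun_eq_iff linopD[OF linop_E])
next
  case (Psi r)
  then show ?thesis
    by (simp add: linop_def psi_op_def fun_eq_iff linopD[OF linop_F] linopD[OF linop_G])
next
  case (E i)
  then show ?thesis by (simp add: linop_def e_op_def fun_eq_iff)
qed

lemmas klr_act_mult = free_act_mult[of "klr_op n" for n, OF linop_klr_op]

lemma positive_cases:
  assumes "1 \<le> r"
  obtains "r = Suc 0" | k where "r = Suc (Suc (2 * k))" | k where "r = Suc (Suc (Suc (2 * k)))"
proof (cases r rule: position_cases)
  case (2 j)
  then show ?thesis using that by (cases j) auto
qed (use assms that in auto)

text \<open>With \<open>res_of_2k1\<close> and \<open>res_of_12\<close> this is the dictionary from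
  residues to letters that decides which case of a defining relation applies at a position.\<close>

lemma res_of_2k: "res_of T (Suc (Suc (2 * k))) = res_of T (Suc (Suc (Suc (2 * k)))) \<longleftrightarrow> fst (T k) \<noteq> snd (T k)"
  using res_of_simps(1)[of T "Suc k"] by simp

lemma res_of_2k1: "res_of T (Suc (Suc (Suc (2 * k)))) \<noteq> res_of T (Suc (Suc (Suc (Suc (2 * k)))))"
  using res_of_simps(1)[of T "Suc k"] res_of_simps(2)[of T "Suc k"] by (simp del: res_of_simps parity.simps)

lemma res_of_12: "res_of T (Suc 0) \<noteq> res_of T (Suc (Suc 0))"
  using res_of_simps(2)[of T 0] by simp

lemma E_op_res_of: "T k = (True, False) \<Longrightarrow> res_of (T(k := (False, True))) = res_of T"
  by (rule res_of_cong) auto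

lemma y_e_op: "y_op r (e_op n i g) T = e_op n i (y_op r g) T"
proof -
  have "E_op k (e_op n i g) T = e_op n i (E_op k g) T" for k
    by (simp add: E_op_def e_op_def E_op_res_of)
  then show ?thesis by (simp add: y_op_def e_op_def)
qed

lemma restrict_transpose:
  assumes "1 \<le> r" "r < n"
  shows "restrict f {1..n} = i \<circ> transpose r (Suc r) \<longleftrightarrow> restrict (f \<circ> transpose r (Suc r)) {1..n} = i"
proof -
  have *: "restrict f {1..n} \<circ> transpose r (Suc r) = restrict (f \<circ> transpose r (Suc r)) {1..n}"
    using assms by (auto simp: fun_eq_iff transpose_def)
  have "f' = i \<circ> transpose r (Suc r) \<longleftrightarrow> f' \<circ> transpose r (Suc r) = i" for f' :: "nat \<Rightarrow> 'a"
    by (auto simp: o_assoc[symmetric])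
  then show ?thesis unfolding *[symmetric] .
qed

text \<open>Every preimage that \<open>G_op\<close> reads has both pairs of the opposite kind, so a
  condition depending on kinds alone passes through the operator.\<close>

lemma G_op_if:
  assumes "\<And>x y. (fst x = snd x) \<noteq> (fst (T k) = snd (T k)) \<Longrightarrow>
    (fst y = snd y) \<noteq> (fst (T (Suc k)) = snd (T (Suc k))) \<Longrightarrow> P (T(k := x, Suc k := y)) = Q"
  shows "G_op k (\<lambda>T. if P T then g T else 0) T = (if Q then G_op k g T else 0)"
proof -
  obtain x x' y y' where xy: "T k = (x, x')" "T (Suc k) = (y, y')" by fastforce
  show ?thesis
    using assms[of "(True, True)" "(True, True)"] assms[of "(True, True)" "(False, False)"]
      assms[of "(False, False)" "(True, True)"] assms[of "(False, False)" "(False, False)"]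
      assms[of "(True, True)" "(False, True)"] assms[of "(False, False)" "(False, True)"]
      assms[of "(False, True)" "(True, True)"] assms[of "(False, True)" "(False, False)"]
      assms[of "(False, True)" "(False, True)"]
    by (cases x; cases x'; cases y; cases y') (simp_all add: G_op_def xy)
qed

lemma psi_e_op:
  assumes "1 \<le> r" "r < n"
  shows "psi_op r (e_op n i g) T = e_op n (i \<circ> transpose r (Suc r)) (psi_op r g) T"
  using assms(1)
proof (cases r rule: positive_cases)
  case (2 k)
  \<comment> \<open>At an even position \<psi> lives on a pair with different letters; its two
    residues agree, so the transposition has no effect on the residue sequence.\<close>
  have "res_of (T(k := (True, False))) = res_of T \<and> res_of T \<circ> transpose r (Suc r) = res_of T" if "T k = (False, True)"
  proof -
    have "res_of T r = res_of T (Suc r)" using res_of_2k[of T k] that unfolding 2 by auto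
    then show ?thesis using that
      by (intro conjI res_of_cong) (auto simp: fun_eq_iff transpose_def)
  qed
  then show ?thesis
    unfolding e_op_def restrict_transpose[OF assms] by (auto simp: 2 F_op_def)
next
  case (3 k)
  have *: "res_of (T(k := x, Suc k := y)) = res_of T \<circ> transpose r (Suc r)"
    if "(fst x = snd x) \<noteq> (fst (T k) = snd (T k))" "(fst y = snd y) \<noteq> (fst (T (Suc k)) = snd (T (Suc k)))" for x y
    using res_of_flip[of "T(k := x, Suc k := y)" T k] that by (auto simp: fun_eq_iff 3)
  have "G_op k (\<lambda>T. if restrict (res_of T) {1..n} = i then g T else 0) T =
     (if restrict (res_of T \<circ> transpose r (Suc r)) {1..n} = i then G_op k g T else 0)"
    by (rule G_op_if) (simp add: *)
  then show ?thesis
    unfolding e_op_def[abs_def] restrict_transpose[OF assms] unfolding 3 psi_op_simps .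
qed (simp add: e_op_def)

lemma res_of_residue_seqs: "restrict (res_of T) {1..n} \<in> residue_seqs n"
  by (auto simp: residue_seqs_def res_of_def)

lemma finite_residue_seqs: "finite (residue_seqs n)"
  unfolding residue_seqs_def by (rule finite_PiE) auto

lemma sum_e_op: "(\<Sum>i\<in>residue_seqs n. e_op n i g T) = g T"
  using res_of_residue_seqs[of T n] by (simp add: e_op_def finite_residue_seqs)

lemma free_act_power2_mult:
  "free_act (klr_op n) (p ^ 2 * q) g = free_act (klr_op n) p (free_act (klr_op n) p (free_act (klr_op n) q g))"
  by (simp add: power2_eq_square klr_act_mult)

lemma free_act_two: "free_act \<rho> 2 g t = 2 * g t"
  unfolding one_add_one[symmetric] free_act_add by (simp add: distrib_right)

lemma op_shift [simp]:
  "y_op (Suc (Suc 0)) g = (\<lambda>T. - E_op 0 g T)" "y_op (Suc (Suc (Suc 0))) g = E_op 0 g"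
  "y_op (Suc (Suc (Suc (Suc (2 * k))))) g = (\<lambda>T. - E_op (Suc k) g T)"
  "y_op (Suc (Suc (Suc (Suc (Suc (2 * k)))))) g = E_op (Suc k) g"
  "psi_op (Suc (Suc 0)) g = F_op 0 g" "psi_op (Suc (Suc (Suc (Suc (2 * k))))) g = F_op (Suc k) g"
  using y_op_simps(2)[of 0 g] y_op_simps(3)[of 0 g] y_op_simps(2)[of "Suc k" g] y_op_simps(3)[of "Suc k" g]
    psi_op_simps(2)[of 0 g] psi_op_simps(2)[of "Suc k" g]
  by simp_all

lemma e_op_eq_0:
  assumes "1 \<le> r" "r < n" "(res_of T r = res_of T (Suc r)) \<noteq> (i r = i (Suc r))"
  shows "e_op n i g T = 0"
  using assms by (auto simp: e_op_def)

lemma y_y_op: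
  assumes "1 \<le> r" "1 \<le> s"
  shows "y_op s (y_op r g) T = y_op r (y_op s g) T"
  using assms(1)
proof (cases r rule: positive_cases)
  case r: (2 k)
  show ?thesis
    using assms(2) by (cases s rule: positive_cases) (auto simp: r op_zero op_uminus E_comm[of k])
next
  case r: (3 k)
  show ?thesis
    using assms(2) by (cases s rule: positive_cases) (auto simp: r op_zero op_uminus E_comm[of k])
qed (simp add: y_op_def op_zero)

text \<open>Even positions r > 0 act inside one pair and odd positions r > 1 across a boundary. The
  factor e(i) prescribes the kinds of the pairs, and that decides whether the correction terms of
  the local relations survive.\<close>

lemma klr_relators_act_zero:
  assumes "p \<in> klr_relators n"
  shows "free_act (klr_op n) p g T = 0"
  using assms
proof cases
  case y_1
  then show ?thesis by simp
next
  case (e_1 i)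
  then show ?thesis by (auto simp: e_op_def)
next
  case (e_e i j)
  then show ?thesis by (auto simp: klr_act_mult e_op_def)
next
  case e_sum
  then show ?thesis by (simp add: sum_e_op)
next
  case (y_e r i)
  then show ?thesis by (simp add: klr_act_mult y_e_op)
next
  case (psi_e r i)
  then show ?thesis by (simp add: klr_act_mult psi_e_op)
next
  case (y_y r s)
  then show ?thesis by (simp add: klr_act_mult y_y_op)
next
  case (y_psi r s)
  have "y_op s (psi_op r g) T = psi_op r (y_op s g) T"
    using y_psi(2)
  proof (cases r rule: positive_cases)
    case r: (2 k)
    show ?thesis using y_psi(4)
      by (cases s rule: positive_cases) (use y_psi r in \<open>auto simp: op_zero op_uminus E_F_far\<close>)
  next
    case r: (3 k)
    show ?thesis using y_psi(4)
    proof (cases s rule: positive_cases)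
      case (2 j)
      then show ?thesis using r y_psi G_E_zero[of k g T] 
        by (cases "j = k"; cases "j = Suc k") (auto simp: op_uminus E_G_far)
    next
      case (3 j)
      then show ?thesis using r y_psi G_E_zero[of k g T] 
        by (cases "j = k"; cases "j = Suc k") (auto simp: op_uminus E_G_far)
    qed (simp add: r op_zero)
  qed (simp add: y_op_def op_zero)
  then show ?thesis using y_psi by (simp add: klr_act_mult)
next
  case (y_psi_left r i)
  let ?h = "e_op n i g"
  have "y_op r (psi_op r ?h) T - (psi_op r (y_op (Suc r) ?h) T - of_bool (i r = i (Suc r)) * ?h T) = 0"
    using y_psi_left(2)
  proof (cases r rule: positive_cases)
    case 1
    then have "of_bool (i r = i (Suc r)) * ?h T = 0"
      using y_psi_left res_of_12[of T] e_op_eq_0[of r n T i g] by auto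
    then show ?thesis using 1 by (simp add: op_zero)
  next
    case (2 k)
    then have "of_bool (i r = i (Suc r)) * ?h T = E_op k (F_op k ?h) T + F_op k (E_op k ?h) T"
      using y_psi_left res_of_2k[of T k] e_op_eq_0[of r n T i g] E_F[of k ?h T]
      by (auto simp del: res_of_simps)
    then show ?thesis
      using 2 by (simp only: y_op_simps psi_op_simps op_uminus) simp
  next
    case (3 k)
    then have "of_bool (i r = i (Suc r)) * ?h T = 0"
      using y_psi_left res_of_2k1[of T k] e_op_eq_0[of r n T i g] by auto
    then show ?thesis
      using 3 by (simp add: op_uminus G_E_zero)
  qed
  then show ?thesis using y_psi_left by (cases "i r = i (Suc r)") (auto simp: klr_act_mult left_diff_distrib)
next
  case (y_psi_right r i)
  let ?h = "e_op n i g"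
  have "y_op (Suc r) (psi_op r ?h) T - (psi_op r (y_op r ?h) T + of_bool (i r = i (Suc r)) * ?h T) = 0"
    using y_psi_right(2)
  proof (cases r rule: positive_cases)
    case 1
    then have "of_bool (i r = i (Suc r)) * ?h T = 0"
      using y_psi_right res_of_12[of T] e_op_eq_0[of r n T i g] by auto
    then show ?thesis using 1 by (simp add: op_zero)
  next
    case (2 k)
    then have "of_bool (i r = i (Suc r)) * ?h T = E_op k (F_op k ?h) T + F_op k (E_op k ?h) T"
      using y_psi_right res_of_2k[of T k] e_op_eq_0[of r n T i g] E_F[of k ?h T]
      by (auto simp del: res_of_simps)
    then show ?thesis
      using 2 by (simp only: y_op_simps psi_op_simps op_uminus) simp
  next
    case (3 k)
    then have "of_bool (i r = i (Suc r)) * ?h T = 0"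
      using y_psi_right res_of_2k1[of T k] e_op_eq_0[of r n T i g] by auto
    then show ?thesis
      using 3 by (simp add: op_uminus G_E_zero)
  qed
  then show ?thesis using y_psi_right by (cases "i r = i (Suc r)") (auto simp: klr_act_mult distrib_right)
next
  case (psi_psi r s)
  have "psi_op s (psi_op r g) T = psi_op r (psi_op s g) T"
    using psi_psi(2)
  proof (cases r rule: positive_cases)
    case r: (2 k)
    show ?thesis using psi_psi(4)
      by (cases s rule: positive_cases) (use psi_psi r in \<open>auto simp: op_zero F_comm F_G_far\<close>)
  next
    case r: (3 k)
    show ?thesis using psi_psi(4)
    proof (cases s rule: positive_cases)
      case (2 j)
      then show ?thesis using r psi_psi F_G_far[of j k g T] by auto
    next
      case (3 j)
      consider "j = k" | "k = Suc j" | "j = Suc k" | "Suc j < k" | "Suc k < j" by linarith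
      then have "G_op j (G_op k g) T = G_op k (G_op j g) T"
      proof cases
        case 4
        then show ?thesis by (rule G_far)
      next
        case 5
        then show ?thesis by (rule G_far[symmetric])
      qed (simp_all add: G_comm)
      then show ?thesis by (simp add: r 3)
    qed (simp add: r op_zero)
  qed (simp add: psi_op_def op_zero)
  then show ?thesis using psi_psi by (simp add: klr_act_mult)
next
  case (psi_sq_eq r i)
  let ?h = "e_op n i g"
  have "psi_op r (psi_op r ?h) T = 0"
    using psi_sq_eq(2)
  proof (cases r rule: positive_cases)
    case (3 k)
    \<comment> \<open>Residues never agree across a boundary, so this e(i) annihilates
      everything.\<close>
    have "?h U = 0" for U
      using psi_sq_eq res_of_2k1[of U k] 3 e_op_eq_0[of r n U i g] e_op_eq_0[of "Suc r" n U i g]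
      by (auto simp del: res_of_simps)
    then have "?h = (\<lambda>U. 0)" by (simp add: fun_eq_iff)
    then show ?thesis using 3 by (simp add: op_zero)
  qed (simp_all add: F_F)
  then show ?thesis using psi_sq_eq by (simp add: free_act_power2_mult)
next
  case (psi_sq_neq r i)
  let ?h = "e_op n i g"
  have "psi_op r (psi_op r ?h) T + (y_op r (y_op r ?h) T - y_op r (y_op (Suc r) ?h) T
    - y_op (Suc r) (y_op r ?h) T + y_op (Suc r) (y_op (Suc r) ?h) T) = 0"
    using psi_sq_neq(2)
  proof (cases r rule: positive_cases)
    case 1
    then show ?thesis by (simp add: op_zero op_uminus E_E)
  next
    case (2 k)
    then show ?thesis by (simp add: op_zero op_uminus E_E F_F)
  next
    case (3 k)
    then show ?thesis by (simp add: op_zero op_uminus E_E G_G E_comm[of "Suc k" k])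
  qed
  then show ?thesis using psi_sq_neq
    by (simp add: klr_act_mult power2_eq_square left_diff_distrib right_diff_distrib mult.assoc,
      simp add: algebra_simps)
next
  case (braid r i)
  let ?h = "e_op n i g"
  have "psi_op r (psi_op (Suc r) (psi_op r ?h)) T - psi_op (Suc r) (psi_op r (psi_op (Suc r) ?h)) T = 0"
    using braid(2)
  proof (cases r rule: positive_cases)
    case 1
    then show ?thesis by (simp add: op_zero)
  next
    case (2 k)
    \<comment> \<open>The residues at r + 1 and r + 2 lie on two sides of a boundary and differ;
      hence those at r and r + 1 agree, pair k has different letters, and the correction in
      \<open>FGF\<close> drops out.\<close>
    have "?h U = 0" if "fst (U k) = snd (U k)" for U
      using that res_of_2k[of U k] res_of_2k1[of U k] braid 2 e_op_eq_0[of r n U i g] e_op_eq_0[of "Suc r" n U i g]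
      by (auto simp del: res_of_simps)
    then show ?thesis using 2 by (simp add: FGF E_op_def)
  next
    case (3 k)
    have "?h U = 0" if "fst (U (Suc k)) = snd (U (Suc k))" for U
      using that res_of_2k[of U "Suc k"] res_of_2k1[of U k] braid 3 e_op_eq_0[of r n U i g] e_op_eq_0[of "Suc r" n U i g]
      by (auto simp del: res_of_simps)
    then show ?thesis using 3 by (simp add: GFG E_op_def)
  qed
  then show ?thesis using braid by (simp add: klr_act_mult mult.assoc)
next
  case (braid_neq r i)
  let ?h = "e_op n i g"
  have "psi_op r (psi_op (Suc r) (psi_op r ?h)) T - (psi_op (Suc r) (psi_op r (psi_op (Suc r) ?h)) T
     + y_op r ?h T - 2 * y_op (Suc r) ?h T + y_op (Suc (Suc r)) ?h T) = 0"
    using braid_neq(2)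
  proof (cases r rule: positive_cases)
    case 1
    have "?h U = 0" if "fst (U 0) \<noteq> snd (U 0)" for U
      using that res_of_2k[of U 0] braid_neq 1 e_op_eq_0[of r n U i g] e_op_eq_0[of "Suc r" n U i g]
      by (auto simp del: res_of_simps)
    then show ?thesis using 1 by (simp add: op_zero E_op_def)
  next
    case (2 k)
    have "?h U = 0" if "fst (U k) \<noteq> snd (U k)" for U
      using that res_of_2k[of U k] braid_neq 2 e_op_eq_0[of r n U i g] e_op_eq_0[of "Suc r" n U i g]
      by (auto simp del: res_of_simps)
    then show ?thesis using 2 by (simp add: FGF E_op_def)
  next
    case (3 k)
    have "?h U = 0" if "fst (U (Suc k)) \<noteq> snd (U (Suc k))" for U
      using that res_of_2k[of U "Suc k"] braid_neq 3 e_op_eq_0[of r n U i g] e_op_eq_0[of "Suc r" n U i g]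
      by (auto simp del: res_of_simps)
    then show ?thesis using 3
      by (simp add: GFG E_op_def)
  qed
  then show ?thesis using braid_neq
    by (simp add: klr_act_mult free_act_two mult.assoc distrib_right left_diff_distrib)
qed

section \<open>Spanning set of a cyclic module with Specht relations\<close>

text \<open>The spanning argument sees the module only through a left ideal \<open>J\<close> that
  contains the relations of the generator; \<open>c\<close> is the length of the first
  column.\<close>

locale hecke_left_ideal =
  fixes n c :: nat and i0 :: "nat \<Rightarrow> nat" and J :: "(klr_gen, 'f::field) free_alg set"
  assumes J_carrier: "J \<subseteq> carrier (free_algebra (klr_gens n))"
    and J_add: "p \<in> J \<Longrightarrow> q \<in> J \<Longrightarrow> p + q \<in> J"
    and J_mult: "p \<in> carrier (free_algebra (klr_gens n)) \<Longrightarrow> q \<in> J \<Longrightarrow> p * q \<in> J"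
    and relator_mult_J: "p \<in> klr_relators n \<Longrightarrow> q \<in> carrier (free_algebra (klr_gens n)) \<Longrightarrow> p * q \<in> J"
    and c_le: "c \<le> n"
    and y_J: "1 \<le> r \<Longrightarrow> r \<le> n \<Longrightarrow> y_gen r \<in> J"
    and e_J: "e_gen i0 - 1 \<in> J"
    and i0: "i0 \<in> residue_seqs n"
    and psi_J: "1 \<le> r \<Longrightarrow> r < n \<Longrightarrow> r \<noteq> c \<Longrightarrow> psi_gen r \<in> J"
    and garnir_J: "c < n \<Longrightarrow> prod_list (map psi_gen [1..<Suc c]) \<in> J"
begin

abbreviation "C \<equiv> carrier (free_algebra (klr_gens n)) :: (klr_gen, 'f) free_alg set"

definition cong (infix "\<approx>" 50) where "p \<approx> q \<longleftrightarrow> p - q \<in> J"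

lemma gen_C: "1 \<le> r \<Longrightarrow> r \<le> n \<Longrightarrow> y_gen r \<in> C" "1 \<le> r \<Longrightarrow> r < n \<Longrightarrow> psi_gen r \<in> C"
  "i \<in> residue_seqs n \<Longrightarrow> e_gen i \<in> C"
  by (rule free_algebra_closed(6); simp add: klr_gens_def)+

lemma J_uminus: "p \<in> J \<Longrightarrow> - p \<in> J"
  using J_mult[OF free_algebra_closed(5)[OF free_algebra_closed(2)], of p] by simp

lemma J_diff: "p \<in> J \<Longrightarrow> q \<in> J \<Longrightarrow> p - q \<in> J"
  using J_add[OF _ J_uminus, of p q] by simp

lemma J_zero: "0 \<in> J"
  using J_diff[OF e_J e_J] by simp

lemma cong_refl: "p \<approx> p"
  by (simp add: cong_def J_zero)

lemma cong_sym: "p \<approx> q \<Longrightarrow> q \<approx> p"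
  using J_uminus[of "p - q"] by (simp add: cong_def)

lemma cong_trans [trans]: "p \<approx> q \<Longrightarrow> q \<approx> r \<Longrightarrow> p \<approx> r"
  using J_add[of "p - q" "q - r"] by (simp add: cong_def)

lemma cong_mult: "p \<approx> q \<Longrightarrow> u \<in> C \<Longrightarrow> u * p \<approx> u * q"
  using J_mult[of u "p - q"] by (simp add: cong_def right_diff_distrib)

lemma cong_add: "p \<approx> q \<Longrightarrow> p' \<approx> q' \<Longrightarrow> p + p' \<approx> q + q'"
  using J_add[of "p - q" "p' - q'"] by (simp add: cong_def algebra_simps)

lemma cong_J: "p \<approx> q \<Longrightarrow> q \<in> J \<Longrightarrow> p \<in> J"
  using J_add[of "p - q" q] by (simp add: cong_def)

lemma relator_cong: "p - q \<in> klr_relators n \<Longrightarrow> u \<in> C \<Longrightarrow> p * u \<approx> q * u"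
  using relator_mult_J[of "p - q" u] by (simp add: cong_def left_diff_distrib)

lemma psi_psi_cong:
  "1 \<le> r \<Longrightarrow> r < n \<Longrightarrow> 1 \<le> s \<Longrightarrow> s < n \<Longrightarrow> s \<noteq> r + 1 \<Longrightarrow> r \<noteq> s + 1 \<Longrightarrow> u \<in> C \<Longrightarrow>
    psi_gen s * (psi_gen r * u) \<approx> psi_gen r * (psi_gen s * u)"
  unfolding mult.assoc[symmetric] by (rule relator_cong[OF klr_relators.psi_psi])

definition words :: "nat set set"
  where "words = {T. T \<subseteq> {1..n} \<and> card T = c}"

text \<open>Words are the possible sets of entries of the first column. \<open>up\<close> and
  \<open>dn\<close> change the sum of the entries by one, so this sum is the length of the
  Grassmannian permutation up to a constant; it is the measure of the inductions below.\<close>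

definition up :: "nat \<Rightarrow> nat set \<Rightarrow> nat set"
  where "up r T = insert (Suc r) (T - {r})"

definition dn :: "nat \<Rightarrow> nat set \<Rightarrow> nat set"
  where "dn r T = insert r (T - {Suc r})"

lemma finite_words: "T \<in> words \<Longrightarrow> finite T"
  by (auto simp: words_def intro: finite_subset)

lemma up_dn: "r \<notin> T \<Longrightarrow> Suc r \<in> T \<Longrightarrow> up r (dn r T) = T"
  and dn_up: "r \<in> T \<Longrightarrow> Suc r \<notin> T \<Longrightarrow> dn r (up r T) = T"
  by (auto simp: up_def dn_def)

lemma dn_words: "T \<in> words \<Longrightarrow> 1 \<le> r \<Longrightarrow> r \<notin> T \<Longrightarrow> Suc r \<in> T \<Longrightarrow> dn r T \<in> words"
  using finite_words[of T] by (auto simp: words_def dn_def card_Suc_Diff1 simp del: card_Diff_singleton card_Diff_insert)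

lemma sum_dn: "T \<in> words \<Longrightarrow> r \<notin> T \<Longrightarrow> Suc r \<in> T \<Longrightarrow> \<Sum>T = Suc (\<Sum>(dn r T))"
  using finite_words[of T] by (simp add: dn_def sum.remove[of T "Suc r"])

lemma up_words: "T \<in> words \<Longrightarrow> r < n \<Longrightarrow> r \<in> T \<Longrightarrow> Suc r \<notin> T \<Longrightarrow> up r T \<in> words"
  using finite_words[of T] by (auto simp: words_def up_def card_Suc_Diff1 simp del: card_Diff_singleton card_Diff_insert)

lemma sum_up: "T \<in> words \<Longrightarrow> r \<in> T \<Longrightarrow> Suc r \<notin> T \<Longrightarrow> \<Sum>(up r T) = Suc (\<Sum>T)"
  using finite_words[of T] by (simp add: up_def sum.remove[of T r])

lemma initial_words: "{1..c} \<in> words"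
  using c_le by (auto simp: words_def)

lemma downset_eq:
  assumes T: "T \<subseteq> {1..n}" and d: "\<And>r. 1 \<le> r \<Longrightarrow> r < n \<Longrightarrow> Suc r \<in> T \<Longrightarrow> r \<in> T"
  shows "T = {1..card T}"
proof -
  have fin: "finite T" using T by (rule finite_subset) simp
  have *: "j - k \<in> T" if "j \<in> T" "k < j" for j k
    using that
  proof (induction k)
    case (Suc k)
    then show ?case using d[of "j - Suc k"] T by (auto simp: Suc_diff_Suc)
  qed simp
  have "T = {1..Max T}" if "T \<noteq> {}"
  proof
    show "T \<subseteq> {1..Max T}" using T fin by auto
    show "{1..Max T} \<subseteq> T"
    proof
      fix k assume "k \<in> {1..Max T}"
      then show "k \<in> T"
        using *[of "Max T" "Max T - k"] Max_in[OF fin that] by simp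
    qed
  qed
  moreover have "T = {1..0}" if "T = {}" using that by simp
  ultimately obtain m where m: "T = {1..m}" by metis
  then have "card T = m" by simp
  then show ?thesis using m by metis
qed

lemma downset_initial:
  "T \<in> words \<Longrightarrow> (\<And>r. 1 \<le> r \<Longrightarrow> r < n \<Longrightarrow> Suc r \<in> T \<Longrightarrow> r \<in> T) \<Longrightarrow> T = {1..c}"
  using downset_eq[of T] by (auto simp: words_def)

text \<open>
  Products of \<open>\<psi>\<close>'s along reduced words of Grassmannian permutations. Such permutations are fully
  commutative, so only the commutation relation is needed for uniqueness modulo \<open>J\<close>.
\<close>

inductive reduced_rep :: "nat set \<Rightarrow> (klr_gen, 'f) free_alg \<Rightarrow> bool" where
  reduced_rep_initial: "reduced_rep {1..c} 1"
| reduced_rep_up: "T \<in> words \<Longrightarrow> reduced_rep T p \<Longrightarrow> 1 \<le> r \<Longrightarrow> r < n \<Longrightarrow> r \<in> T \<Longrightarrow> Suc r \<notin> T \<Longrightarrow> reduced_rep (up r T) (psi_gen r * p)"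

lemma reduced_rep_C: "reduced_rep T p \<Longrightarrow> p \<in> C"
  by (induction rule: reduced_rep.induct) (auto intro: free_algebra_closed(2) free_algebra_closed(4)[OF gen_C(2)])

lemma ex_descent:
  assumes "T \<in> words" "T \<noteq> {1..c}"
  obtains r where "1 \<le> r" "r < n" "r \<notin> T" "Suc r \<in> T"
  using downset_initial[OF assms(1)] assms(2) by blast

lemma ex_reduced_rep: "T \<in> words \<Longrightarrow> \<exists>p. reduced_rep T p"
proof (induction "\<Sum>T" arbitrary: T rule: less_induct)
  case less
  show ?case
  proof (cases "T = {1..c}")
    case True
    then show ?thesis using reduced_rep_initial by blast
  next
    case False
    then obtain r where r: "1 \<le> r" "r < n" "r \<notin> T" "Suc r \<in> T" using ex_descent less.prems by blast
    then obtain p where "reduced_rep (dn r T) p"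
      using less.hyps[of "dn r T"] sum_dn[of T r] dn_words[of T r] less.prems by auto
    then have "reduced_rep (up r (dn r T)) (psi_gen r * p)"
      using r dn_words[of T r] less.prems by (intro reduced_rep_up) (auto simp: dn_def)
    then show ?thesis using up_dn r by auto
  qed
qed

text \<open>A diamond argument. The last letters of two reduced products are descents r and s of the
  same set; distinct descents are never neighbours, so \<psi>_r and \<psi>_s commute and both
  products can be compared with one through the common lower set.\<close>

lemma reduced_rep_unique: "T \<in> words \<Longrightarrow> reduced_rep T p \<Longrightarrow> reduced_rep T q \<Longrightarrow> p \<approx> q"
proof (induction "\<Sum>T" arbitrary: T p q rule: less_induct)
  case less
  have ini: "p = 1" if "reduced_rep {1..c} p" for p
    using that
  proof cases
    case (reduced_rep_up T' p' r)
    have "Suc r \<in> up r T'" "r \<notin> up r T'" by (auto simp: up_def)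
    then have "Suc r \<in> {1..c}" "r \<notin> {1..c}" using reduced_rep_up(1) by metis+
    then show ?thesis using \<open>1 \<le> r\<close> by auto
  qed simp
  show ?case
  proof (cases "T = {1..c}")
    case True
    then show ?thesis using ini less.prems cong_refl by metis
  next
    case False
    obtain r p' where p: "reduced_rep (dn r T) p'" "p = psi_gen r * p'" "1 \<le> r" "r < n" "r \<notin> T" "Suc r \<in> T"
      using less.prems(2) False
    proof cases
      case (reduced_rep_up T' u t)
      then show ?thesis using that[of t u] dn_up[of t T'] by (auto simp: up_def)
    qed simp
    obtain s q' where q: "reduced_rep (dn s T) q'" "q = psi_gen s * q'" "1 \<le> s" "s < n" "s \<notin> T" "Suc s \<in> T"
      using less.prems(3) False
    proof cases
      case (reduced_rep_up T' u t)
      then show ?thesis using that[of t u] dn_up[of t T'] by (auto simp: up_def)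
    qed simp
    note rw = dn_words[OF less.prems(1) p(3,5,6)] and sw = dn_words[OF less.prems(1) q(3,5,6)]
    note rs = sum_dn[OF less.prems(1) p(5,6)] and ss = sum_dn[OF less.prems(1) q(5,6)]
    show ?thesis
    proof (cases "r = s")
      case True
      then show ?thesis
        using less.hyps[OF _ rw p(1), of q'] p q rs by (auto intro!: cong_mult gen_C)
    next
      case False
      have far: "s \<noteq> r + 1" "r \<noteq> s + 1" using p q by auto
      let ?U = "dn s (dn r T)"
      have mem: "s \<notin> dn r T" "Suc s \<in> dn r T" "r \<notin> dn s T" "Suc r \<in> dn s T"
        and U: "dn r (dn s T) = ?U"
        using p q far False by (auto simp: dn_def)
      have Uw: "?U \<in> words" using dn_words[OF rw q(3) mem(1,2)] .
      then obtain u where u: "reduced_rep ?U u" using ex_reduced_rep by blast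
      have "reduced_rep (up s ?U) (psi_gen s * u)" "reduced_rep (up r ?U) (psi_gen r * u)"
        using Uw u q p far False by (auto intro!: reduced_rep_up simp: dn_def)
      then have "reduced_rep (dn r T) (psi_gen s * u)" "reduced_rep (dn s T) (psi_gen r * u)"
        using up_dn mem U by metis+
      then have "p' \<approx> psi_gen s * u" "q' \<approx> psi_gen r * u"
        using less.hyps[OF _ rw p(1)] less.hyps[OF _ sw q(1)] rs ss by auto
      then have "p \<approx> psi_gen r * (psi_gen s * u)" "q \<approx> psi_gen s * (psi_gen r * u)"
        using p q by (auto intro!: cong_mult gen_C)
      moreover have "psi_gen r * (psi_gen s * u) \<approx> psi_gen s * (psi_gen r * u)"
        using far p q reduced_rep_C[OF u] by (intro psi_psi_cong) auto
      ultimately show ?thesis using cong_trans cong_sym by blast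
    qed
  qed
qed

definition V :: "nat set \<Rightarrow> (klr_gen, 'f) free_alg"
  where "V T = (SOME p. reduced_rep T p)"

lemma reduced_rep_V: "T \<in> words \<Longrightarrow> reduced_rep T (V T)"
  unfolding V_def using ex_reduced_rep by (rule someI_ex)

lemma V_C: "T \<in> words \<Longrightarrow> V T \<in> C"
  by (rule reduced_rep_C[OF reduced_rep_V])

lemma V_initial: "V {1..c} \<approx> 1"
  using reduced_rep_unique[OF initial_words reduced_rep_V[OF initial_words] reduced_rep_initial] .

lemma V_up: "T \<in> words \<Longrightarrow> 1 \<le> r \<Longrightarrow> r < n \<Longrightarrow> r \<in> T \<Longrightarrow> Suc r \<notin> T \<Longrightarrow> V (up r T) \<approx> psi_gen r * V T"
  by (rule reduced_rep_unique[OF up_words reduced_rep_V[OF up_words] reduced_rep_up[OF _ reduced_rep_V]])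

lemma V_dn: "T \<in> words \<Longrightarrow> 1 \<le> r \<Longrightarrow> r < n \<Longrightarrow> r \<notin> T \<Longrightarrow> Suc r \<in> T \<Longrightarrow> V T \<approx> psi_gen r * V (dn r T)"
  using V_up[of "dn r T" r] up_dn[of r T] dn_words[of T r] by (simp add: dn_def)

text \<open>The length filtration modulo \<open>J\<close>. Generating it inductively reduces its
  stability under left multiplication to the vectors \<open>V T\<close>.\<close>

inductive_set filtr :: "nat \<Rightarrow> (klr_gen, 'f) free_alg set" for k :: nat where
  filtr_J: "p \<in> J \<Longrightarrow> p \<in> filtr k"
| filtr_V: "T \<in> words \<Longrightarrow> \<Sum>T < k \<Longrightarrow> V T \<in> filtr k"
| filtr_add: "p \<in> filtr k \<Longrightarrow> q \<in> filtr k \<Longrightarrow> p + q \<in> filtr k"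
| filtr_const: "p \<in> filtr k \<Longrightarrow> const d * p \<in> filtr k"

lemma filtr_mono: "p \<in> filtr k \<Longrightarrow> k \<le> l \<Longrightarrow> p \<in> filtr l"
  by (induction rule: filtr.induct) (auto intro: filtr.intros)

lemma filtr_uminus: "p \<in> filtr k \<Longrightarrow> - p \<in> filtr k"
  using filtr_const[of p k "- 1"] by (simp add: const_minus_one)

lemma filtr_diff: "p \<in> filtr k \<Longrightarrow> q \<in> filtr k \<Longrightarrow> p - q \<in> filtr k"
  using filtr_add[OF _ filtr_uminus, of p k q] by simp

lemma filtr_cong: "p \<approx> q \<Longrightarrow> q \<in> filtr k \<Longrightarrow> p \<in> filtr k"
  using filtr_add[OF filtr_J, of "p - q"] unfolding cong_def by fastforce

lemma filtr_map:
  assumes "p \<in> filtr k" "u \<in> C" "\<And>T. T \<in> words \<Longrightarrow> \<Sum>T < k \<Longrightarrow> u * V T \<in> filtr l"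
  shows "u * p \<in> filtr l"
  using assms(1)
proof (induction rule: filtr.induct)
  case (filtr_J p)
  then show ?case using J_mult[OF assms(2)] filtr.filtr_J by blast
next
  case (filtr_V T)
  then show ?case by (rule assms(3))
next
  case (filtr_add p q)
  then show ?case by (simp add: distrib_left filtr.filtr_add)
next
  case (filtr_const p d)
  have "u * (const d * p) = const d * (u * p)"
    by (metis mult.assoc const_mult_commute)
  then show ?case using filtr.filtr_const[OF filtr_const.IH] by simp
qed

text \<open>The defining relations carry an idempotent on the right. For a vector with a weight it
  can be inserted and removed modulo \<open>J\<close>.\<close>

definition weight :: "(nat \<Rightarrow> nat) \<Rightarrow> (klr_gen, 'f) free_alg \<Rightarrow> bool"
  where "weight i u \<longleftrightarrow> i \<in> residue_seqs n \<and> u \<in> C \<and> e_gen i * u \<approx> u"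

lemma weight_psi: "weight i u \<Longrightarrow> 1 \<le> r \<Longrightarrow> r < n \<Longrightarrow> weight (i \<circ> transpose r (Suc r)) (psi_gen r * u)"
proof -
  assume u: "weight i u" and r: "1 \<le> r" "r < n"
  have "e_gen (i \<circ> transpose r (Suc r)) * (psi_gen r * u) \<approx> psi_gen r * (e_gen i * u)"
    using relator_cong[OF klr_relators.psi_e[OF r, of i], of u] u
    by (simp add: weight_def mult.assoc cong_sym)
  also have "\<dots> \<approx> psi_gen r * u"
    using u r by (intro cong_mult gen_C) (auto simp: weight_def)
  finally show ?thesis
    using u r residue_seqs_transpose[of i n r] free_algebra_closed(4)[OF gen_C(2), of r u] by (auto simp: weight_def)
qed

lemma weight_cong: "weight i u \<Longrightarrow> v \<approx> u \<Longrightarrow> v \<in> C \<Longrightarrow> weight i v"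
  unfolding weight_def using cong_mult[of v u "e_gen i"] gen_C(3) cong_trans cong_sym by meson

lemma weight_V: "T \<in> words \<Longrightarrow> \<exists>i. weight i (V T)"
proof (induction "\<Sum>T" arbitrary: T rule: less_induct)
  case less
  show ?case
  proof (cases "T = {1..c}")
    case True
    have "weight i0 1" using i0 e_J by (auto simp: weight_def cong_def free_algebra_closed)
    then show ?thesis using weight_cong[OF _ V_initial] V_C[OF initial_words] True by blast
  next
    case False
    then obtain r where r: "1 \<le> r" "r < n" "r \<notin> T" "Suc r \<in> T" using ex_descent less.prems by blast
    then obtain i where "weight i (V (dn r T))"
      using less.hyps[of "dn r T"] sum_dn[of T r] dn_words[of T r] less.prems by auto
    then show ?thesis
      using weight_cong[OF weight_psi V_dn] r less.prems V_C by blast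
  qed
qed

lemma weight_relator:
  assumes "a * e_gen i - b * e_gen i \<in> klr_relators n" "weight i u" "a \<in> C" "b \<in> C"
  shows "a * u \<approx> b * u"
proof -
  have "a * (e_gen i * u) \<approx> b * (e_gen i * u)"
    using relator_cong[OF assms(1), of u] assms by (simp add: weight_def mult.assoc)
  moreover have "a * (e_gen i * u) \<approx> a * u" "b * (e_gen i * u) \<approx> b * u"
    using assms by (auto intro!: cong_mult simp: weight_def)
  ultimately show ?thesis using cong_trans cong_sym by blast
qed

lemma filtr_of_bool: "u \<in> filtr k \<Longrightarrow> of_bool P * u \<in> filtr k"
  by (cases P) (simp_all add: filtr_J J_zero)

lemma y_psi_left_filtr:
  assumes u: "weight i u" "u \<in> filtr k" and r: "1 \<le> r" "r < n"
  shows "y_gen r * (psi_gen r * u) - psi_gen r * (y_gen (Suc r) * u) \<in> filtr k"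
proof -
  have "(y_gen r * psi_gen r) * u \<approx> (psi_gen r * y_gen (Suc r) - of_bool (i r = i (Suc r))) * u"
    using klr_relators.y_psi_left[OF r, of i] u(1) r
    by (intro weight_relator[of _ i]) (auto simp: weight_def intro!: C_ops gen_C)
  then have "y_gen r * (psi_gen r * u) - psi_gen r * (y_gen (Suc r) * u) \<approx> - (of_bool (i r = i (Suc r)) * u)"
    by (simp add: cong_def algebra_simps mult.assoc)
  then show ?thesis by (rule filtr_cong) (intro filtr_uminus filtr_of_bool u)
qed

lemma y_psi_right_filtr:
  assumes u: "weight i u" "u \<in> filtr k" and r: "1 \<le> r" "r < n"
  shows "y_gen (Suc r) * (psi_gen r * u) - psi_gen r * (y_gen r * u) \<in> filtr k"
proof -
  have "(y_gen (Suc r) * psi_gen r) * u \<approx> (psi_gen r * y_gen r + of_bool (i r = i (Suc r))) * u"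
    using klr_relators.y_psi_right[OF r, of i] u(1) r
    by (intro weight_relator[of _ i]) (auto simp: weight_def intro!: C_ops gen_C)
  then have "y_gen (Suc r) * (psi_gen r * u) - psi_gen r * (y_gen r * u) \<approx> of_bool (i r = i (Suc r)) * u"
    by (simp add: cong_def algebra_simps mult.assoc)
  then show ?thesis by (rule filtr_cong) (intro filtr_of_bool u)
qed

lemma psi_sq_filtr:
  assumes u: "weight i u" and r: "1 \<le> r" "r < n"
    and yy: "\<And>s t. 1 \<le> s \<Longrightarrow> s \<le> n \<Longrightarrow> 1 \<le> t \<Longrightarrow> t \<le> n \<Longrightarrow> y_gen s * (y_gen t * u) \<in> filtr k"
  shows "psi_gen r * (psi_gen r * u) \<in> filtr k"
proof (cases "i r = i (Suc r)")
  case True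
  have "psi_gen r ^ 2 * u \<approx> 0 * u"
    using klr_relators.psi_sq_eq[OF r, of i] u r True
    by (intro weight_relator[of _ i]) (auto simp: weight_def intro!: C_ops gen_C)
  then show ?thesis by (intro filtr_J) (simp add: cong_def power2_eq_square mult.assoc)
next
  case False
  have "psi_gen r ^ 2 * u \<approx> (- ((y_gen r - y_gen (Suc r)) ^ 2)) * u"
    using klr_relators.psi_sq_neq[OF r, of i] u r False
    by (intro weight_relator[of _ i]) (auto simp: weight_def intro!: C_ops gen_C)
  then have "psi_gen r * (psi_gen r * u) \<approx> (y_gen r * (y_gen (Suc r) * u) - y_gen (Suc r) * (y_gen (Suc r) * u))
     - (y_gen r * (y_gen r * u) - y_gen (Suc r) * (y_gen r * u))"
    by (simp add: cong_def power2_eq_square algebra_simps mult.assoc)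
  then show ?thesis by (rule filtr_cong) (use r in \<open>intro filtr_diff yy; simp\<close>)
qed

lemma braid_filtr:
  assumes u: "weight i u" and r: "1 \<le> r" "r + 1 < n"
    and yy: "\<And>s. 1 \<le> s \<Longrightarrow> s \<le> n \<Longrightarrow> y_gen s * u \<in> filtr k"
  shows "psi_gen r * (psi_gen (Suc r) * (psi_gen r * u)) - psi_gen (Suc r) * (psi_gen r * (psi_gen (Suc r) * u)) \<in> filtr k"
proof (cases "i r = i (r + 1) \<or> i (r + 1) = i (r + 2)")
  case True
  have "psi_gen r * psi_gen (Suc r) * psi_gen r * u \<approx> psi_gen (Suc r) * psi_gen r * psi_gen (Suc r) * u"
    using klr_relators.braid[OF r _ True] u r
    by (intro weight_relator[of _ i]) (auto simp: weight_def intro!: C_ops gen_C)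
  then show ?thesis by (intro filtr_J) (simp add: cong_def mult.assoc)
next
  case False
  have "psi_gen r * psi_gen (Suc r) * psi_gen r * u \<approx> (psi_gen (Suc r) * psi_gen r * psi_gen (Suc r)
     + y_gen r - 2 * y_gen (Suc r) + y_gen (Suc (Suc r))) * u"
    using klr_relators.braid_neq[OF r, of i] False u r
    by (intro weight_relator[of _ i]) (auto simp: weight_def intro!: C_ops gen_C)
  then have "psi_gen r * (psi_gen (Suc r) * (psi_gen r * u)) - psi_gen (Suc r) * (psi_gen r * (psi_gen (Suc r) * u))
    \<approx> (y_gen r * u - y_gen (Suc r) * u) - (y_gen (Suc r) * u - y_gen (Suc (Suc r)) * u)"
    by (simp add: cong_def algebra_simps mult.assoc mult_2)
  then show ?thesis by (rule filtr_cong) (use r in \<open>intro filtr_diff yy; simp\<close>)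
qed

lemma y_psi_far_cong:
  "1 \<le> r \<Longrightarrow> r < n \<Longrightarrow> 1 \<le> s \<Longrightarrow> s \<le> n \<Longrightarrow> s \<noteq> r \<Longrightarrow> s \<noteq> r + 1 \<Longrightarrow> u \<in> C \<Longrightarrow>
    y_gen s * (psi_gen r * u) \<approx> psi_gen r * (y_gen s * u)"
  unfolding mult.assoc[symmetric] by (rule relator_cong[OF klr_relators.y_psi])

lemma y_filtr_step:
  assumes p: "p \<in> filtr k" and s: "1 \<le> s" "s \<le> n"
    and V: "\<And>U. U \<in> words \<Longrightarrow> \<Sum>U < k \<Longrightarrow> y_gen s * V U \<in> filtr (\<Sum>U)"
  shows "y_gen s * p \<in> filtr k"
  using p
proof (rule filtr_map)
  fix U assume U: "U \<in> words" "\<Sum>U < k"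
  then have "y_gen s * V U \<in> filtr (\<Sum>U)" by (rule V)
  then show "y_gen s * V U \<in> filtr k" by (rule filtr_mono) (use U in simp)
qed (use s in \<open>auto intro: gen_C\<close>)

lemma psi_filtr_step:
  assumes p: "p \<in> filtr k" and r: "1 \<le> r" "r < n"
    and V: "\<And>U. U \<in> words \<Longrightarrow> \<Sum>U < k \<Longrightarrow> \<not> (r \<in> U \<and> Suc r \<notin> U) \<Longrightarrow> psi_gen r * V U \<in> filtr (\<Sum>U)"
  shows "psi_gen r * p \<in> filtr (Suc k)"
  using p
proof (rule filtr_map)
  fix U assume U: "U \<in> words" "\<Sum>U < k"
  show "psi_gen r * V U \<in> filtr (Suc k)"
  proof (cases "r \<in> U \<and> Suc r \<notin> U")
    case True
    then have "V (up r U) \<in> filtr (Suc k)"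
      using U r up_words[of U r] sum_up[of U r] by (intro filtr_V) auto
    then show ?thesis
      using filtr_cong[OF cong_sym[OF V_up[OF U(1) r]]] True by blast
  next
    case False
    then have "psi_gen r * V U \<in> filtr (\<Sum>U)" by (rule V[OF U])
    then show ?thesis by (rule filtr_mono) (use U in simp)
  qed
qed (use r in \<open>auto intro: gen_C\<close>)

text \<open>
  The gain of strictness (the bound in \<open>filtr\<close> is strict) is what makes the induction close: a braid
  replaces a vector by one two steps lower, and the correction terms \<open>y\<^sub>s\<close> do not raise the degree.
\<close>

lemma gen_V_filtr:
  assumes "T \<in> words"
  shows "(\<forall>s. 1 \<le> s \<longrightarrow> s \<le> n \<longrightarrow> y_gen s * V T \<in> filtr (\<Sum>T)) \<and>
    (\<forall>r. 1 \<le> r \<longrightarrow> r < n \<longrightarrow> \<not> (r \<in> T \<and> Suc r \<notin> T) \<longrightarrow> psi_gen r * V T \<in> filtr (\<Sum>T))"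
  using assms
proof (induction "\<Sum>T" arbitrary: T rule: less_induct)
  case less
  note T = \<open>T \<in> words\<close>
  have IHy: "y_gen s * V U \<in> filtr (\<Sum>U)" if "U \<in> words" "\<Sum>U < \<Sum>T" "1 \<le> s" "s \<le> n" for U s
    using less.hyps[of U] that by blast
  have IHpsi: "psi_gen r * V U \<in> filtr (\<Sum>U)"
    if "U \<in> words" "\<Sum>U < \<Sum>T" "1 \<le> r" "r < n" "\<not> (r \<in> U \<and> Suc r \<notin> U)" for U r
    using less.hyps[of U] that by blast
  have y_filtr: "y_gen s * p \<in> filtr k" if "p \<in> filtr k" "k \<le> \<Sum>T" "1 \<le> s" "s \<le> n" for p s k
    using that(1,3,4) by (rule y_filtr_step) (use IHy that in auto)
  have psi_filtr: "psi_gen r * p \<in> filtr (Suc k)" if "p \<in> filtr k" "k \<le> \<Sum>T" "1 \<le> r" "r < n" for p r k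
    using that(1,3,4) by (rule psi_filtr_step) (use IHpsi that in auto)
  show ?case
  proof (cases "T = {1..c}")
    case True
    have "u * V T \<in> filtr (\<Sum>T)" if "u \<in> J" for u
      using cong_J[OF cong_mult[OF V_initial, of u]] J_carrier that True by (auto intro: filtr_J)
    then show ?thesis using y_J psi_J True by auto
  next
    case False
    have A: "y_gen s * V T \<in> filtr (\<Sum>T)" if s: "1 \<le> s" "s \<le> n" for s
    proof -
      obtain r where r: "1 \<le> r" "r < n" "r \<notin> T" "Suc r \<in> T" using ex_descent[OF T False] by blast
      define U where "U = dn r T"
      have U: "U \<in> words" "\<Sum>T = Suc (\<Sum>U)"
        using dn_words[OF T] sum_dn[OF T] r by (auto simp: U_def)
      obtain i where i: "weight i (V U)" using weight_V[OF U(1)] by blast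
      have VU: "V U \<in> filtr (\<Sum>T)" using U by (intro filtr_V) auto
      \<comment> \<open>By induction y does not raise the filtration of \<open>V U\<close>, and
        \<psi>_r raises it by one, which is just the gap between \<open>U\<close> and
        \<open>T\<close>.\<close>
      have yU: "psi_gen r * (y_gen t * V U) \<in> filtr (\<Sum>T)" if "1 \<le> t" "t \<le> n" for t
        unfolding U(2) using U that r by (intro psi_filtr IHy) auto
      have "y_gen s * (psi_gen r * V U) \<in> filtr (\<Sum>T)"
      proof -
        consider "s = r" | "s = Suc r" | "s \<noteq> r" "s \<noteq> r + 1" by force
        then show ?thesis
        proof cases
          case 1
          have "y_gen r * (psi_gen r * V U) - psi_gen r * (y_gen (Suc r) * V U) \<in> filtr (\<Sum>T)"
            by (rule y_psi_left_filtr[OF i VU r(1,2)])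
          then show ?thesis using filtr_add[OF _ yU[of "Suc r"]] r 1 by fastforce
        next
          case 2
          have "y_gen (Suc r) * (psi_gen r * V U) - psi_gen r * (y_gen r * V U) \<in> filtr (\<Sum>T)"
            by (rule y_psi_right_filtr[OF i VU r(1,2)])
          then show ?thesis using filtr_add[OF _ yU[of r]] r 2 by fastforce
        next
          case 3
          then show ?thesis
            using filtr_cong[OF y_psi_far_cong yU[OF s]] r s V_C[OF U(1)] by blast
        qed
      qed
      then show ?thesis
        using cong_mult[OF V_dn[OF T r] gen_C(1)[OF s]] filtr_cong U_def by blast
    qed
    have B: "psi_gen r * V T \<in> filtr (\<Sum>T)" if r: "1 \<le> r" "r < n" "\<not> (r \<in> T \<and> Suc r \<notin> T)" for r
    proof (cases "r \<notin> T \<and> Suc r \<in> T")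
      case True
      define U where "U = dn r T"
      have U: "U \<in> words" "\<Sum>T = Suc (\<Sum>U)"
        using dn_words[OF T] sum_dn[OF T] r True by (auto simp: U_def)
      obtain i where i: "weight i (V U)" using weight_V[OF U(1)] by blast
      \<comment> \<open>\<psi>_r^2 is zero or quadratic in the y's, so the lower vector is hit by no
        \<psi> at all.\<close>
      have "psi_gen r * (psi_gen r * V U) \<in> filtr (\<Sum>U)"
        by (rule psi_sq_filtr[OF i r(1,2)]) (use U in \<open>intro y_filtr IHy; simp\<close>)
      then show ?thesis
        using cong_mult[OF V_dn[OF T r(1,2)] gen_C(2)[OF r(1,2)]] filtr_cong filtr_mono[of _ "\<Sum>U" "\<Sum>T"] U U_def True
        by (metis le_SucI order_refl)
    next
      case same: False
      obtain q where q: "1 \<le> q" "q < n" "q \<notin> T" "Suc q \<in> T" using ex_descent[OF T False] by blast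
      define U where "U = dn q T"
      have U: "U \<in> words" "\<Sum>T = Suc (\<Sum>U)"
        using dn_words[OF T] sum_dn[OF T] q by (auto simp: U_def)
      have VT: "psi_gen r * V T \<approx> psi_gen r * (psi_gen q * V U)"
        using cong_mult[OF V_dn[OF T q] gen_C(2)[OF r(1,2)]] U_def by simp
      consider "r = Suc q" | "q = Suc r" | "r \<noteq> q + 1" "q \<noteq> r + 1" by force
      then show ?thesis
      proof cases
        case 1
        define W where "W = dn r U"
        have rU: "r \<notin> U" "Suc r \<in> U" using q r same 1 by (auto simp: U_def dn_def)
        have W: "W \<in> words" "\<Sum>U = Suc (\<Sum>W)"
          using dn_words[OF U(1)] sum_dn[OF U(1)] rU r by (auto simp: W_def)
        have qW: "q \<in> W" "Suc q \<in> W" using q 1 by (auto simp: U_def W_def dn_def)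
        obtain i where i: "weight i (V W)" using weight_V[OF W(1)] by blast
        \<comment> \<open>Both q and q + 1 lie in \<open>W\<close>, so the innermost \<psi>_q yields
          terms strictly below \<open>W\<close>. The two outer factors raise the bound by two, to
          that of \<open>T\<close>. In the mirror case neither position lies in
          \<open>W\<close>.\<close>
        have *: "psi_gen q * (psi_gen r * (psi_gen q * V W)) \<in> filtr (\<Sum>T)"
          unfolding U(2) W(2) using U(2) W q r qW by (intro psi_filtr IHpsi) auto
        have "psi_gen q * (psi_gen (Suc q) * (psi_gen q * V W)) - psi_gen (Suc q) * (psi_gen q * (psi_gen (Suc q) * V W))
            \<in> filtr (\<Sum>W)"
          by (rule braid_filtr[OF i]) (use q r 1 U W in \<open>auto intro: IHy\<close>)
        then have "psi_gen r * (psi_gen q * (psi_gen r * V W)) \<in> filtr (\<Sum>T)"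
          using filtr_diff[OF * filtr_mono[of _ "\<Sum>W" "\<Sum>T"]] U W 1 by fastforce
        moreover have "psi_gen r * (psi_gen q * V U) \<approx> psi_gen r * (psi_gen q * (psi_gen r * V W))"
          unfolding W_def by (intro cong_mult V_dn gen_C) (use U r q rU in auto)
        ultimately show ?thesis using VT filtr_cong by blast
      next
        case 2
        define W where "W = dn r U"
        have rU: "r \<notin> U" "Suc r \<in> U" using q r same 2 by (auto simp: U_def dn_def)
        have W: "W \<in> words" "\<Sum>U = Suc (\<Sum>W)"
          using dn_words[OF U(1)] sum_dn[OF U(1)] rU r by (auto simp: W_def)
        have qW: "q \<notin> W" using q 2 by (auto simp: U_def W_def dn_def)
        obtain i where i: "weight i (V W)" using weight_V[OF W(1)] by blast
        have *: "psi_gen q * (psi_gen r * (psi_gen q * V W)) \<in> filtr (\<Sum>T)"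
          unfolding U(2) W(2) using U(2) W q r qW by (intro psi_filtr IHpsi) auto
        have "psi_gen r * (psi_gen (Suc r) * (psi_gen r * V W)) - psi_gen (Suc r) * (psi_gen r * (psi_gen (Suc r) * V W))
            \<in> filtr (\<Sum>W)"
          by (rule braid_filtr[OF i]) (use q r 2 U W in \<open>auto intro: IHy\<close>)
        then have "psi_gen r * (psi_gen q * (psi_gen r * V W)) \<in> filtr (\<Sum>T)"
          using filtr_add[OF filtr_mono[of _ "\<Sum>W" "\<Sum>T"] *] U W 2 by fastforce
        moreover have "psi_gen r * (psi_gen q * V U) \<approx> psi_gen r * (psi_gen q * (psi_gen r * V W))"
          unfolding W_def by (intro cong_mult V_dn gen_C) (use U r q rU in auto)
        ultimately show ?thesis using VT filtr_cong by blast
      next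
        case 3
        have ne: "r \<noteq> q" using q same r by auto
        have "\<not> (r \<in> U \<and> Suc r \<notin> U)" using r 3 ne by (auto simp: U_def dn_def)
        then have "psi_gen q * (psi_gen r * V U) \<in> filtr (\<Sum>T)"
          unfolding U(2) using U r q by (intro psi_filtr IHpsi) auto
        moreover have "psi_gen r * (psi_gen q * V U) \<approx> psi_gen q * (psi_gen r * V U)"
          using 3 r q V_C[OF U(1)] by (intro psi_psi_cong) auto
        ultimately show ?thesis using VT filtr_cong by blast
      qed
    qed
    show ?thesis using A B by blast
  qed
qed

lemma psi_filtr:
  assumes "p \<in> filtr k" and r: "1 \<le> r" "r < n"
  shows "psi_gen r * p \<in> filtr (Suc k)"
  using assms
proof (rule psi_filtr_step)
  fix U assume "U \<in> words" "\<not> (r \<in> U \<and> Suc r \<notin> U)"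
  then show "psi_gen r * V U \<in> filtr (\<Sum>U)" using gen_V_filtr[of U] r by blast
qed

lemma y_filtr:
  assumes "p \<in> filtr k" and s: "1 \<le> s" "s \<le> n"
  shows "y_gen s * p \<in> filtr k"
  using assms
proof (rule y_filtr_step)
  fix U assume "U \<in> words"
  then show "y_gen s * V U \<in> filtr (\<Sum>U)" using gen_V_filtr[of U] s by blast
qed

lemma e_filtr: "p \<in> filtr k \<Longrightarrow> j \<in> residue_seqs n \<Longrightarrow> e_gen j * p \<in> filtr k"
proof (rule filtr_map)
  fix U assume j: "j \<in> residue_seqs n" and U: "U \<in> words" "\<Sum>U < k"
  obtain i where i: "weight i (V U)" using weight_V[OF U(1)] by blast
  have "e_gen j * (e_gen i * V U) \<approx> of_bool (j = i) * (e_gen j * V U)"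
    using relator_cong[OF klr_relators.e_e[OF j, of i], of "V U"] i by (simp add: weight_def mult.assoc)
  moreover have "e_gen i * V U \<in> filtr k"
    using i filtr_V[OF U] by (auto simp: weight_def intro: filtr_cong)
  then have "of_bool (j = i) * (e_gen j * V U) \<in> filtr k"
    by (cases "j = i") (auto simp: filtr_J J_zero)
  ultimately have "e_gen j * (e_gen i * V U) \<in> filtr k"
    using filtr_cong by blast
  moreover have "e_gen j * V U \<approx> e_gen j * (e_gen i * V U)"
    using i j by (intro cong_mult cong_sym[of "e_gen i * V U"]) (auto simp: weight_def gen_C)
  ultimately show "e_gen j * V U \<in> filtr k" using filtr_cong by blast
qed (auto intro: gen_C)

lemma carrier_filtr:
  assumes "p \<in> C"
  shows "\<exists>k. p \<in> filtr k"
proof -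
  define S where "S = {u. \<exists>k. u \<in> filtr k}"
  have "p * 1 \<in> S"
    using assms
  proof (rule free_algebra_left_induct)
    have "V {1..c} \<in> filtr (Suc (\<Sum>{1..c}))" by (intro filtr_V initial_words) simp
    then have "1 \<in> filtr (Suc (\<Sum>{1..c}))" by (rule filtr_cong[OF cong_sym[OF V_initial]])
    then show "1 \<in> S" unfolding S_def by (intro CollectI exI)
  next
    fix u v assume "u \<in> S" "v \<in> S"
    then obtain k l where u: "u \<in> filtr k" and v: "v \<in> filtr l" unfolding S_def mem_Collect_eq by (elim exE)
    have "u + v \<in> filtr (max k l)"
      by (rule filtr_add; rule filtr_mono, rule u v, simp)
    then show "u + v \<in> S" unfolding S_def by (intro CollectI exI)
  next
    fix d u assume "u \<in> S"
    then obtain k where "u \<in> filtr k" unfolding S_def mem_Collect_eq by (elim exE)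
    then have "const d * u \<in> filtr k" by (rule filtr_const)
    then show "const d * u \<in> S" unfolding S_def by (intro CollectI exI)
  next
    fix x u assume x: "x \<in> klr_gens n" and "u \<in> S"
    then obtain k where k: "u \<in> filtr k" unfolding S_def mem_Collect_eq by (elim exE)
    from x consider r where "x = Y r" "1 \<le> r" "r \<le> n" | r where "x = Psi r" "1 \<le> r" "r < n"
      | i where "x = E i" "i \<in> residue_seqs n"
      by (auto simp: klr_gens_def)
    then have "gen x * u \<in> filtr (Suc k)"
      using y_filtr[OF k] psi_filtr[OF k] e_filtr[OF k] filtr_mono[of _ k "Suc k"] by cases simp_all
    then show "gen x * u \<in> S" unfolding S_def by (intro CollectI exI)
  qed
  then show ?thesis by (simp add: S_def)
qed

lemma filtr_sum:
  assumes "p \<in> filtr k"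
  shows "\<exists>f. p \<approx> (\<Sum>T\<in>words. const (f T) * V T)"
  using assms
proof (induction rule: filtr.induct)
  case (filtr_J p)
  then have "p \<approx> (\<Sum>T\<in>words. const ((\<lambda>_. 0) T) * V T)" by (simp add: cong_def const_zero)
  then show ?case by (rule exI[where x = "\<lambda>_. 0"])
next
  case (filtr_V T)
  have fin: "finite words" unfolding words_def by (rule finite_subset[of _ "Pow {1..n}"]) auto
  have "(\<Sum>U\<in>words. const (of_bool (U = T)) * V U) = (\<Sum>U\<in>words. if U = T then V U else 0)"
    by (rule sum.cong) (auto simp: const_zero const_one)
  also have "\<dots> = V T" using fin filtr_V by simp
  finally have "V T \<approx> (\<Sum>U\<in>words. const ((\<lambda>U. of_bool (U = T)) U) * V U)" by (simp add: cong_refl)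
  then show ?case by (rule exI[where x = "\<lambda>U. of_bool (U = T)"])
next
  case (filtr_add p q)
  then obtain f g where "p \<approx> (\<Sum>T\<in>words. const (f T) * V T)" "q \<approx> (\<Sum>T\<in>words. const (g T) * V T)" by blast
  then have "p + q \<approx> (\<Sum>T\<in>words. const (f T) * V T) + (\<Sum>T\<in>words. const (g T) * V T)" by (rule cong_add)
  also have "(\<Sum>T\<in>words. const (f T) * V T) + (\<Sum>T\<in>words. const (g T) * V T) = (\<Sum>T\<in>words. const ((\<lambda>T. f T + g T) T) * V T)"
    by (simp add: const_def single_add distrib_right sum.distrib)
  finally show ?case by (rule exI[where x = "\<lambda>T. f T + g T"])
next
  case (filtr_const p d)
  then obtain f where "p \<approx> (\<Sum>T\<in>words. const (f T) * V T)" by blast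
  then have "const d * p \<approx> const d * (\<Sum>T\<in>words. const (f T) * V T)"
    by (rule cong_mult) (rule free_algebra_closed)
  also have "const d * (\<Sum>T\<in>words. const (f T) * V T) = (\<Sum>T\<in>words. const ((\<lambda>T. d * f T) T) * V T)"
    by (simp add: sum_distrib_left mult.assoc[symmetric]) (simp add: const_def mult_single)
  finally show ?case by (rule exI[where x = "\<lambda>T. d * f T"])
qed

section \<open>The Garnir relation and the words containing 1\<close>

lemma V_initial_shift:
  assumes "j \<le> Suc c" "1 \<le> j" "c < n"
  shows "{1..Suc c} - {j} \<in> words \<and> V ({1..Suc c} - {j}) \<approx> prod_list (map psi_gen [j..<Suc c])"
  using assms
proof (induction rule: inc_induct)
  case base
  have "{1..Suc c} - {Suc c} = {1..c}" by auto
  then show ?case using initial_words V_initial by simp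
next
  case (step j)
  let ?T = "{1..Suc c} - {Suc j}"
  have T: "?T \<in> words" "V ?T \<approx> prod_list (map psi_gen [Suc j..<Suc c])" using step by auto
  have up: "up j ?T = {1..Suc c} - {j}" using step by (auto simp: up_def)
  have "V (up j ?T) \<approx> psi_gen j * V ?T" using T(1) step by (intro V_up) auto
  also have "\<dots> \<approx> psi_gen j * prod_list (map psi_gen [Suc j..<Suc c])"
    using T(2) step by (intro cong_mult gen_C) auto
  also have "\<dots> = prod_list (map psi_gen [j..<Suc c])"
    using step by (simp add: upt_conv_Cons del: upt_Suc)
  finally have "V ({1..Suc c} - {j}) \<approx> prod_list (map psi_gen [j..<Suc c])" unfolding up .
  moreover have "up j ?T \<in> words" using T(1) step by (intro up_words) auto
  ultimately show ?case unfolding up by blast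
qed

text \<open>Descents at r \<ge> 2 keep 1 outside the word and lower it until it is {2..c+1}, whose
  vector is the Garnir product \<psi>_1 ... \<psi>_c modulo \<open>J\<close>.\<close>

lemma V_nonstandard: "T \<in> words \<Longrightarrow> 0 < c \<Longrightarrow> 1 \<notin> T \<Longrightarrow> V T \<in> J"
proof (induction "\<Sum>T" arbitrary: T rule: less_induct)
  case less
  show ?case
  proof (cases "\<exists>r\<ge>2. r < n \<and> r \<notin> T \<and> Suc r \<in> T")
    case True
    then obtain r where r: "r \<ge> 2" "r < n" "r \<notin> T" "Suc r \<in> T" by blast
    then have "V (dn r T) \<in> J"
      using less.hyps[of "dn r T"] sum_dn[of T r] dn_words[of T r] less.prems by (auto simp: dn_def)
    then have "psi_gen r * V (dn r T) \<in> J" using r by (intro J_mult gen_C) auto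
    moreover have "V T \<approx> psi_gen r * V (dn r T)" using less.prems r by (intro V_dn) auto
    ultimately show ?thesis using cong_J by blast
  next
    case no: False
    then have d: "r \<in> T" if "r \<ge> 2" "r < n" "Suc r \<in> T" for r
      using that by blast
    have sub: "insert 1 T \<subseteq> {1..n}" using less.prems c_le by (auto simp: words_def)
    have "insert 1 T = {1..card (insert 1 T)}"
    proof (rule downset_eq[OF sub])
      fix r assume "1 \<le> r" "r < n" "Suc r \<in> insert 1 T"
      then show "r \<in> insert 1 T" using d[of r] by (cases "r = 1") auto
    qed
    then have "insert 1 T = {1..Suc c}"
      using less.prems finite_words[of T] by (simp add: words_def)
    moreover have "T = insert 1 T - {1}" using less.prems by auto
    ultimately have T: "T = {1..Suc c} - {1}" "c < n" using sub by auto
    show ?thesis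
      using V_initial_shift[of 1] garnir_J T cong_J by auto
  qed
qed

lemma spanning:
  assumes "p \<in> C" "0 < c"
  shows "\<exists>f. p \<approx> (\<Sum>T | T \<in> words \<and> 1 \<in> T. const (f T) * V T)"
proof -
  have fin: "finite words" unfolding words_def by (rule finite_subset[of _ "Pow {1..n}"]) auto
  obtain f where f: "p \<approx> (\<Sum>T\<in>words. const (f T) * V T)"
    using carrier_filtr[OF assms(1)] filtr_sum by blast
  have sum_J: "(\<Sum>T\<in>A. const (f T) * V T) \<in> J" if "A \<subseteq> words \<inter> {T. 1 \<notin> T}" for A
    using that
  proof (induction A rule: infinite_finite_induct)
    case (insert T A)
    then show ?case
      by (auto intro!: J_add J_mult V_nonstandard free_algebra_closed assms(2))
  qed (simp_all add: J_zero)
  have "(\<Sum>T\<in>words. const (f T) * V T) = (\<Sum>T\<in>{T\<in>words. 1 \<in> T} \<union> {T\<in>words. 1 \<notin> T}. const (f T) * V T)"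
    by (rule sum.cong) auto
  also have "\<dots> = (\<Sum>T | T \<in> words \<and> 1 \<in> T. const (f T) * V T) + (\<Sum>T | T \<in> words \<and> 1 \<notin> T. const (f T) * V T)"
    using fin by (intro sum.union_disjoint) auto
  also have "\<dots> \<approx> (\<Sum>T | T \<in> words \<and> 1 \<in> T. const (f T) * V T)"
    using sum_J[of "{T\<in>words. 1 \<notin> T}"] by (auto simp: cong_def)
  finally show ?thesis using f cong_trans by blast
qed

end

section \<open>Singular vectors in the tensor-space representation\<close>

definition leg_count :: "bool \<times> bool \<Rightarrow> nat"
  where "leg_count x = of_bool (fst x) + of_bool (snd x)"

definition pair_pos :: "nat \<Rightarrow> bool \<times> bool \<Rightarrow> nat"
  where "pair_pos k x = of_bool (fst x) * Suc (Suc (2 * k)) + of_bool (snd x) * Suc (Suc (Suc (2 * k)))"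

text \<open>\<open>b\<close> counts the legs besides position 1. Pairs from \<open>m\<close> on are
  padded with arms, and the second letter of pair m - 1 is the fictitious position n + 1.\<close>

definition admissible :: "nat \<Rightarrow> nat \<Rightarrow> pairs \<Rightarrow> bool"
  where "admissible m b W \<longleftrightarrow> (\<forall>k\<ge>m. W k = (False, False)) \<and> \<not> snd (W (m - 1)) \<and> (\<Sum>k<m. leg_count (W k)) = b"

definition init_pairs :: "nat \<Rightarrow> pairs"
  where "init_pairs p k = (k \<le> p, k < p)"

definition init_vec :: "nat \<Rightarrow> pairs \<Rightarrow> 'f::field"
  where "init_vec p W = of_bool (W = init_pairs p)"

lemma sum_upd:
  fixes f :: "nat \<Rightarrow> bool \<times> bool \<Rightarrow> nat"
  assumes "k < m"
  shows "(\<Sum>j<m. f j ((W(k := x)) j)) + f k (W k) = (\<Sum>j<m. f j (W j)) + f k x"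
proof -
  have "(\<Sum>j<m. f j ((W(k := x)) j)) = f k x + (\<Sum>j\<in>{..<m}-{k}. f j ((W(k := x)) j))"
    using assms by (subst sum.remove[of _ k]) auto
  moreover have "(\<Sum>j\<in>{..<m}-{k}. f j ((W(k := x)) j)) = (\<Sum>j\<in>{..<m}-{k}. f j (W j))"
    by (rule sum.cong) auto
  moreover have "(\<Sum>j<m. f j (W j)) = f k (W k) + (\<Sum>j\<in>{..<m}-{k}. f j (W j))"
    using assms by (subst sum.remove[of _ k]) auto
  ultimately show ?thesis by simp
qed

lemma sum_upd2:
  fixes f :: "nat \<Rightarrow> bool \<times> bool \<Rightarrow> nat"
  assumes "Suc k < m"
  shows "(\<Sum>j<m. f j ((W(k := x, Suc k := y)) j)) + f k (W k) + f (Suc k) (W (Suc k)) = (\<Sum>j<m. f j (W j)) + f k x + f (Suc k) y"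
  using sum_upd[of k m f W x] sum_upd[of "Suc k" m f "W(k := x)" y] assms by simp

lemma parity_odd: "parity W k \<longleftrightarrow> odd (\<Sum>j<k. leg_count (W j))"
  by (induction k) (auto simp: leg_count_def)

lemma parity_init_pairs: "parity (init_pairs p) k \<longleftrightarrow> p < k"
  by (induction k) (auto simp: init_pairs_def)

lemma residue_eq: "residue (r, c) = of_bool (odd (r + c))"
proof -
  have "(int c - int r) mod 2 = of_bool (odd (r + c))"
    unfolding mod_2_eq_odd by (auto simp: of_bool_def)
  then show ?thesis by (simp add: residue_def)
qed

lemma hook_residue_odd:
  assumes "Suc (2 * k) \<le> a + (2 * p + 1)"
  shows "hook_residue_seq a (2 * p + 1) (Suc (2 * k)) = of_bool (p < k)"
proof (cases "p < k")
  case True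
  then obtain l where "k = Suc p + l" using less_iff_Suc_add by auto
  then show ?thesis using assms by (simp add: hook_residue_seq_def hook_node_def residue_eq)
next
  case False
  then show ?thesis using assms by (simp add: hook_residue_seq_def hook_node_def residue_eq)
qed

lemma hook_residue_even:
  assumes "Suc (Suc (2 * k)) \<le> a + (2 * p + 1)"
  shows "hook_residue_seq a (2 * p + 1) (Suc (Suc (2 * k))) = of_bool (\<not> p < k)"
proof (cases "p < k")
  case True
  then obtain l where "k = Suc p + l" using less_iff_Suc_add by auto
  then show ?thesis using assms by (simp add: hook_residue_seq_def hook_node_def residue_eq)
next
  case False
  then show ?thesis using assms by (simp add: hook_residue_seq_def hook_node_def residue_eq)
qed

lemma res_of_init_pairs: "restrict (res_of (init_pairs p)) {1..a + (2 * p + 1)} = hook_residue_seq a (2 * p + 1)"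
proof
  fix r
  show "restrict (res_of (init_pairs p)) {1..a + (2 * p + 1)} r = hook_residue_seq a (2 * p + 1) r"
  proof (cases "1 \<le> r \<and> r \<le> a + (2 * p + 1)")
    case False
    then show ?thesis by (auto simp: hook_residue_seq_def restrict_def)
  next
    case True
    then show ?thesis
      using hook_residue_odd[of _ a p] hook_residue_even[of _ a p]
      by (cases r rule: position_cases) (auto simp: parity_init_pairs)
  qed
qed

lemma E_init_vec: "E_op k (init_vec p) W = (0 :: 'f::field)"
proof -
  have "W(k := (False, True)) \<noteq> init_pairs p"
    by (auto simp: init_pairs_def fun_eq_iff intro!: exI[of _ k])
  then show ?thesis by (simp add: E_op_def init_vec_def)
qed

lemma F_init_vec: "k \<noteq> p \<Longrightarrow> F_op k (init_vec p) W = (0 :: 'f::field)"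
proof -
  assume "k \<noteq> p"
  then have "W(k := (True, False)) \<noteq> init_pairs p"
    by (auto simp: init_pairs_def fun_eq_iff intro!: exI[of _ k])
  then show ?thesis by (simp add: F_op_def init_vec_def)
qed

text \<open>The pair (True, False) separates the leg pairs from the arm pairs, so the form never
  meets neighbouring pairs of opposite equal letters, and no pair (False, True) occurs.\<close>

lemma G_init_vec: "G_op k (init_vec p) W = (0 :: 'f::field)"
proof -
  have "U \<noteq> init_pairs p" if "U k = (False, True) \<or> U (Suc k) = (False, True) \<or> U k = (True, True) \<and> U (Suc k) = (False, False)
     \<or> U k = (False, False) \<and> U (Suc k) = (True, True)" for U
    using that by (auto simp: init_pairs_def)
  then show ?thesis by (simp add: G_op_def init_vec_def)
qed

lemma specht_relators_init_vec:
  assumes "p \<in> specht_relators a (2 * k + 1)"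
  shows "free_act (klr_op (a + (2 * k + 1))) p (init_vec k) W = (0 :: 'f::field)"
  using assms unfolding specht_relators_def
proof (elim UnE)
  assume "p \<in> y_gen ` {1..a + (2 * k + 1)}"
  then obtain r where r: "p = y_gen r" "1 \<le> r" by auto
  show ?thesis using r(2) by (cases r rule: positive_cases) (auto simp: r(1) E_init_vec)
next
  assume "p \<in> (\<lambda>i. e_gen i - of_bool (i = hook_residue_seq a (2 * k + 1))) ` residue_seqs (a + (2 * k + 1))"
  then obtain i where "p = e_gen i - of_bool (i = hook_residue_seq a (2 * k + 1))" by auto
  then show ?thesis
    using res_of_init_pairs[of k a] by (cases "i = hook_residue_seq a (2 * k + 1)") (auto simp: e_op_def init_vec_def)
next
  assume "p \<in> psi_gen ` ({1..<a + (2 * k + 1)} - {2 * k + 1 + 1})"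
  then obtain r where r: "p = psi_gen r" "r \<in> {1..<a + (2 * k + 1)} - {2 * k + 1 + 1}" by (rule imageE)
  then have "1 \<le> r" by simp
  then show ?thesis by (cases r rule: positive_cases) (use r in \<open>auto simp: F_init_vec G_init_vec\<close>)
next
  assume "p \<in> (if a = 1 then {} else {prod_list (map psi_gen [1..<2 * k + 1 + 2])})"
  \<comment> \<open>The leftmost factor \<psi>_1 acts by zero, so the Garnir relation holds in the
    representation.\<close>
  then have "p = psi_gen 1 * prod_list (map psi_gen [2..<2 * k + 1 + 2])"
    by (auto simp: upt_conv_Cons numeral_2_eq_2 simp del: upt_Suc split: if_splits)
  then show ?thesis by (simp add: klr_act_mult del: upt_Suc)
qed

text \<open>
  For a vector in the support, moving a leg pair to the last position by exchanges contradicts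
  admissibility, so all leg pairs precede the pair with different letters.
\<close>

lemma singular_support:
  fixes g :: "pairs \<Rightarrow> 'f::field"
  assumes a: "a = 2 * q + 1" and b: "b = 2 * p + 1" and n: "n = a + b" and m: "m = p + q + 1"
    and admissible: "\<And>W. g W \<noteq> 0 \<Longrightarrow> admissible m b W"
    and y: "y_op (b + 1) g = (\<lambda>W. 0)"
    and e: "e_op n (hook_residue_seq a b) g = g"
    and psi: "\<And>r. 1 \<le> r \<Longrightarrow> r < n \<Longrightarrow> r \<noteq> b + 1 \<Longrightarrow> psi_op r g = (\<lambda>W. 0)"
    and W: "g W \<noteq> 0"
  shows "W = init_pairs p"
proof -
  have D: "fst (W k) = snd (W k) \<longleftrightarrow> k \<noteq> p" if W: "g W \<noteq> 0" and k: "k < m" for W k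
  proof -
    have res: "restrict (res_of W) {1..n} = hook_residue_seq a b"
      using W e by (metis e_op_def)
    \<comment> \<open>For j < m the parity is the residue at 2 j + 1. The position 2 m + 1 exceeds
      n, so at j = m the total number b of legs, which is odd, is used instead.\<close>
    have t: "parity W j \<longleftrightarrow> p < j" if j: "j \<le> m" for j
    proof (cases "j = m")
      case True
      then show ?thesis using admissible[OF W] by (simp add: parity_odd admissible_def b m)
    next
      case False
      have "(of_bool (parity W j) :: nat) = restrict (res_of W) {1..n} (Suc (2 * j))"
        using False j by (simp add: n m a b)
      also have "\<dots> = of_bool (p < j)"
        unfolding res b using False j by (subst hook_residue_odd) (auto simp: m a)
      finally show ?thesis by (simp only: of_bool_eq_iff)
    qed
    show ?thesis using t[of k] t[of "Suc k"] k by auto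
  qed
  have Wp: "W p = (True, False)" if W: "g W \<noteq> 0" for W
  proof (rule ccontr)
    assume "W p \<noteq> (True, False)"
    then have "W p = (False, True)" using D[OF W, of p] m by (cases "W p") auto
    then have "y_op (b + 1) g (W(p := (True, False))) = - g W"
      by (simp add: b E_op_def fun_upd_idem)
    then show False using y W by simp
  qed
  have tail: "W k \<noteq> (True, True)" if "g W \<noteq> 0" "p < k" "k < m" for W k
    using that
  proof (induction "m - k" arbitrary: k W)
    case (Suc l)
    show ?case
    proof
      assume Wk: "W k = (True, True)"
      show False
      proof (cases "Suc k = m")
        case True
        then show False using admissible[OF Suc.prems(1)] Wk by (auto simp: admissible_def)
      next
        case False
        then have k1: "Suc k < m" using Suc.prems by simp
        have l: "l = m - Suc k" using Suc.hyps(2) by simp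
        have "W (Suc k) \<noteq> (True, True)" using Suc.hyps(1)[OF l, of W] Suc.prems k1 by auto
        then have W1: "W (Suc k) = (False, False)"
          using D[OF Suc.prems(1) k1] Suc.prems by (cases "W (Suc k)") auto
        let ?U = "W(k := (False, False), Suc k := (True, True))"
        \<comment> \<open>At a word with (True, False) in both pairs, the operator returns the
          difference of the coefficients with the leg pair first and with the arm pair first. The
          index is odd, hence not b + 1.\<close>
        have "psi_op (Suc (Suc (Suc (2 * k)))) g (W(k := (True, False), Suc k := (True, False))) = 0"
          using psi[of "Suc (Suc (Suc (2 * k)))"] k1
          by (simp add: n m a b Suc_double_not_eq_double)
        then have "g W = g ?U"
          using Wk W1 by (simp add: G_op_def fun_upd_twist[of _ "Suc k"] fun_upd_idem)
        then have "g ?U \<noteq> 0" using Suc.prems by simp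
        then show False using Suc.hyps(1)[OF l, of ?U] Suc.prems k1 by auto
      qed
    qed
  qed simp
  have AA: "W k = (False, False)" if k: "p < k" for k
  proof (cases "k < m")
    case True
    then show ?thesis using D[OF W True] tail[OF W k True] k by (cases "W k") auto
  next
    case False
    then show ?thesis using admissible[OF W] by (auto simp: admissible_def)
  qed
  have "(\<Sum>k<m. leg_count (W k)) = (\<Sum>k<Suc p. leg_count (W k))"
    by (rule sum.mono_neutral_right) (auto simp: m AA leg_count_def)
  \<comment> \<open>Of the 2 p + 1 legs one sits in pair p, so the p pairs before it are
    full.\<close>
  then have "(\<Sum>k<p. leg_count (W k)) = (\<Sum>k<p. 2)"
    using admissible[OF W] Wp[OF W] by (simp add: admissible_def b leg_count_def)
  then have "leg_count (W k) = 2" if "k < p" for k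
    by (rule sum_mono_inv) (use that in \<open>auto simp: leg_count_def\<close>)
  then have LL: "W k = (True, True)" if "k < p" for k
    using that by (cases "W k") (force simp: leg_count_def of_bool_def split: if_splits)
  show ?thesis
  proof
    fix k
    show "W k = init_pairs p k"
      using AA[of k] LL[of k] Wp[OF W] by (cases k p rule: linorder_cases) (auto simp: init_pairs_def)
  qed
qed

section \<open>Leading terms\<close>

definition to_pairs :: "nat set \<Rightarrow> pairs"
  where "to_pairs T k = (Suc (Suc (2 * k)) \<in> T, Suc (Suc (Suc (2 * k))) \<in> T)"

definition pos_sum :: "nat \<Rightarrow> pairs \<Rightarrow> nat"
  where "pos_sum m W = (\<Sum>k<m. pair_pos k (W k))"

lemma to_pairs_up_even:
  assumes "r = Suc (Suc (2 * k))" "r \<in> T" "Suc r \<notin> T"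
  shows "to_pairs (insert (Suc r) (T - {r})) = (to_pairs T)(k := (False, True))"
  using assms by (auto simp: to_pairs_def fun_eq_iff)

lemma to_pairs_up_odd:
  assumes "r = Suc (Suc (Suc (2 * k)))" "r \<in> T" "Suc r \<notin> T"
  shows "to_pairs (insert (Suc r) (T - {r}))
    = (to_pairs T)(k := (fst (to_pairs T k), False), Suc k := (True, snd (to_pairs T (Suc k))))"
  using assms by (auto simp: to_pairs_def fun_eq_iff)

lemma G_op_nz_cases:
  assumes nz: "G_op k g W \<noteq> (0 :: 'f::field)"
  obtains (1) x where "W k = (True, False)" "W (Suc k) = (x, x)" "g (W(k := (x, x), Suc k := (False, True))) \<noteq> 0"
  | (2) x where "W k = (x, x)" "W (Suc k) = (True, False)" "g (W(k := (False, True), Suc k := (x, x))) \<noteq> 0"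
  | (3) x where "W k = (True, False)" "W (Suc k) = (True, False)" "g (W(k := (x, x), Suc k := (\<not> x, \<not> x))) \<noteq> 0"
  | (4) x where "W k = (x, x)" "W (Suc k) = (\<not> x, \<not> x)" "g (W(k := (False, True), Suc k := (False, True))) \<noteq> 0"
proof (rule ccontr)
  assume n: "\<not> thesis"
  have z1: "g (W(k := (x, x), Suc k := (False, True))) = 0" if "W k = (True, False)" "W (Suc k) = (x, x)" for x
    using n 1[OF that] by blast
  have z2: "g (W(k := (False, True), Suc k := (x, x))) = 0" if "W k = (x, x)" "W (Suc k) = (True, False)" for x
    using n 2[OF that] by blast
  have z3: "g (W(k := (x, x), Suc k := (\<not> x, \<not> x))) = 0" if "W k = (True, False)" "W (Suc k) = (True, False)" for x
    using n 3[OF that] by blast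
  have z4: "g (W(k := (False, True), Suc k := (False, True))) = 0" if "W k = (x, x)" "W (Suc k) = (\<not> x, \<not> x)" for x
    using n 4[OF that] by blast
  have "G_op k g W = 0"
  proof -
    obtain x x' y y' where xy: "W k = (x, x')" "W (Suc k) = (y, y')" by fastforce
    show ?thesis
      by (cases x; cases x'; cases y; cases y')
        (simp_all add: G_op_def xy z1[of True] z1[of False] z2[of True] z2[of False]
          z3[of True, simplified] z3[of False, simplified] z4[of True] z4[of False])
  qed
  then show False using nz by simp
qed

lemma admissible_upd2:
  assumes "admissible m b U" "U = W(k := x, Suc k := y)" "Suc k < m" "leg_count x + leg_count y = leg_count (W k) + leg_count (W (Suc k))"
    "snd (W (Suc k)) \<Longrightarrow> snd y"
  shows "admissible m b W"
proof -
  have "(\<Sum>j<m. leg_count (U j)) = (\<Sum>j<m. leg_count (W j))"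
    using sum_upd2[OF assms(3), of "\<lambda>_. leg_count" W x y] assms(2,4) by simp
  moreover have "\<not> snd (W (m - 1))"
    using assms by (cases "m - 1 = Suc k"; cases "m - 1 = k") (auto simp: admissible_def)
  ultimately show ?thesis using assms(1-3) by (auto simp: admissible_def)
qed

lemma pos_sum_upd2:
  assumes "Suc k < m"
  shows "pos_sum m (W(k := x, Suc k := y)) + pair_pos k (W k) + pair_pos (Suc k) (W (Suc k)) = pos_sum m W + pair_pos k x + pair_pos (Suc k) y"
  unfolding pos_sum_def by (rule sum_upd2[OF assms])

text \<open>Unitriangularity for the position sum; admissibility of the whole support is carried
  along because the singular vector argument requires it.\<close>

definition leading :: "nat \<Rightarrow> nat \<Rightarrow> pairs \<Rightarrow> (pairs \<Rightarrow> 'f::field) \<Rightarrow> bool"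
  where "leading m b U g \<longleftrightarrow> g U = 1 \<and> (\<forall>W. g W \<noteq> 0 \<longrightarrow> admissible m b W \<and> (W = U \<or> pos_sum m W < pos_sum m U))"

lemma leading_F:
  assumes t: "leading m b U g" and k: "Suc k < m" and U: "U k = (True, False)"
  shows "leading m b (U(k := (False, True))) (F_op k g)"
proof -
  have N: "pos_sum m (V(k := (False, True))) = Suc (pos_sum m V)" if "V k = (True, False)" for V
    using pos_sum_upd2[OF k, of V "(False, True)" "V (Suc k)"] that by (simp add: pair_pos_def fun_upd_idem)
  have "F_op k g (U(k := (False, True))) = 1"
    using t U by (simp add: leading_def F_op_def fun_upd_idem)
  moreover have "admissible m b W \<and> (W = U(k := (False, True)) \<or> pos_sum m W < pos_sum m (U(k := (False, True))))"
    if "F_op k g W \<noteq> 0" for W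
  proof -
    let ?V = "W(k := (True, False))"
    have W: "W k = (False, True)" "g ?V \<noteq> 0" using that by (auto simp: F_op_def split: if_splits)
    have WV: "W = ?V(k := (False, True))" using W by (simp add: fun_upd_idem)
    have V: "admissible m b ?V" "?V = U \<or> pos_sum m ?V < pos_sum m U" using t W by (auto simp: leading_def)
    have "admissible m b W"
      by (rule admissible_upd2[OF V(1), of W k "(True, False)" "W (Suc k)"]) (use k W in \<open>auto simp: leg_count_def\<close>)
    moreover have "pos_sum m W = Suc (pos_sum m ?V)" using N[of ?V] WV by simp
    moreover have "?V = U \<Longrightarrow> W = U(k := (False, True))" using WV by metis
    ultimately show ?thesis using V(2) N[of U, OF U] by auto
  qed
  ultimately show ?thesis by (auto simp: leading_def)
qed

text \<open>On basis vectors \<open>G_op\<close> either moves the leg at position 2 k + 3 to 2 k + 4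
  with coefficient 1, raising the position sum by one, or lowers the sum by three. The four choices
  of \<open>x\<close> and \<open>y\<close> are the four moves of the first kind.\<close>

lemma leading_G:
  assumes t: "leading m b U g" and k: "Suc k < m" and U: "U k = (x, True)" "U (Suc k) = (False, y)"
  shows "leading m b (U(k := (x, False), Suc k := (True, y))) (G_op k g)"
proof -
  let ?U = "U(k := (x, False), Suc k := (True, y))"
  have NU: "pos_sum m ?U = Suc (pos_sum m U)"
    using pos_sum_upd2[OF k, of U "(x, False)" "(True, y)"] U by (simp add: pair_pos_def)
  \<comment> \<open>The new coefficient at (True, False), (True, False) is a difference; its second
    term belongs to a word with larger position sum than \<open>U\<close> and vanishes.\<close>
  have "g (U(k := (False, False), Suc k := (True, True))) = 0" if "x" "\<not> y"
  proof (rule ccontr)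
    let ?V = "U(k := (False, False), Suc k := (True, True))"
    assume "g ?V \<noteq> 0"
    then have "?V = U \<or> pos_sum m ?V < pos_sum m U" using t by (auto simp: leading_def)
    moreover have "pos_sum m ?V > pos_sum m U"
      using pos_sum_upd2[OF k, of U "(False, False)" "(True, True)"] U that by (simp add: pair_pos_def)
    ultimately show False by auto
  qed
  then have "G_op k g ?U = 1"
    using t U by (cases x; cases y) (auto simp: leading_def G_op_def fun_upd_twist[of _ "Suc k"] fun_upd_idem)
  moreover have "admissible m b W \<and> (W = ?U \<or> pos_sum m W < pos_sum m ?U)" if nz: "G_op k g W \<noteq> 0" for W
  proof -
    have *: ?thesis if V: "g (W(k := u, Suc k := v)) \<noteq> 0"
      and c: "leg_count u + leg_count v = leg_count (W k) + leg_count (W (Suc k))" "snd (W (Suc k)) \<Longrightarrow> snd v"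
      and N: "pair_pos k (W k) + pair_pos (Suc k) (W (Suc k)) \<le> Suc (pair_pos k u + pair_pos (Suc k) v)"
      and up: "u = (x, True) \<Longrightarrow> v = (False, y) \<Longrightarrow> W k = (x, False) \<and> W (Suc k) = (True, y) \<or>
          pair_pos k (W k) + pair_pos (Suc k) (W (Suc k)) \<le> pair_pos k u + pair_pos (Suc k) v" for u v
    proof -
      let ?V = "W(k := u, Suc k := v)"
      have VU: "admissible m b ?V" "?V = U \<or> pos_sum m ?V < pos_sum m U" using t V by (auto simp: leading_def)
      have admissible: "admissible m b W" by (rule admissible_upd2[OF VU(1) refl k c])
      have NV: "pos_sum m ?V + pair_pos k (W k) + pair_pos (Suc k) (W (Suc k)) = pos_sum m W + pair_pos k u + pair_pos (Suc k) v"
        by (rule pos_sum_upd2[OF k])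
      show ?thesis
      proof (cases "?V = U")
        case True
        then have "u = (x, True)" "v = (False, y)"
          using fun_cong[OF True, of k] fun_cong[OF True, of "Suc k"] U by auto
        from up[OF this] show ?thesis
        proof
          assume w: "W k = (x, False) \<and> W (Suc k) = (True, y)"
          have "W = ?V(k := W k, Suc k := W (Suc k))" by (auto simp: fun_eq_iff)
          then have "W = ?U" using w unfolding True by metis
          then show ?thesis using admissible by simp
        next
          assume "pair_pos k (W k) + pair_pos (Suc k) (W (Suc k)) \<le> pair_pos k u + pair_pos (Suc k) v"
          then have "pos_sum m W \<le> pos_sum m U" using NV unfolding True by linarith
          then show ?thesis using admissible NU by simp
        qed
      next
        case False
        then show ?thesis using VU N NV NU admissible by linarith
      qed
    qed
    from nz show ?thesis
    proof (cases rule: G_op_nz_cases)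
      case (1 z)
      then show ?thesis by (intro *[OF 1(3)]) (auto simp: leg_count_def pair_pos_def)
    next
      case (2 z)
      then show ?thesis by (intro *[OF 2(3)]) (auto simp: leg_count_def pair_pos_def)
    next
      case (3 z)
      then show ?thesis by (intro *[OF 3(3)]) (auto simp: leg_count_def pair_pos_def)
    next
      case (4 z)
      then show ?thesis by (intro *[OF 4(3)]) (auto simp: leg_count_def pair_pos_def)
    qed
  qed
  ultimately show ?thesis by (auto simp: leading_def)
qed

lemma leading_psi:
  assumes t: "leading m b (to_pairs T) g" and r: "2 \<le> r" "r < 2 * m" "r \<in> T" "Suc r \<notin> T"
  shows "leading m b (to_pairs (insert (Suc r) (T - {r}))) (psi_op r g)"
proof -
  from r(1) have "1 \<le> r" by simp
  then show ?thesis
  proof (cases r rule: positive_cases)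
    case 1
    then show ?thesis using r by simp
  next
    case (2 k)
    show ?thesis
      unfolding to_pairs_up_even[OF 2 r(3,4)] using leading_F[OF t, of k] r 2 by (auto simp: to_pairs_def)
  next
    case (3 k)
    show ?thesis
      unfolding to_pairs_up_odd[OF 3 r(3,4)] using leading_G[OF t, of k] r 3 by (auto simp: to_pairs_def)
  qed
qed

lemma to_pairs_initial: "to_pairs {1..2 * p + 2} = init_pairs p"
  by (auto simp: to_pairs_def init_pairs_def fun_eq_iff)

lemma leading_init_vec:
  assumes "p < m"
  shows "leading m (2 * p + 1) (to_pairs {1..2 * p + 2}) (init_vec p)"
proof -
  have "(\<Sum>k<m. leg_count (init_pairs p k)) = (\<Sum>k<Suc p. leg_count (init_pairs p k))"
    by (rule sum.mono_neutral_right) (use assms in \<open>auto simp: leg_count_def init_pairs_def\<close>)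
  also have "\<dots> = 2 * p + 1" by (simp add: leg_count_def init_pairs_def)
  finally have "admissible m (2 * p + 1) (init_pairs p)"
    using assms by (auto simp: admissible_def init_pairs_def)
  then show ?thesis unfolding to_pairs_initial by (auto simp: leading_def init_vec_def)
qed

lemma inj_on_to_pairs: "inj_on to_pairs {T. T \<subseteq> {1..n} \<and> 1 \<in> T}"
proof (rule inj_onI)
  fix T U assume T: "T \<in> {T. T \<subseteq> {1..n} \<and> 1 \<in> T}" and U: "U \<in> {T. T \<subseteq> {1..n} \<and> 1 \<in> T}" and eq: "to_pairs T = to_pairs U"
  have "r \<in> T \<longleftrightarrow> r \<in> U" for r
  proof (cases "1 \<le> r")
    case True
    then show ?thesis
      by (cases r rule: positive_cases)
        (use T U fun_cong[OF eq] in \<open>auto simp: to_pairs_def\<close>)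
  next
    case False
    then show ?thesis using T U by auto
  qed
  then show "T = U" by blast
qed

text \<open>Among the words with nonzero coefficient, evaluation at one with maximal position sum
  leaves a single term.\<close>

lemma leading_independent:
  assumes fin: "finite A" and inj: "inj_on to_pairs A" and t: "\<And>T. T \<in> A \<Longrightarrow> leading m b (to_pairs T) (v T)"
    and zero: "\<And>W. (\<Sum>T\<in>A. f T * v T W) = (0 :: 'f::field)" and T: "T \<in> A"
  shows "f T = 0"
proof (rule ccontr)
  assume "f T \<noteq> 0"
  let ?B = "{T \<in> A. f T \<noteq> 0}"
  have B: "finite ?B" "?B \<noteq> {}" using fin T \<open>f T \<noteq> 0\<close> by auto
  have "Max ((\<lambda>T. pos_sum m (to_pairs T)) ` ?B) \<in> (\<lambda>T. pos_sum m (to_pairs T)) ` ?B"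
    using B by (intro Max_in) auto
  then obtain U where U: "U \<in> ?B" "pos_sum m (to_pairs U) = Max ((\<lambda>T. pos_sum m (to_pairs T)) ` ?B)"
    by auto
  have le: "pos_sum m (to_pairs T) \<le> pos_sum m (to_pairs U)" if "T \<in> ?B" for T
    unfolding U(2) using B that by (intro Max_ge) auto
  have "f T * v T (to_pairs U) = (if T = U then f U else 0)" if "T \<in> A" for T
  proof (cases "T = U")
    case True
    then show ?thesis using t[of U] U by (simp add: leading_def)
  next
    case False
    then have "to_pairs T \<noteq> to_pairs U" using inj that U by (auto dest: inj_onD)
    then have "f T = 0 \<or> v T (to_pairs U) = 0"
      using t[OF that] le[of T] that by (fastforce simp: leading_def)
    then show ?thesis using False by auto
  qed
  then have "(\<Sum>T\<in>A. f T * v T (to_pairs U)) = f U"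
    using fin U by (simp add: sum.delta')
  then show False using zero[of "to_pairs U"] U by simp
qed

section \<open>The Specht module\<close>

locale odd_hook =
  fixes p q a b c n m :: nat and J :: "(klr_gen, 'f::field) free_alg set"
  assumes a: "a = 2 * q + 1" and b: "b = 2 * p + 1" and c: "c = b + 1" and n: "n = a + b" and m: "m = p + q + 1"
    and J_eq: "J = presented_cyclic.J (klr_gens n) (klr_relators n) (specht_relators a b)"
begin

sublocale P: presented_cyclic "klr_gens n" "klr_relators n" "specht_relators a b :: (klr_gen, 'f) free_alg set"
  by unfold_locales (rule klr_relators_closed, unfold n, rule specht_relators_closed, simp_all add: a b)

lemma specht_gens:
  "1 \<le> r \<Longrightarrow> r \<le> n \<Longrightarrow> y_gen r \<in> specht_relators a b"
  "1 \<le> r \<Longrightarrow> r < n \<Longrightarrow> r \<noteq> c \<Longrightarrow> psi_gen r \<in> specht_relators a b"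
  "e_gen (hook_residue_seq a b) - 1 \<in> specht_relators a b"
  "c < n \<Longrightarrow> prod_list (map psi_gen [1..<Suc c]) \<in> specht_relators a b"
proof -
  have "e_gen (hook_residue_seq a b) - of_bool (hook_residue_seq a b = hook_residue_seq a b) \<in> specht_relators a b"
    unfolding specht_relators_def using hook_residue_seq_mem[of a b, folded n] n by blast
  then show "e_gen (hook_residue_seq a b) - 1 \<in> specht_relators a b" by simp
qed (auto simp: specht_relators_def c n simp del: upt_Suc)

sublocale L: hecke_left_ideal n c "hook_residue_seq a b" J
proof
  show "J \<subseteq> carrier (free_algebra (klr_gens n))" unfolding J_eq by (rule P.J_carrier)
  show "u + v \<in> J" if "u \<in> J" "v \<in> J" for u v using that unfolding J_eq by (rule P.J_add)
  show "u * v \<in> J" if "u \<in> carrier (free_algebra (klr_gens n))" "v \<in> J" for u v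
    using that unfolding J_eq by (rule P.J_mult)
  show "u * v \<in> J" if "u \<in> klr_relators n" "v \<in> carrier (free_algebra (klr_gens n))" for u v
    using that unfolding J_eq by (rule P.relator_mult_J)
  show "y_gen r \<in> J" if "1 \<le> r" "r \<le> n" for r
    unfolding J_eq using specht_gens(1)[OF that] P.Q_subset_J by blast
  show "psi_gen r \<in> J" if "1 \<le> r" "r < n" "r \<noteq> c" for r
    unfolding J_eq using specht_gens(2)[OF that] P.Q_subset_J by blast
  show "e_gen (hook_residue_seq a b) - 1 \<in> J"
    unfolding J_eq using specht_gens(3) P.Q_subset_J by blast
  show "prod_list (map psi_gen [1..<Suc c]) \<in> J" if "c < n"
    unfolding J_eq using specht_gens(4)[OF that] P.Q_subset_J by blast
  show "hook_residue_seq a b \<in> residue_seqs n" unfolding n by (rule hook_residue_seq_mem)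
qed (simp add: c n a)

lemma J_act: "u \<in> J \<Longrightarrow> free_act (klr_op n) u (init_vec p) W = 0"
  unfolding J_eq
  by (rule P.J_free_act[OF linop_klr_op klr_relators_act_zero])
    (use specht_relators_init_vec[of _ a p, folded b, folded n] in auto)

lemma one_notin_J: "1 \<notin> J"
  using J_act[of 1 "init_pairs p"] by (auto simp: init_vec_def)

lemma leading_reduced_rep: "L.reduced_rep T u \<Longrightarrow> 1 \<in> T \<Longrightarrow> leading m b (to_pairs T) (free_act (klr_op n) u (init_vec p))"
proof (induction rule: L.reduced_rep.induct)
  case reduced_rep_initial
  then show ?case using leading_init_vec[of p m] by (simp add: c b m)
next
  case (reduced_rep_up T u r)
  \<comment> \<open>Raising at r = 1 would remove 1 from the word, so the zero operator \<psi>_1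
    never occurs in the product.\<close>
  then have "r \<noteq> 1" "1 \<in> T" by (auto simp: L.up_def)
  then show ?case
    using reduced_rep_up leading_psi[of m b T _ r] by (simp add: klr_act_mult L.up_def n a b m)
qed

lemma leading_V: "T \<in> L.words \<Longrightarrow> 1 \<in> T \<Longrightarrow> leading m b (to_pairs T) (free_act (klr_op n) (L.V T) (init_vec p))"
  by (rule leading_reduced_rep[OF L.reduced_rep_V])

lemma singular_scalar:
  assumes v: "v \<in> carrier (free_algebra (klr_gens n))"
    and Qv: "\<And>u. u \<in> specht_relators a b \<Longrightarrow> u * v \<in> J"
  shows "\<exists>d. v - const d \<in> J"
proof -
  let ?act = "\<lambda>u. free_act (klr_op n) u (init_vec p) :: pairs \<Rightarrow> 'f"
  let ?A = "{T. T \<in> L.words \<and> 1 \<in> T}"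
  have fin: "finite ?A"
    by (rule finite_subset[of _ "Pow {1..n}"]) (auto simp: L.words_def)
  obtain f where f: "v - (\<Sum>T\<in>?A. const (f T) * L.V T) \<in> J"
    using L.spanning[OF v] by (auto simp: L.cong_def c)
  have act_v: "?act v W = (\<Sum>T\<in>?A. f T * ?act (L.V T) W)" for W
    using J_act[OF f, of W] by (simp add: klr_act_mult)
  have Qg: "free_act (klr_op n) u (?act v) = (\<lambda>W. 0)" if "u \<in> specht_relators a b" for u
    using J_act[OF Qv[OF that]] by (simp add: klr_act_mult fun_eq_iff)
  have supp: "W = init_pairs p" if "?act v W \<noteq> 0" for W
  proof (rule singular_support[OF a b n m])
    show "admissible m b U" if U: "?act v U \<noteq> 0" for U
    proof -
      obtain T where "T \<in> ?A" "f T * ?act (L.V T) U \<noteq> 0"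
        using U unfolding act_v by (rule sum.not_neutral_contains_not_neutral)
      then show ?thesis using leading_V by (auto simp: leading_def)
    qed
    show "y_op (b + 1) (?act v) = (\<lambda>W. 0)"
      using Qg[OF specht_gens(1)[of c]] by (simp add: c n a)
    show "e_op n (hook_residue_seq a b) (?act v) = ?act v"
      using fun_cong[OF Qg[OF specht_gens(3)]] by (simp add: fun_eq_iff)
    show "psi_op r (?act v) = (\<lambda>W. 0)" if "1 \<le> r" "r < n" "r \<noteq> b + 1" for r
      using Qg[OF specht_gens(2)] that by (simp add: c)
  qed (use that in auto)
  define d where "d = ?act v (init_pairs p)"
  let ?f = "\<lambda>T. f T - of_bool (T = {1..c}) * d"
  have init: "{1..c} \<in> ?A" using L.initial_words by (auto simp: c)
  have split: "(\<Sum>T\<in>?A. const (?f T) * L.V T) = (\<Sum>T\<in>?A. const (f T) * L.V T) - const d * L.V {1..c}"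
  proof -
    have "const (?f T) * L.V T = const (f T) * L.V T - (if T = {1..c} then const d * L.V T else 0)" for T
      by (simp add: const_def single_diff left_diff_distrib)
    then show ?thesis using fin init by (simp add: sum_subtractf sum.delta)
  qed
  \<comment> \<open>Lowering the coefficient of the initial word by \<open>d\<close> subtracts d
    times the generator. The remaining combination acts by zero, so independence forces all its
    coefficients to vanish.\<close>
  have dJ: "v - const d - (\<Sum>T\<in>?A. const (?f T) * L.V T) \<in> J"
  proof -
    have "const d * L.V {1..c} - const d * 1 \<in> J"
      using L.cong_mult[OF L.V_initial free_algebra_closed(7), of d] by (simp add: L.cong_def)
    from L.J_add[OF f this] show ?thesis unfolding split by (simp add: algebra_simps)
  qed
  have zero: "(\<Sum>T\<in>?A. ?f T * ?act (L.V T) W) = 0" for W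
  proof -
    have "?act v W = d * init_vec p W" using supp[of W] by (auto simp: d_def init_vec_def)
    then show ?thesis
      using J_act[OF dJ, of W] by (simp add: klr_act_mult)
  qed
  have inj: "inj_on to_pairs ?A"
    by (rule inj_on_subset[OF inj_on_to_pairs[of n]]) (auto simp: L.words_def)
  have "?f T = 0" if "T \<in> ?A" for T
    by (rule leading_independent[OF fin inj _ zero that]) (use leading_V in auto)
  then have "(\<Sum>T\<in>?A. const (?f T) * L.V T) = (\<Sum>T\<in>?A. 0)"
    by (intro sum.cong) (simp_all only: const_zero mult_zero_left)
  then have "v - const d - 0 \<in> J" using dJ by (simp only: sum.neutral_const)
  then show ?thesis by auto
qed

end

theorem theorem4p3:
  fixes a b n :: nat
    and H :: "'f::field hecke ring"
    and S :: "('f hecke, 'f hecke set) module"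
  assumes "odd a" and "odd b" and "n = a + b"
    and "H = hecke_algebra n"
    and "S = specht_module a b"
  shows "ring.dimension (End_ring H S) 1 (scalar_endos n S) (carrier (End_ring H S))
    \<and> indecomposable H S"
proof -
  obtain p q where pq: "b = 2 * p + 1" "a = 2 * q + 1" using assms by (meson oddE)
  interpret O: odd_hook p q a b "b + 1" n "p + q + 1"
    "presented_cyclic.J (klr_gens n) (klr_relators n) (specht_relators a b) :: (klr_gen, 'f) free_alg set"
    by unfold_locales (simp_all add: pq assms)
  have H: "H = presented_algebra (klr_gens n) (klr_relators n)"
    by (simp add: assms hecke_algebra_def)
  have S: "S = presented_cyclic_module H (presented_class (klr_gens n) (klr_relators n) ` specht_relators a b)"
    by (simp add: assms specht_module_def hecke_class_def)
  have scalar: "scalar_endos n S = range (\<lambda>d. \<lambda>x\<in>carrier S.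
      presented_class (klr_gens n) (klr_relators n) (const d) \<odot>\<^bsub>S\<^esub> x)"
    by (simp add: scalar_endos_def hecke_class_def)
  show ?thesis
    unfolding scalar unfolding S H
    using O.P.dimension_End[OF O.singular_scalar O.one_notin_J] O.P.indecomposable_M[OF O.singular_scalar O.one_notin_J]
    by blast
qed

end
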